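(* Let $n\ge 2$, $s\in(0,1)$ and $M>0$. There exists a constant $\alpha>0$ depending only on $n$, $s$ and $M$ such that the following holds. Let $x_0\in\mathbb{R}^n$, $0<r\le1$, and let $\vec b:B_r(x_0)\to\mathbb{R}^n$ and $c:B_r(x_0)\to\mathbb{R}$ satisfy $\|\vec b\|_{C^1(B_r(x_0))}\le M$ and $c(x)\le M$ in $B_r(x_0)$. Let $m>0$ and let $u\in\mathcal{L}_{2s}$ satisfy $$\begin{cases}(-\Delta)^su+\vec b\cdot\nabla u+c\,u\ge 0 & \text{in }\mathcal{D}'(B_r(x_0)),\\ u\ge m & \text{in }B_r(x_0)\setminus B_{r/2}(x_0),\\ u\ge 0 & \text{in }\mathbb{R}^n.\end{cases}$$ Then $u\ge\alpha m$ in $B_r(x_0)$.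
   Context: $B_r(x_0)$ is the open ball of radius $r$ centered at $x_0$; pointwise inequalities for $u$ are understood almost everywhere. $\mathcal{L}_{\alpha}=\{u:\mathbb{R}^n\to\mathbb{R}\ :\ \int_{\mathbb{R}^n}\frac{|u(y)|}{1+|y|^{n+\alpha}}\,dy<\infty\}$. For $\varphi\in C_c^\infty(\mathbb{R}^n)$, $(-\Delta)^s\varphi(x)=C_{n,s}\,\mathrm{P.V.}\int_{\mathbb{R}^n}\frac{\varphi(x)-\varphi(y)}{|x-y|^{n+2s}}\,dy$, where $C_{n,s}>0$ is the usual normalization constant. The function $c$ is measurable and such that $cu$ is locally integrable on $B_r(x_0)$, so that the inequality makes sense. For an open set $U$, $(-\Delta)^su+\vec b\cdot\nabla u+cu\ge0$ in $\mathcal{D}'(U)$ means $\int_{\mathbb{R}^n}u\,(-\Delta)^s\varphi\,dx+\int_U u\,[-\mathrm{div}(\vec b\,\varphi)+c\,\varphi]\,dx\ge0$ for every nonnegative $\varphi\in C_c^\infty(U)$. *)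

theory Defs
  imports "HOL-Analysis.Analysis"
begin

definition partial_deriv :: "'n \<Rightarrow> (real^'n \<Rightarrow> real) \<Rightarrow> real^'n::finite \<Rightarrow> real" where
  "partial_deriv i f x = frechet_derivative f (at x) (axis i 1)"

primrec Ck :: "nat \<Rightarrow> (real^'n::finite \<Rightarrow> real) \<Rightarrow> bool" where
  "Ck 0 f \<longleftrightarrow> continuous_on UNIV f"
| "Ck (Suc k) f \<longleftrightarrow> f differentiable_on UNIV \<and> (\<forall>i. Ck k (partial_deriv i f))"

definition test_functions :: "(real^'n::finite) set \<Rightarrow> (real^'n \<Rightarrow> real) set" where
  "test_functions U =
     {\<phi>. (\<forall>k. Ck k \<phi>) \<and> compact (closure {x. \<phi> x \<noteq> 0}) \<and> closure {x. \<phi> x \<noteq> 0} \<subseteq> U}"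

definition divergence :: "(real^'n \<Rightarrow> real^'n) \<Rightarrow> real^'n::finite \<Rightarrow> real" where
  "divergence F x = (\<Sum>i\<in>UNIV. partial_deriv i (\<lambda>y. F y $ i) x)"

definition C1_on :: "(real^'n::finite) set \<Rightarrow> (real^'n \<Rightarrow> real^'n) \<Rightarrow> bool" where
  "C1_on U b \<longleftrightarrow> (\<forall>x\<in>U. b differentiable (at x)) \<and>
     continuous_on U (\<lambda>x. jacobian b (at x))"

text \<open>Valued in \<^typ>\<open>ennreal\<close>, so that a bound on the norm does assert that
  \<open>b\<close> and its derivative are bounded on \<open>U\<close> (a \<^typ>\<open>real\<close>-valued supremum
  of an unbounded set would be unspecified).\<close>

definition C1_norm :: "(real^'n::finite) set \<Rightarrow> (real^'n \<Rightarrow> real^'n) \<Rightarrow> ennreal" where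
  "C1_norm U b = (SUP x\<in>U. ennreal (norm (b x))) +
     (SUP x\<in>U. ennreal (onorm (frechet_derivative b (at x))))"

definition weighted_L1 :: "real \<Rightarrow> (real^'n::finite \<Rightarrow> real) set" where
  "weighted_L1 \<alpha> = {u. u \<in> borel_measurable lebesgue \<and>
     integrable lebesgue (\<lambda>y. \<bar>u y\<bar> / (1 + norm y powr (real CARD('n) + \<alpha>)))}"

definition locally_integrable_on :: "(real^'n::finite \<Rightarrow> real) \<Rightarrow> (real^'n) set \<Rightarrow> bool" where
  "locally_integrable_on f U \<longleftrightarrow> (\<forall>K. compact K \<and> K \<subseteq> U \<longrightarrow> set_integrable lebesgue K f)"

text \<open>The closed form of the normalization constant
  \<open>(\<integral> (1 - cos \<zeta>\<^sub>1) / |\<zeta>|^(n+2s) d\<zeta>)^(-1)\<close>, which makes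
  the Fourier symbol of the operator equal to \<open>|\<xi>|^(2s)\<close>.\<close>

definition frac_laplacian_const :: "nat \<Rightarrow> real \<Rightarrow> real" where
  "frac_laplacian_const n s =
     s * 4 powr s * Gamma (real n / 2 + s) / (pi powr (real n / 2) * Gamma (1 - s))"

definition frac_laplacian :: "real \<Rightarrow> (real^'n::finite \<Rightarrow> real) \<Rightarrow> real^'n \<Rightarrow> real" where
  "frac_laplacian s \<phi> x = frac_laplacian_const CARD('n) s *
     Lim (at_right 0) (\<lambda>\<epsilon>. LINT y:(- ball x \<epsilon>)|lebesgue.
       (\<phi> x - \<phi> y) / norm (x - y) powr (real CARD('n) + 2 * s))"

text \<open>The distributional inequality
  \<open>(-\<Delta>)^s u + b \<bullet> \<nabla>u + c u \<ge> 0\<close> in the open set \<open>U\<close>.\<close>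

definition distributional_supersolution ::
  "real \<Rightarrow> (real^'n::finite) set \<Rightarrow> (real^'n \<Rightarrow> real^'n) \<Rightarrow> (real^'n \<Rightarrow> real) \<Rightarrow> (real^'n \<Rightarrow> real) \<Rightarrow> bool"
where
  "distributional_supersolution s U b c u \<longleftrightarrow>
     (\<forall>\<phi>\<in>test_functions U. (\<forall>x. 0 \<le> \<phi> x) \<longrightarrow>
        0 \<le> (LINT x|lebesgue. u x * frac_laplacian s \<phi> x) +
            (LINT x:U|lebesgue. u x * (- divergence (\<lambda>y. \<phi> y *\<^sub>R b y) x + c x * \<phi> x)))"

end

theory Submission
  imports Defs
begin

text \<open>
  Write \<open>K(z) = |z|\<^sup>-\<^sup>n\<^sup>-\<^sup>2\<^sup>s\<close> for the kernel, let \<open>\<rho>\<close> be a smooth bump supported in the unit ball, and let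
  \<open>w(x) = \<integral> u(y) \<rho>((y - x) / \<epsilon>) dy\<close> be the unnormalised mollification of \<open>u\<close> at scale \<open>\<epsilon>\<close>. It suffices to show
  \<open>w \<ge> \<alpha> m \<integral> \<rho>(y / \<epsilon>) dy\<close> on the closed ball of radius \<open>3r/4\<close> for all small \<open>\<epsilon>\<close>, with \<open>\<alpha>\<close> independent of
  \<open>\<epsilon>\<close>: integrating over small cubes and letting \<open>\<epsilon>\<close> tend to \<open>0\<close> bounds the averages of \<open>u\<close> from below, and these
  averages converge to \<open>u\<close> almost everywhere (\<open>AE_lower_of_moll\<close>). Outside that ball the bound is a hypothesis.

  Let \<open>a\<close> minimise the continuous function \<open>w\<close> over this ball. If \<open>a\<close> lies in the annulus where \<open>u \<ge> m\<close>, nothing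
  is left to prove. Otherwise the inequality is tested with \<open>\<phi>(y) = \<rho>((y - a) / \<epsilon>)\<close>, for which the two
  terms are as follows (\<open>min_point_estimate\<close>).

    \<^item> \<^emph>\<open>The drift.\<close> Since \<open>\<nabla>w(a) = 0\<close>, freezing \<open>b\<close> at \<open>a\<close> costs nothing, and the commutator error is at most
      \<open>C \<integral> u\<close> over the \<open>\<epsilon>\<close>-ball around \<open>a\<close>, because \<open>|b(y) - b(a)| \<le> M\<epsilon>\<close> there while \<open>|\<nabla>\<phi>| \<le> C/\<epsilon>\<close>. The terms with
      \<open>div b\<close> and \<open>c\<close> are at most \<open>C w(a)\<close>, as \<open>u \<ge> 0\<close> (\<open>drift_term_bound\<close>).

    \<^item> \<^emph>\<open>The diffusion.\<close> Fubini's theorem turns \<open>\<integral> u (-\<Delta>)\<^sup>s\<phi>\<close> into the limit of truncations of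
      \<open>\<integral> (w(a) - w(a - z)) K(z) dz\<close>. The part of this integral where \<open>a - z\<close> leaves the ball is at most
      \<open>C r\<^sup>-\<^sup>2\<^sup>s w(a)\<close>, since \<open>w \<ge> 0\<close>. All the rest is nonpositive by minimality. The values in the annulus lower
      the bound to \<open>C r\<^sup>-\<^sup>2\<^sup>s w(a) - c r\<^sup>-\<^sup>2\<^sup>s m \<integral> \<rho>(y / \<epsilon>) dy\<close>, and the shell \<open>|z| \<approx> \<epsilon>\<close>, where \<open>K\<close> is of
      size \<open>\<epsilon>\<^sup>-\<^sup>n\<^sup>-\<^sup>2\<^sup>s\<close>, yields a negative multiple of the same \<open>\<integral> u\<close> over the \<open>\<epsilon>\<close>-ball, with a factor that
      grows like \<open>\<epsilon>\<^sup>-\<^sup>2\<^sup>s\<close> compared to the drift error (\<open>nonlocal_bound_at_min\<close>, \<open>shell_mass\<close>).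

  A fraction of order \<open>\<epsilon>\<^sup>2\<^sup>s\<close> of the shell contribution therefore absorbs the drift error, at the price of another
  \<open>C w(a)\<close>. What remains is \<open>c r\<^sup>-\<^sup>2\<^sup>s m \<integral> \<rho>(y / \<epsilon>) dy \<le> C (1 + r\<^sup>-\<^sup>2\<^sup>s) w(a)\<close>, and \<open>r \<le> 1\<close> gives the claim. The drift
  is absorbed at the scale of the mollifier and not at the scale of the ball, so the argument is the same
  for every \<open>s \<in> (0,1)\<close>, including the range \<open>s < 1/2\<close> in which the drift has higher order than the diffusion.
\<close>

section \<open>Smooth bump functions\<close>

text \<open>
  These are \<open>t\<^sup>-\<^sup>j exp(-1/t)\<close> extended by zero. The power is carried along because differentiation raises it.
\<close>

definition flat :: "nat \<Rightarrow> real \<Rightarrow> real" where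
  "flat j t = (if 0 < t then exp (- inverse t) * inverse t ^ j else 0)"

lemma tendsto_flat_at_0: "(flat j \<longlongrightarrow> 0) (at 0)"
proof -
  have "((\<lambda>x::real. x ^ j / exp x) \<longlongrightarrow> 0) at_top"
    by (rule tendsto_power_div_exp_0)
  then have "((\<lambda>t::real. inverse t ^ j / exp (inverse t)) \<longlongrightarrow> 0) (at_right 0)"
    by (rule filterlim_compose) (rule filterlim_inverse_at_top_right)
  then have "(flat j \<longlongrightarrow> 0) (at_right 0)"
    by (rule Lim_transform_eventually)
      (auto simp: flat_def exp_minus field_simps eventually_at_right_less intro!: eventually_at_rightI[of 0 1])
  moreover have "(flat j \<longlongrightarrow> 0) (at_left 0)"
    by (rule tendsto_eventually) (auto simp: flat_def intro!: eventually_at_leftI[of "-1" 0])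
  ultimately show ?thesis
    by (simp add: filterlim_split_at)
qed

text \<open>
  At \<open>t = 0\<close> the difference quotient of \<open>flat j\<close> is \<open>flat (j + 1)\<close> itself, which tends to \<open>0\<close>.
\<close>

lemma has_real_derivative_flat:
  "(flat j has_real_derivative (flat (j + 2) t - real j * flat (j + 1) t)) (at t)"
proof (cases "t = 0")
  case True
  have "((\<lambda>h. flat j h / h) \<longlongrightarrow> 0) (at 0)"
    using tendsto_flat_at_0[of "Suc j"]
    by (rule Lim_transform_eventually) (auto simp: flat_def field_simps)
  with True show ?thesis
    by (simp add: DERIV_def flat_def)
next
  case False
  show ?thesis
  proof (cases "0 < t")
    case True
    have inv: "(inverse has_real_derivative - (inverse t ^ Suc (Suc 0))) (at t)"
      by (rule DERIV_inverse) (use True in blast)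
    have exp_inv: "((\<lambda>t. exp (- inverse t)) has_real_derivative
        exp (- inverse t) * - (- (inverse t ^ Suc (Suc 0)))) (at t)"
      by (rule DERIV_fun_exp[OF DERIV_minus[OF inv]])
    have pow_inv: "((\<lambda>t. inverse t ^ j) has_real_derivative
        real j * (- (inverse t ^ Suc (Suc 0)) * inverse t ^ (j - Suc 0))) (at t)"
      by (rule DERIV_power[OF inv])
    have "E * - (- (x ^ Suc (Suc 0))) * x ^ j + real j * (- (x ^ Suc (Suc 0)) * x ^ (j - Suc 0)) * E =
        E * x ^ (j + 2) - real j * (E * x ^ (j + 1))" for E x :: real
      by (cases j) (simp_all add: algebra_simps)
    from this[of "exp (- inverse t)" "inverse t"]
    have "((\<lambda>t. exp (- inverse t) * inverse t ^ j) has_real_derivative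
        (flat (j + 2) t - real j * flat (j + 1) t)) (at t)"
      using DERIV_mult[OF exp_inv pow_inv] True by (simp only: flat_def if_True)
    then show ?thesis
      by (rule has_field_derivative_transform_within_open[where S = "{0<..}"])
        (use True in \<open>auto simp: flat_def\<close>)
  next
    case neg: False
    have "((\<lambda>t. 0) has_real_derivative (flat (j + 2) t - real j * flat (j + 1) t)) (at t)"
      using neg by (simp add: flat_def)
    then show ?thesis
      by (rule has_field_derivative_transform_within_open[where S = "{..<0}"])
        (use neg False in \<open>auto simp: flat_def\<close>)
  qed
qed

lemma partial_deriv_eq:
  assumes "(f has_derivative f') (at x)"
  shows "partial_deriv i f x = f' (axis i 1)"
  using frechet_derivative_at[OF assms] by (simp add: partial_deriv_def)

text \<open>
  A vector space that contains the bump and is mapped into itself by every partial derivative, so that its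
  members have continuous derivatives of all orders (\<open>Ck_flat_class\<close>).
\<close>

inductive_set flat_class :: "(real^'n::finite \<Rightarrow> real) set" where
  flat: "(\<lambda>x. flat j (1 - x \<bullet> x)) \<in> flat_class"
| scale: "f \<in> flat_class \<Longrightarrow> (\<lambda>x. k * f x) \<in> flat_class"
| coord: "f \<in> flat_class \<Longrightarrow> (\<lambda>x. x $ i * f x) \<in> flat_class"
| add: "f \<in> flat_class \<Longrightarrow> g \<in> flat_class \<Longrightarrow> (\<lambda>x. f x + g x) \<in> flat_class"

lemma flat_class_partial_deriv:
  assumes "f \<in> flat_class"
  shows "f differentiable_on UNIV \<and> (\<forall>i. partial_deriv i f \<in> flat_class)"
  using assms
proof induction
  case (flat j)
  have D: "((\<lambda>x::real^'a. flat j (1 - x \<bullet> x)) has_derivative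
      (\<lambda>h. (flat (j + 2) (1 - x \<bullet> x) - real j * flat (j + 1) (1 - x \<bullet> x)) * (- (2 * (x \<bullet> h))))) (at x)" for x
  proof -
    have "((\<lambda>x::real^'a. 1 - x \<bullet> x) has_derivative (\<lambda>h. - (2 * (x \<bullet> h)))) (at x)"
      by (auto intro!: derivative_eq_intros simp: inner_commute)
    from has_derivative_compose[OF this has_field_derivative_imp_has_derivative[OF has_real_derivative_flat]]
    show ?thesis .
  qed
  have "partial_deriv i (\<lambda>x::real^'a. flat j (1 - x \<bullet> x)) \<in> flat_class" for i
  proof -
    have "partial_deriv i (\<lambda>x::real^'a. flat j (1 - x \<bullet> x)) =
      (\<lambda>x. - 2 * (x $ i * flat (j + 2) (1 - x \<bullet> x)) + (2 * real j) * (x $ i * flat (j + 1) (1 - x \<bullet> x)))"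
      by (rule ext, subst partial_deriv_eq[OF D]) (simp add: inner_axis algebra_simps)
    also have "\<dots> \<in> flat_class"
      by (rule flat_class.add; rule flat_class.scale; rule flat_class.coord; rule flat_class.flat)
    finally show ?thesis .
  qed
  with D show ?case
    by (auto simp: differentiable_on_def differentiable_def)
next
  case (scale f k)
  have D: "((\<lambda>x. k * f x) has_derivative (\<lambda>h. k * frechet_derivative f (at x) h)) (at x)" for x
    using scale.IH by (intro derivative_intros) (auto simp: frechet_derivative_works differentiable_on_def)
  have "partial_deriv i (\<lambda>x. k * f x) = (\<lambda>x. k * partial_deriv i f x)" for i
    by (rule ext, subst partial_deriv_eq[OF D]) (simp add: partial_deriv_def)
  with D scale.IH show ?case
    by (auto simp: differentiable_on_def differentiable_def intro!: flat_class.intros)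
next
  case (coord f k)
  have D: "((\<lambda>x. x $ k * f x) has_derivative (\<lambda>h. x $ k * frechet_derivative f (at x) h + h $ k * f x)) (at x)" for x
    using coord.IH
    by (intro has_derivative_mult bounded_linear_imp_has_derivative bounded_linear_vec_nth)
      (auto simp: frechet_derivative_works differentiable_on_def)
  have "partial_deriv i (\<lambda>x. x $ k * f x) =
      (\<lambda>x. x $ k * partial_deriv i f x + (if i = k then 1 else 0) * f x)" for i
    by (rule ext, subst partial_deriv_eq[OF D]) (simp add: partial_deriv_def axis_def)
  with D coord.IH coord.hyps show ?case
    by (auto simp: differentiable_on_def differentiable_def intro!: flat_class.intros)
next
  case (add f g)
  have D: "((\<lambda>x. f x + g x) has_derivative
      (\<lambda>h. frechet_derivative f (at x) h + frechet_derivative g (at x) h)) (at x)" for x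
    using add.IH by (intro derivative_intros) (auto simp: frechet_derivative_works differentiable_on_def)
  have "partial_deriv i (\<lambda>x. f x + g x) = (\<lambda>x. partial_deriv i f x + partial_deriv i g x)" for i
    by (rule ext, subst partial_deriv_eq[OF D]) (simp add: partial_deriv_def)
  with D add.IH show ?case
    by (auto simp: differentiable_on_def differentiable_def intro!: flat_class.intros)
qed

lemma Ck_flat_class: "f \<in> flat_class \<Longrightarrow> Ck k f"
proof (induction k arbitrary: f)
  case 0
  then show ?case
    using flat_class_partial_deriv differentiable_imp_continuous_on by auto
next
  case (Suc k)
  then show ?case
    using flat_class_partial_deriv by auto
qed

definition bump :: "real^'n::finite \<Rightarrow> real" where
  "bump x = flat 0 (1 - x \<bullet> x)"

lemma bump_nonneg: "0 \<le> bump x"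
  and bump_le_1: "bump x \<le> 1"
  by (auto simp: bump_def flat_def)

lemma bump_eq_0_iff: "bump x = 0 \<longleftrightarrow> 1 \<le> norm x"
proof -
  have "0 < 1 - x \<bullet> x \<longleftrightarrow> norm x < 1"
    by (simp add: dot_square_norm power_less_one_iff)
  then show ?thesis
    by (auto simp: bump_def flat_def)
qed

lemma bump_minus: "bump (- x) = bump x"
  by (simp add: bump_def)

text \<open>
  The factor \<open>c\<close> makes the induction go through: each derivative of the rescaled function gains a factor \<open>1/e\<close>.
\<close>

lemma Ck_compose_affine:
  "Ck k f \<Longrightarrow> Ck k (\<lambda>y. c * f ((y - a) /\<^sub>R e))" for f :: "real^'n::finite \<Rightarrow> real"
proof (induction k arbitrary: f c)
  case 0
  then have "continuous_on UNIV f" by simp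
  then have "continuous_on UNIV (\<lambda>y. f ((y - a) /\<^sub>R e))"
    by (rule continuous_on_compose2) (auto intro!: continuous_intros)
  then show ?case by (auto intro!: continuous_intros)
next
  case (Suc k)
  then have f: "f differentiable_on UNIV" "\<And>i. Ck k (partial_deriv i f)" by auto
  have D: "((\<lambda>y. c * f ((y - a) /\<^sub>R e)) has_derivative
      (\<lambda>h. c * frechet_derivative f (at ((x - a) /\<^sub>R e)) (h /\<^sub>R e))) (at x)" for x
  proof -
    have "((\<lambda>y. (y - a) /\<^sub>R e) has_derivative (\<lambda>h. h /\<^sub>R e)) (at x)"
      by (auto intro!: derivative_eq_intros)
    moreover have "(f has_derivative frechet_derivative f (at ((x - a) /\<^sub>R e))) (at ((x - a) /\<^sub>R e))"
      using f by (simp add: frechet_derivative_works[symmetric] differentiable_on_def)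
    ultimately have "((\<lambda>y. f ((y - a) /\<^sub>R e)) has_derivative
      (\<lambda>h. frechet_derivative f (at ((x - a) /\<^sub>R e)) (h /\<^sub>R e))) (at x)"
      by (rule has_derivative_compose)
    then show ?thesis by (intro derivative_intros)
  qed
  have "partial_deriv i (\<lambda>y. c * f ((y - a) /\<^sub>R e)) =
      (\<lambda>x. (c / e) * partial_deriv i f ((x - a) /\<^sub>R e))" for i
  proof (rule ext)
    fix x
    have "linear (frechet_derivative f (at ((x - a) /\<^sub>R e)))"
      using f by (intro linear_frechet_derivative) (simp add: differentiable_on_def)
    then show "partial_deriv i (\<lambda>y. c * f ((y - a) /\<^sub>R e)) x =
      (c / e) * partial_deriv i f ((x - a) /\<^sub>R e)"
      by (subst partial_deriv_eq[OF D]) (simp add: partial_deriv_def linear_scale divide_inverse)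
  qed
  then have "Ck k (partial_deriv i (\<lambda>y. c * f ((y - a) /\<^sub>R e)))" for i
    using Suc.IH[OF f(2)] by (simp only:)
  with D show ?case
    by (auto simp: differentiable_on_def differentiable_def)
qed

lemma test_functions_rescaled_bump:
  fixes a :: "real^'n::finite"
  assumes "0 < e" "cball a e \<subseteq> V"
  shows "(\<lambda>y. bump ((y - a) /\<^sub>R e)) \<in> test_functions V"
proof -
  have "bump \<in> flat_class"
    unfolding bump_def by (rule flat_class.flat)
  from Ck_compose_affine[OF Ck_flat_class[OF this], of _ 1]
  have "Ck k (\<lambda>y. bump ((y - a) /\<^sub>R e))" for k by simp
  moreover have "{y. bump ((y - a) /\<^sub>R e) \<noteq> 0} \<subseteq> cball a e"
  proof
    fix y
    assume "y \<in> {y. bump ((y - a) /\<^sub>R e) \<noteq> 0}"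
    then have "norm ((y - a) /\<^sub>R e) < 1"
      by (simp only: bump_eq_0_iff not_le mem_Collect_eq)
    then have "inverse e * norm (y - a) < 1"
      using assms(1) by (simp only: norm_scaleR) simp
    then have "norm (y - a) < e"
      using assms(1) by (simp add: field_simps)
    then show "y \<in> cball a e"
      using assms(1) by (simp add: dist_norm norm_minus_commute)
  qed
  then have "closure {y. bump ((y - a) /\<^sub>R e) \<noteq> 0} \<subseteq> cball a e"
    by (rule closure_minimal) simp
  moreover from this have "compact (closure {y. bump ((y - a) /\<^sub>R e) \<noteq> 0})"
    by (meson bounded_cball bounded_subset closed_closure compact_eq_bounded_closed)
  ultimately show ?thesis
    using assms(2) by (auto simp: test_functions_def)
qed

section \<open>Calculus of test functions\<close>

definition grad :: "(real^'n::finite \<Rightarrow> real) \<Rightarrow> real^'n \<Rightarrow> real^'n" where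
  "grad \<phi> x = (\<chi> i. partial_deriv i \<phi> x)"

context
  fixes \<phi> :: "real^'n::finite \<Rightarrow> real" and V :: "(real^'n) set"
  assumes test: "\<phi> \<in> test_functions V"
begin

lemma test_function_differentiable: "\<phi> differentiable (at x)"
proof -
  have "Ck (Suc 0) \<phi>"
    using test unfolding test_functions_def by blast
  then show ?thesis
    by (simp add: differentiable_on_def)
qed

lemma test_function_has_derivative: "(\<phi> has_derivative (\<lambda>h. grad \<phi> x \<bullet> h)) (at x)"
proof -
  let ?D = "frechet_derivative \<phi> (at x)"
  have D: "(\<phi> has_derivative ?D) (at x)"
    using test_function_differentiable by (simp add: frechet_derivative_works)
  have "?D h = grad \<phi> x \<bullet> h" for h
  proof -
    have "?D h = ?D (\<Sum>i\<in>UNIV. h $ i *\<^sub>R axis i 1)"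
      by (simp add: basis_expansion flip: scalar_mult_eq_scaleR)
    also have "\<dots> = (\<Sum>i\<in>UNIV. h $ i * ?D (axis i 1))"
      using has_derivative_linear[OF D] by (simp add: linear_sum linear_scale)
    finally show ?thesis
      by (simp add: grad_def inner_vec_def partial_deriv_def mult.commute)
  qed
  then have "?D = (\<lambda>h. grad \<phi> x \<bullet> h)"
    by (rule ext)
  with D show ?thesis
    by (simp only:)
qed

lemma test_function_continuous: "continuous_on A \<phi>"
  using test_function_differentiable
  by (meson continuous_at_imp_continuous_on differentiable_imp_continuous_within)

lemma test_function_borel [measurable]: "\<phi> \<in> borel_measurable borel"
  by (rule borel_measurable_continuous_onI) (rule test_function_continuous)

lemma partial_deriv_test_function: "partial_deriv i \<phi> \<in> test_functions V"
proof -
  let ?S = "closure {x. \<phi> x \<noteq> 0}"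
  have "partial_deriv i \<phi> x = 0" if "x \<notin> ?S" for x
  proof -
    have "((\<lambda>_. 0) has_derivative (\<lambda>_. 0)) (at x)"
      by simp
    then have "(\<phi> has_derivative (\<lambda>_. 0)) (at x)"
      by (rule has_derivative_transform_within_open[where s = "- ?S"])
        (use that closure_subset[of "{x. \<phi> x \<noteq> 0}"] in auto)
    then show ?thesis
      by (simp add: partial_deriv_eq)
  qed
  then have sub: "closure {x. partial_deriv i \<phi> x \<noteq> 0} \<subseteq> ?S"
    by (intro closure_minimal) auto
  have S: "compact ?S" "?S \<subseteq> V" and Ck: "Ck k \<phi>" for k
    using test by (auto simp: test_functions_def)
  have "compact (closure {x. partial_deriv i \<phi> x \<noteq> 0})"
    using compact_Int_closed[OF S(1) closed_closure[of "{x. partial_deriv i \<phi> x \<noteq> 0}"]] sub by (simp only: inf.absorb2)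
  moreover have "Ck k (partial_deriv i \<phi>)" for k
    using Ck[of "Suc k"] by simp
  ultimately show ?thesis
    using sub S(2) by (simp add: test_functions_def)
qed

lemma test_function_bounded: "\<exists>B\<ge>0. \<forall>x. \<bar>\<phi> x\<bar> \<le> B"
proof -
  let ?S = "closure {x. \<phi> x \<noteq> 0}"
  have "compact (\<phi> ` ?S)"
    using test by (intro compact_continuous_image test_function_continuous) (auto simp: test_functions_def)
  then obtain B where B: "\<And>x. x \<in> ?S \<Longrightarrow> \<bar>\<phi> x\<bar> \<le> B"
    using compact_imp_bounded[THEN bounded_iff[THEN iffD1]] by fastforce
  have "\<bar>\<phi> x\<bar> \<le> max B 0" for x
    using B[of x] closure_subset[of "{x. \<phi> x \<noteq> 0}"] by (cases "\<phi> x = 0") auto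
  then show ?thesis
    by (intro exI[of _ "max B 0"]) auto
qed

end

lemma grad_bounded:
  assumes "\<phi> \<in> test_functions V"
  shows "\<exists>L\<ge>0. \<forall>x. norm (grad \<phi> x) \<le> L"
proof -
  obtain B where B: "\<And>i x. \<bar>partial_deriv i \<phi> x\<bar> \<le> B i"
    using test_function_bounded[OF partial_deriv_test_function[OF assms]] by metis
  have "norm (grad \<phi> x) \<le> (\<Sum>i\<in>UNIV. B i)" for x
  proof -
    have "norm (grad \<phi> x) \<le> (\<Sum>i\<in>UNIV. \<bar>grad \<phi> x $ i\<bar>)"
      by (rule norm_le_l1_cart)
    also have "\<dots> \<le> (\<Sum>i\<in>UNIV. B i)"
      using B by (intro sum_mono) (simp add: grad_def)
    finally show ?thesis .
  qed
  then show ?thesis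
    by (intro exI[of _ "\<Sum>i\<in>UNIV. B i"] conjI allI) (auto intro: order_trans[OF norm_ge_zero])
qed

lemma lipschitz_of_grad_bound:
  assumes "\<phi> \<in> test_functions V" "\<And>x. norm (grad \<phi> x) \<le> L"
  shows "\<bar>\<phi> x - \<phi> y\<bar> \<le> L * norm (x - y)"
proof -
  have "norm (\<phi> x - \<phi> y) \<le> L * norm (x - y)"
  proof (rule differentiable_bound[of UNIV _ "\<lambda>x h. grad \<phi> x \<bullet> h"])
    show "onorm ((\<bullet>) (grad \<phi> x)) \<le> L" for x
    proof (rule onorm_bound)
      show "norm (grad \<phi> x \<bullet> h) \<le> L * norm h" for h
        using Cauchy_Schwarz_ineq2[of "grad \<phi> x" h] mult_right_mono[OF assms(2)[of x] norm_ge_zero[of h]]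
        by simp
      show "0 \<le> L"
        using assms(2)[of x] norm_ge_zero order_trans by blast
    qed
  qed (use test_function_has_derivative[OF assms(1)] in auto)
  then show ?thesis by simp
qed

lemma grad_lipschitz:
  assumes "\<phi> \<in> test_functions V"
  shows "\<exists>L\<ge>0. \<forall>x y. norm (grad \<phi> x - grad \<phi> y) \<le> L * norm (x - y)"
proof -
  have "\<exists>L. L \<ge> 0 \<and> (\<forall>x y. \<bar>partial_deriv i \<phi> x - partial_deriv i \<phi> y\<bar> \<le> L * norm (x - y))" for i
    using lipschitz_of_grad_bound[OF partial_deriv_test_function[OF assms]]
      grad_bounded[OF partial_deriv_test_function[OF assms]] by metis
  then obtain L where L: "\<And>i. L i \<ge> 0"
      "\<And>i x y. \<bar>partial_deriv i \<phi> x - partial_deriv i \<phi> y\<bar> \<le> L i * norm (x - y)"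
    by metis
  have "norm (grad \<phi> x - grad \<phi> y) \<le> (\<Sum>i\<in>UNIV. L i) * norm (x - y)" for x y
  proof -
    have "norm (grad \<phi> x - grad \<phi> y) \<le> (\<Sum>i\<in>UNIV. \<bar>(grad \<phi> x - grad \<phi> y) $ i\<bar>)"
      by (rule norm_le_l1_cart)
    also have "\<dots> \<le> (\<Sum>i\<in>UNIV. L i * norm (x - y))"
      using L(2) by (intro sum_mono) (simp add: grad_def)
    finally show ?thesis by (simp add: sum_distrib_right)
  qed
  then show ?thesis
    using L(1) by (meson sum_nonneg)
qed

text \<open>
  The first-order Taylor remainder is quadratic because the gradient is Lipschitz, and in the symmetric second
  difference the linear terms cancel. This cancellation is what makes the principal value converge.
\<close>

lemma second_difference_bound:
  fixes \<phi> :: "real^'n::finite \<Rightarrow> real"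
  assumes test: "\<phi> \<in> test_functions V"
  shows "\<exists>C\<ge>0. \<forall>x z. \<bar>2 * \<phi> x - \<phi> (x + z) - \<phi> (x - z)\<bar> \<le> C * norm z ^ 2"
proof -
  obtain L where L: "L \<ge> 0" "\<And>x y. norm (grad \<phi> x - grad \<phi> y) \<le> L * norm (x - y)"
    using grad_lipschitz[OF test] by metis
  have taylor: "\<bar>\<phi> (x + z) - \<phi> x - grad \<phi> x \<bullet> z\<bar> \<le> L * norm z ^ 2" for x z
  proof -
    define f where "f y = \<phi> (x + y) - grad \<phi> x \<bullet> y" for y
    have D: "(f has_derivative (\<lambda>h. (grad \<phi> (x + y) - grad \<phi> x) \<bullet> h)) (at y within cball 0 (norm z))" for y
    proof -
      have "((\<lambda>y. \<phi> (x + y)) has_derivative (\<lambda>h. grad \<phi> (x + y) \<bullet> h)) (at y within cball 0 (norm z))"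
        by (rule has_derivative_compose[OF _ test_function_has_derivative[OF test]])
          (auto intro!: derivative_eq_intros)
      then have "((\<lambda>y. \<phi> (x + y) - grad \<phi> x \<bullet> y) has_derivative
          (\<lambda>h. grad \<phi> (x + y) \<bullet> h - grad \<phi> x \<bullet> h)) (at y within cball 0 (norm z))"
        by (intro derivative_intros) auto
      then show ?thesis
        by (simp add: f_def[abs_def] inner_diff_left)
    qed
    have "norm (f z - f 0) \<le> (L * norm z) * norm (z - 0)"
    proof (rule differentiable_bound[OF _ D])
      show "onorm ((\<bullet>) (grad \<phi> (x + y) - grad \<phi> x)) \<le> L * norm z"
        if "y \<in> cball 0 (norm z)" for y
      proof (rule onorm_bound)
        have "norm (grad \<phi> (x + y) - grad \<phi> x) \<le> L * norm y"
          using L(2)[of "x + y" x] by simp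
        also have "\<dots> \<le> L * norm z"
          using that L(1) by (auto intro: mult_left_mono)
        finally have "norm (grad \<phi> (x + y) - grad \<phi> x) * norm h \<le> L * norm z * norm h" for h :: "real^'n"
          by (rule mult_right_mono) simp
        then show "norm ((grad \<phi> (x + y) - grad \<phi> x) \<bullet> h) \<le> L * norm z * norm h" for h
          using Cauchy_Schwarz_ineq2[of "grad \<phi> (x + y) - grad \<phi> x" h] order_trans
          unfolding real_norm_def by blast
      qed (use L(1) in simp)
    qed auto
    then show ?thesis
      by (simp add: f_def power2_eq_square algebra_simps)
  qed
  have "\<bar>2 * \<phi> x - \<phi> (x + z) - \<phi> (x - z)\<bar> \<le> (2 * L) * norm z ^ 2" for x z
    using taylor[of x z] taylor[of x "- z"] by simp
  with L(1) show ?thesis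
    by (intro exI[of _ "2 * L"]) auto
qed

section \<open>Integrability of the kernel\<close>

text \<open>
  Integrability by a dyadic decomposition: a function that on each level is dominated by a constant on a ball
  is dominated by the sum of these pieces, whose integrals are proportional to \<open>h k * R k ^ n\<close>. With geometric
  sequences this replaces integration in polar coordinates.
\<close>

lemma integral_bound_by_balls:
  fixes f :: "real^'n::finite \<Rightarrow> real"
  assumes [measurable]: "f \<in> borel_measurable borel" and nonneg: "\<And>z. 0 \<le> f z"
    and cover: "\<And>z. f z \<noteq> 0 \<Longrightarrow> \<exists>k. norm z < R k \<and> f z \<le> h k"
    and pos: "\<And>k. 0 \<le> h k" "\<And>k. 0 \<le> R k"
    and summable: "summable (\<lambda>k. h k * R k ^ CARD('n))"
  shows "integrable lborel f"
    and "(LINT z|lborel. f z) \<le> measure lborel (ball 0 1 :: (real^'n) set) * (\<Sum>k. h k * R k ^ CARD('n))"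
proof -
  let ?B = "\<lambda>k. ball (0 :: real^'n) (R k)" and ?v = "measure lborel (ball 0 1 :: (real^'n) set)"
  have meas: "emeasure lborel (?B k) = ennreal (?v * R k ^ CARD('n))" for k
    using pos(2)[of k] content_ball_conv_unit_ball[of "R k" "0 :: real^'n"]
      emeasure_lborel_ball_finite[of "0 :: real^'n" "R k"]
    by (subst emeasure_eq_ennreal_measure) (auto simp: mult.commute)
  have "(\<integral>\<^sup>+z. ennreal (f z) \<partial>lborel) \<le> (\<integral>\<^sup>+z. (\<Sum>k. ennreal (h k) * indicator (?B k) z) \<partial>lborel)"
  proof (rule nn_integral_mono)
    fix z :: "real^'n"
    show "ennreal (f z) \<le> (\<Sum>k. ennreal (h k) * indicator (?B k) z)"
    proof (cases "f z = 0")
      case False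
      then obtain k where k: "norm z < R k" "f z \<le> h k"
        using cover by blast
      then have "ennreal (f z) \<le> ennreal (h k) * indicator (?B k) z"
        by (simp add: ennreal_leI)
      also have "\<dots> \<le> (\<Sum>k. ennreal (h k) * indicator (?B k) z)"
      proof -
        have "g k \<le> (\<Sum>k. g k)" for g :: "nat \<Rightarrow> ennreal"
          using sum_le_suminf[of g "{k}"] by simp
        then show ?thesis .
      qed
      finally show ?thesis .
    qed simp
  qed
  also have "\<dots> = (\<Sum>k. ennreal (h k) * emeasure lborel (?B k))"
  proof (subst nn_integral_suminf)
    show "(\<lambda>z. ennreal (h k) * indicator (?B k) z) \<in> borel_measurable lborel" for k
      by (intro borel_measurable_times_ennreal borel_measurable_indicator borel_measurable_const) simp
  qed (subst nn_integral_cmult_indicator, auto)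
  also have "\<dots> = (\<Sum>k. ennreal (?v * (h k * R k ^ CARD('n))))"
    using pos by (simp add: meas ennreal_mult'[symmetric] mult_ac)
  also have "\<dots> = ennreal (?v * (\<Sum>k. h k * R k ^ CARD('n)))"
    using pos summable by (subst suminf_ennreal2) (auto simp: suminf_mult intro!: summable_mult)
  finally have le: "(\<integral>\<^sup>+z. ennreal (f z) \<partial>lborel) \<le> ennreal (?v * (\<Sum>k. h k * R k ^ CARD('n)))" .
  show "integrable lborel f"
    using nonneg le by (intro integrableI_bounded) (auto simp: order_le_less_trans)
  have "0 \<le> (\<Sum>k. h k * R k ^ CARD('n))"
    using pos summable by (intro suminf_nonneg) auto
  then show "(LINT z|lborel. f z) \<le> ?v * (\<Sum>k. h k * R k ^ CARD('n))"
    using nonneg le by (subst integral_eq_nn_integral) (auto intro!: enn2real_leI)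
qed

lemma ex_dyadic:
  fixes y :: real
  assumes "1 \<le> y"
  shows "\<exists>k. 2 ^ k \<le> y \<and> y < 2 ^ Suc k"
proof -
  define n where "n = (LEAST n. y < 2 ^ n)"
  have "\<exists>n. y < 2 ^ n"
    by (rule real_arch_pow) simp
  then have n: "y < 2 ^ n"
    unfolding n_def by (rule LeastI_ex)
  with assms obtain k where k: "n = Suc k"
    by (cases n) auto
  then have "\<not> y < 2 ^ k"
    using not_less_Least[of k "\<lambda>n. y < 2 ^ n"] unfolding n_def by simp
  with n k show ?thesis
    by (intro exI[of _ k]) auto
qed

lemma powr_of_power: "0 < x \<Longrightarrow> (x ^ k) powr a = (x powr a) ^ k" for x a :: real
  by (induction k) (simp_all add: powr_mult)

definition kern :: "real \<Rightarrow> real^'n::finite \<Rightarrow> real" where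
  "kern s z = 1 / norm z powr (real CARD('n) + 2 * s)"

lemma kern_nonneg [simp]: "0 \<le> kern s z"
  by (simp add: kern_def)

lemma kern_minus [simp]: "kern s (- z) = kern s z"
  by (simp add: kern_def)

lemma kern_borel [measurable]: "kern s \<in> borel_measurable borel"
  unfolding kern_def[abs_def] by measurable

lemma kern_antimono:
  fixes z :: "real^'n::finite"
  assumes "0 < s" "0 < R" "R \<le> norm z"
  shows "kern s z \<le> 1 / R powr (real CARD('n) + 2 * s)"
  unfolding kern_def using assms by (intro divide_left_mono powr_mono2 mult_pos_pos) auto

lemma kern_lower:
  fixes z :: "real^'n::finite"
  assumes "0 < s" "z \<noteq> 0" "norm z \<le> R"
  shows "1 / R powr (real CARD('n) + 2 * s) \<le> kern s z"
proof -
  have "0 < R"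
    using assms by (meson less_le_trans zero_less_norm_iff)
  with assms show ?thesis
    unfolding kern_def by (intro divide_left_mono powr_mono2 mult_pos_pos) auto
qed

text \<open>
  On the shell \<open>2\<^sup>k d \<le> |z| < 2\<^sup>k\<^sup>+\<^sup>1 d\<close> the kernel times the volume is of order \<open>(2\<^sup>k d)\<^sup>-\<^sup>2\<^sup>s\<close>, a geometric
  sequence in \<open>k\<close>; its sum also shows the scaling \<open>d\<^sup>-\<^sup>2\<^sup>s\<close>.
\<close>

lemma kern_tail:
  fixes s :: real
  assumes "0 < s"
  shows "0 < d \<Longrightarrow> integrable lborel (\<lambda>z::real^'n::finite. indicator (- ball 0 d) z * kern s z)"
    and "\<exists>C>0. \<forall>d>0. (LINT z|lborel. indicator (- ball 0 d) z * kern s (z::real^'n)) \<le> C * d powr (- (2 * s))"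
proof -
  let ?p = "real CARD('n) + 2 * s"
  define q :: real where "q = 2 powr (- (2 * s))"
  have q: "0 < q" "q < 1"
    using assms by (auto simp: q_def powr_less_one)
  have term_eq: "1 / (2 ^ k * d) powr ?p * (2 ^ Suc k * d) ^ CARD('n) = (2 ^ CARD('n) * d powr (- (2 * s))) * q ^ k"
    if "0 < d" for d :: real and k
  proof -
    have "(2 ^ k * d) powr ?p = (2 ^ k * d) ^ CARD('n) * (2 ^ k * d) powr (2 * s)"
      using that by (simp add: powr_add powr_realpow)
    moreover have "(2 ^ k * d) powr (2 * s) * (q ^ k * d powr (- (2 * s))) = 1"
    proof -
      have "(2 ^ k * d) powr (2 * s) * (q ^ k * d powr (- (2 * s))) =
          (2 powr (2 * s) * q) ^ k * (d powr (2 * s) * d powr (- (2 * s)))"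
        using that by (simp add: powr_mult powr_of_power power_mult_distrib)
      also have "\<dots> = 1"
        using that by (simp add: q_def flip: powr_add)
      finally show ?thesis .
    qed
    then have "q ^ k * d powr (- (2 * s)) = 1 / (2 ^ k * d) powr (2 * s)"
      using that by (simp add: field_simps)
    moreover have "(2 ^ CARD('n) * d powr (- (2 * s))) * q ^ k = 2 ^ CARD('n) * (q ^ k * d powr (- (2 * s)))"
      by simp
    ultimately show ?thesis
      using that by (simp add: power_mult_distrib)
  qed
  have tail: "integrable lborel (\<lambda>z::real^'n. indicator (- ball 0 d) z * kern s z)"
      "(LINT z|lborel. indicator (- ball 0 d) z * kern s (z::real^'n)) \<le>
        measure lborel (ball 0 1 :: (real^'n) set) * (\<Sum>k. (2 ^ CARD('n) * d powr (- (2 * s))) * q ^ k)" if "0 < d" for d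
  proof -
    have cover: "\<exists>k. norm z < 2 ^ Suc k * d \<and> indicator (- ball 0 d) z * kern s z \<le> 1 / (2 ^ k * d) powr ?p"
      if "indicator (- ball 0 d) z * kern s z \<noteq> 0" for z :: "real^'n"
    proof -
      have z: "d \<le> norm z"
        using that by (auto simp: indicator_def split: if_splits)
      then obtain k where k: "2 ^ k \<le> norm z / d" "norm z / d < 2 ^ Suc k"
        using ex_dyadic[of "norm z / d"] \<open>0 < d\<close> by auto
      then have "2 ^ k * d \<le> norm z" "norm z < 2 ^ Suc k * d"
        using \<open>0 < d\<close> by (auto simp: field_simps)
      then show ?thesis
        using kern_antimono[of s "2 ^ k * d" z] assms \<open>0 < d\<close> z by (intro exI[of _ k]) auto
    qed
    have sm: "summable (\<lambda>k. 1 / (2 ^ k * d) powr ?p * (2 ^ Suc k * d) ^ CARD('n))"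
      unfolding term_eq[OF \<open>0 < d\<close>] using q by (intro summable_mult summable_geometric) auto
    note * = integral_bound_by_balls[OF _ _ cover _ _ sm]
    show "integrable lborel (\<lambda>z::real^'n. indicator (- ball 0 d) z * kern s z)"
      by (rule *(1)) (use \<open>0 < d\<close> in auto)
    show "(LINT z|lborel. indicator (- ball 0 d) z * kern s (z::real^'n)) \<le>
        measure lborel (ball 0 1 :: (real^'n) set) * (\<Sum>k. (2 ^ CARD('n) * d powr (- (2 * s))) * q ^ k)"
      unfolding term_eq[OF \<open>0 < d\<close>, symmetric] by (rule *(2)) (use \<open>0 < d\<close> in auto)
  qed
  show "0 < d \<Longrightarrow> integrable lborel (\<lambda>z::real^'n. indicator (- ball 0 d) z * kern s z)"
    by (rule tail(1))
  have "0 < measure lborel (ball 0 1 :: (real^'n) set)"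
    by (rule content_ball_pos) simp
  moreover have "(\<Sum>k. (2 ^ CARD('n) * d powr (- (2 * s))) * q ^ k) =
      (2 ^ CARD('n) / (1 - q)) * d powr (- (2 * s))" for d
    using q by (subst suminf_mult) (auto simp: suminf_geometric)
  ultimately show "\<exists>C>0. \<forall>d>0. (LINT z|lborel. indicator (- ball 0 d) z * kern s (z::real^'n)) \<le> C * d powr (- (2 * s))"
    using tail(2) q
    by (intro exI[of _ "measure lborel (ball 0 1 :: (real^'n) set) * (2 ^ CARD('n) / (1 - q))"])
      (simp add: mult.assoc)
qed

text \<open>
  On the shell \<open>2\<^sup>-\<^sup>k\<^sup>-\<^sup>1 < |z| \<le> 2\<^sup>-\<^sup>k\<close> the integrand times the volume is of order \<open>2\<^sup>-\<^sup>k\<^sup>(\<^sup>2\<^sup>-\<^sup>2\<^sup>s\<^sup>)\<close>, which is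
  summable exactly because \<open>s < 1\<close>.
\<close>

lemma kern_near:
  fixes s :: real
  assumes "0 < s" "s < 1"
  shows "integrable lborel (\<lambda>z::real^'n::finite. indicator (ball 0 1) z * (norm z ^ 2 * kern s z))"
proof -
  let ?p = "real CARD('n) + 2 * s"
  define q :: real where "q = 2 powr (2 * s - 2)"
  have q: "0 < q" "q < 1"
    using assms by (auto simp: q_def powr_less_one)
  have term_eq: "(2 * inverse 2 ^ k) ^ 2 / (inverse 2 ^ Suc k) powr ?p * (2 * inverse 2 ^ k) ^ CARD('n) =
      (2 ^ CARD('n) * 4 * 2 powr ?p) * q ^ k" for k
  proof -
    define x :: real where "x = inverse 2 ^ k"
    have x: "0 < x" by (simp add: x_def)
    have "inverse 2 ^ Suc k = x / 2"
      by (simp add: x_def)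
    then have "(inverse 2 ^ Suc k) powr ?p = x powr ?p / 2 powr ?p"
      using x by (simp add: powr_divide)
    moreover have "x powr ?p = x ^ CARD('n) * x ^ 2 * x powr (2 * s - 2)"
      using x by (simp add: powr_realpow[symmetric] powr_add[symmetric] del: powr_numeral)
    moreover have "x powr (2 * s - 2) * q ^ k = 1"
    proof -
      have "x powr (2 * s - 2) * q ^ k = (inverse 2 powr (2 * s - 2) * 2 powr (2 * s - 2)) ^ k"
        by (simp add: x_def q_def powr_of_power power_mult_distrib)
      also have "inverse 2 powr (2 * s - 2) * 2 powr (2 * s - 2) = (1::real)"
        by (subst powr_mult[symmetric]) auto
      finally show ?thesis
        by simp
    qed
    then have "x powr (2 * s - 2) = 1 / q ^ k"
      using q by (simp add: field_simps)
    ultimately show ?thesis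
      using x q unfolding x_def[symmetric] by (simp add: power_mult_distrib field_simps)
  qed
  show ?thesis
  proof (rule integral_bound_by_balls(1))
    show "\<exists>k. norm z < 2 * inverse 2 ^ k \<and>
        indicator (ball 0 1) z * (norm z ^ 2 * kern s z) \<le> (2 * inverse 2 ^ k) ^ 2 / (inverse 2 ^ Suc k) powr ?p"
      if "indicator (ball 0 1) z * (norm z ^ 2 * kern s z) \<noteq> 0" for z :: "real^'n"
    proof -
      have z: "0 < norm z" "norm z < 1"
        using that by (auto simp: indicator_def split: if_splits)
      then obtain k where k: "2 ^ k \<le> 1 / norm z" "1 / norm z < 2 ^ Suc k"
        using ex_dyadic[of "1 / norm z"] by auto
      then have zk: "inverse 2 ^ Suc k \<le> norm z" "norm z < 2 * inverse 2 ^ k"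
        using z by (auto simp: field_simps power_inverse intro: less_le_trans[of _ 1])
      have "norm z ^ 2 * kern s z \<le> (2 * inverse 2 ^ k) ^ 2 * (1 / (inverse 2 ^ Suc k) powr ?p)"
        using zk assms by (intro mult_mono power_mono kern_antimono) auto
      with zk z show ?thesis
        by (intro exI[of _ k]) simp
    qed
    show "summable (\<lambda>k. (2 * inverse 2 ^ k) ^ 2 / (inverse 2 ^ Suc k) powr ?p * (2 * inverse 2 ^ k) ^ CARD('n))"
      unfolding term_eq using q by (intro summable_mult summable_geometric) auto
    show "(\<lambda>z::real^'n. indicator (ball 0 1) z * (norm z ^ 2 * kern s z)) \<in> borel_measurable borel"
      by (intro borel_measurable_times borel_measurable_indicator borel_measurable_power
        borel_measurable_norm kern_borel) auto
  qed auto
qed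

section \<open>Truncated fractional Laplacians\<close>

definition trunc_kern :: "real \<Rightarrow> real \<Rightarrow> real^'n::finite \<Rightarrow> real" where
  "trunc_kern s d z = indicator (- ball 0 d) z * kern s z"

lemma trunc_kern_nonneg [simp]: "0 \<le> trunc_kern s d z"
  by (simp add: trunc_kern_def)

lemma trunc_kern_minus [simp]: "trunc_kern s d (- z) = trunc_kern s d z"
  by (simp add: trunc_kern_def indicator_def)

lemma trunc_kern_borel [measurable]: "trunc_kern s d \<in> borel_measurable borel"
  unfolding trunc_kern_def[abs_def]
  by (intro borel_measurable_times borel_measurable_indicator kern_borel) auto

lemma integrable_trunc_kern:
  "0 < s \<Longrightarrow> 0 < d \<Longrightarrow> integrable lborel (trunc_kern s d :: real^'n::finite \<Rightarrow> real)"
  unfolding trunc_kern_def[abs_def] by (rule kern_tail(1))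

text \<open>
  The weight in the definition of the function space, which is also the rate at which the fractional
  Laplacian of a test function decays.
\<close>

definition decay :: "real \<Rightarrow> real^'n::finite \<Rightarrow> real" where
  "decay s x = 1 / (1 + norm x powr (real CARD('n) + 2 * s))"

lemma decay_pos [simp]: "0 < decay s x"
  by (simp add: decay_def add_pos_nonneg)

lemma decay_nonneg [simp]: "0 \<le> decay s x"
  using decay_pos by (rule less_imp_le)

lemma decay_lower:
  fixes x :: "real^'n::finite"
  assumes "0 < s" "norm x \<le> R"
  shows "1 \<le> (1 + R powr (real CARD('n) + 2 * s)) * decay s x"
proof -
  have "norm x powr (real CARD('n) + 2 * s) \<le> R powr (real CARD('n) + 2 * s)"
    using assms by (intro powr_mono2) auto
  then show ?thesis
    by (simp add: decay_def add_pos_nonneg)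
qed

lemma inverse_power_le_decay:
  fixes x :: "real^'n::finite"
  assumes "0 < s" "1 \<le> norm x"
  shows "1 / norm x powr (real CARD('n) + 2 * s) \<le> 2 * decay s x"
proof -
  have "1 \<le> norm x powr (real CARD('n) + 2 * s)"
    using assms by (intro ge_one_powr_ge_zero) auto
  moreover have "1 / t \<le> 2 * (1 / (1 + t))" if "1 \<le> t" for t :: real
    using that by (simp add: field_simps)
  ultimately show ?thesis
    unfolding decay_def by blast
qed

lemma integrable_mult_bounded:
  fixes f g :: "'a \<Rightarrow> real"
  assumes "integrable M f" and [measurable]: "g \<in> borel_measurable M"
    and "\<And>x. \<bar>g x\<bar> \<le> B"
  shows "integrable M (\<lambda>x. f x * g x)"
proof (rule Bochner_Integration.integrable_bound)
  show "integrable M (\<lambda>x. B * f x)"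
    using assms(1) by simp
  have "0 \<le> B" using assms(3)[of undefined] by linarith
  have [measurable]: "f \<in> borel_measurable M"
    by (rule borel_measurable_integrable[OF assms(1)])
  show "(\<lambda>x. f x * g x) \<in> borel_measurable M"
    by measurable
  show "AE x in M. norm (f x * g x) \<le> norm (B * f x)"
  proof (rule AE_I2)
    fix x
    have "\<bar>f x\<bar> * \<bar>g x\<bar> \<le> \<bar>f x\<bar> * B"
      by (rule mult_left_mono) (auto simp: assms(3))
    with \<open>0 \<le> B\<close> show "norm (f x * g x) \<le> norm (B * f x)"
      by (simp add: abs_mult mult.commute)
  qed
qed

lemma integral_translate:
  fixes f :: "'a::euclidean_space \<Rightarrow> real"
  assumes "f \<in> borel_measurable borel"
  shows "(LINT z|lborel. f (a + z)) = (LINT z|lborel. f z)"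
proof -
  have "(LINT z|lborel. f z) = (LINT z|distr lborel borel ((+) a). f z)"
    by (simp add: lborel_distr_plus)
  also have "\<dots> = (LINT z|lborel. f (a + z))"
    by (rule integral_distr) (use assms in auto)
  finally show ?thesis by simp
qed

lemma lborel_distr_reflect: "distr lborel borel uminus = (lborel :: 'a::euclidean_space measure)"
  using lborel_affine[of "-1" "0 :: 'a"] by (simp add: density_1)

lemma integral_reflect_lborel:
  fixes f :: "'a::euclidean_space \<Rightarrow> real"
  assumes "f \<in> borel_measurable borel"
  shows "(LINT z|lborel. f (- z)) = (LINT z|lborel. f z)"
proof -
  have "(LINT z|lborel. f z) = (LINT z|distr lborel borel uminus. f z)"
    by (simp add: lborel_distr_reflect)
  also have "\<dots> = (LINT z|lborel. f (- z))"
    by (rule integral_distr) (use assms in auto)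
  finally show ?thesis by simp
qed

text \<open>
  The principal-value integral with the ball of radius \<open>d\<close> removed, in the variable \<open>z = y - x\<close> and without the
  normalization constant. For \<open>d > 0\<close> every integral converges absolutely, so Fubini's theorem applies before
  the limit is taken.
\<close>

definition trunc_lap :: "real \<Rightarrow> real \<Rightarrow> (real^'n::finite \<Rightarrow> real) \<Rightarrow> real^'n \<Rightarrow> real" where
  "trunc_lap s d \<phi> x = (LINT z|lborel. trunc_kern s d z * (\<phi> x - \<phi> (x + z)))"

lemma integrable_trunc_lap:
  fixes \<phi> :: "real^'n::finite \<Rightarrow> real"
  assumes s: "0 < s" "0 < d" and [measurable]: "\<phi> \<in> borel_measurable borel" and B: "\<And>x. \<bar>\<phi> x\<bar> \<le> B"
  shows "integrable lborel (\<lambda>z. trunc_kern s d z * (\<phi> x - \<phi> (x + z)))"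
proof (rule integrable_mult_bounded[OF integrable_trunc_kern[OF s]])
  show "\<bar>\<phi> x - \<phi> (x + z)\<bar> \<le> 2 * B" for z
    using B[of x] B[of "x + z"] by linarith
qed measurable

text \<open>
  Far from the support only \<open>\<phi> (x + z)\<close> survives, and it forces \<open>|z| \<ge> |x| / 2\<close>; hence the kernel is of order
  \<open>|x|\<^sup>-\<^sup>n\<^sup>-\<^sup>2\<^sup>s\<close> on a ball of fixed volume. The bound is uniform in the truncation.
\<close>

lemma trunc_lap_far_bound:
  fixes \<phi> :: "real^'n::finite \<Rightarrow> real"
  assumes s: "0 < s" and [measurable]: "\<phi> \<in> borel_measurable borel" and B: "\<And>x. \<bar>\<phi> x\<bar> \<le> B"
    and R: "1 \<le> R" and supp: "\<And>x. R \<le> norm x \<Longrightarrow> \<phi> x = 0"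
  shows "\<exists>C\<ge>0. \<forall>d>0. \<forall>x. 2 * R \<le> norm x \<longrightarrow>
    (LINT z|lborel. trunc_kern s d z * \<bar>\<phi> x - \<phi> (x + z)\<bar>) \<le> C * decay s x"
proof -
  let ?p = "real CARD('n) + 2 * s"
  define V where "V = measure lborel (ball (0 :: real^'n) R)"
  have B0: "0 \<le> B" using B[of 0] by linarith
  have "(LINT z|lborel. trunc_kern s d z * \<bar>\<phi> x - \<phi> (x + z)\<bar>) \<le> (B * (2 powr ?p * 2) * V) * decay s x"
    if "0 < d" "2 * R \<le> norm x" for d and x :: "real^'n"
  proof -
    let ?c = "B * (2 powr ?p * (2 * decay s x))"
    have ball_iff: "z \<in> ball (- x) R \<longleftrightarrow> norm (x + z) < R" for z
      by (simp add: dist_norm) (metis add_uminus_conv_diff minus_add_distrib norm_minus_cancel)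
    have le: "trunc_kern s d z * \<bar>\<phi> x - \<phi> (x + z)\<bar> \<le> ?c * indicator (ball (- x) R) z" for z
    proof (cases "z \<in> ball (- x) R")
      case True
      have z: "norm x / 2 \<le> norm z"
        using True[unfolded ball_iff] that norm_triangle_ineq2[of x "- z"] by simp
      have "trunc_kern s d z \<le> kern s z"
        by (auto simp: trunc_kern_def indicator_def)
      also have "\<dots> \<le> 1 / (norm x / 2) powr ?p"
        using that R s z by (intro kern_antimono) auto
      also have "\<dots> = 2 powr ?p * (1 / norm x powr ?p)"
        by (simp add: powr_divide)
      also have "\<dots> \<le> 2 powr ?p * (2 * decay s x)"
        using that R s by (intro mult_left_mono inverse_power_le_decay) auto
      finally have "trunc_kern s d z \<le> 2 powr ?p * (2 * decay s x)" .
      then have "trunc_kern s d z * \<bar>\<phi> x - \<phi> (x + z)\<bar> \<le> (2 powr ?p * (2 * decay s x)) * B"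
        using that R supp[of x] B[of "x + z"] B0 by (intro mult_mono) auto
      with True show ?thesis
        by (simp add: mult_ac)
    next
      case False
      then have "R \<le> norm (x + z)"
        unfolding ball_iff by simp
      then show ?thesis
        using that R supp[of x] supp[of "x + z"] B0 by simp
    qed
    have "V = measure lborel (ball (- x) R)"
      using R content_ball_conv_unit_ball[of R "- x"] content_ball_conv_unit_ball[of R "0 :: real^'n"]
      by (simp add: V_def)
    moreover have "integrable lborel (\<lambda>z. trunc_kern s d z * \<bar>\<phi> x - \<phi> (x + z)\<bar>)"
      using integrable_abs[OF integrable_trunc_lap[OF s \<open>0 < d\<close> assms(2) B]] by (simp add: abs_mult)
    moreover have "integrable lborel (\<lambda>z. ?c * indicator (ball (- x) R) z)"
      using emeasure_lborel_ball_finite[of "- x" R] by (intro integrable_mult_right integrable_real_indicator) auto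
    ultimately have "(LINT z|lborel. trunc_kern s d z * \<bar>\<phi> x - \<phi> (x + z)\<bar>) \<le> ?c * V"
      using Bochner_Integration.integral_mono[of lborel _ "\<lambda>z. ?c * indicator (ball (- x) R) z", OF _ _ le] by simp
    then show ?thesis
      by (simp only: mult_ac)
  qed
  moreover have "0 \<le> B * (2 powr ?p * 2) * V"
    using B0 by (simp add: V_def)
  ultimately show ?thesis by blast
qed

text \<open>
  With absolute values inside, no cancellation is available near the support, and the constant depends on
  \<open>d\<close>. This is the bound that justifies Fubini's theorem for a fixed truncation.
\<close>

lemma trunc_lap_abs_bound:
  fixes \<phi> :: "real^'n::finite \<Rightarrow> real"
  assumes s: "0 < s" and [measurable]: "\<phi> \<in> borel_measurable borel" and B: "\<And>x. \<bar>\<phi> x\<bar> \<le> B"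
    and R: "1 \<le> R" and supp: "\<And>x. R \<le> norm x \<Longrightarrow> \<phi> x = 0" and d: "0 < d"
  shows "\<exists>C\<ge>0. \<forall>x. (LINT z|lborel. trunc_kern s d z * \<bar>\<phi> x - \<phi> (x + z)\<bar>) \<le> C * decay s x"
proof -
  obtain C where C: "C \<ge> 0" "\<And>x. 2 * R \<le> norm x \<Longrightarrow>
      (LINT z|lborel. trunc_kern s d z * \<bar>\<phi> x - \<phi> (x + z)\<bar>) \<le> C * decay s x"
    using trunc_lap_far_bound[OF s assms(2) B R supp] d by blast
  have B0: "0 \<le> B" using B[of 0] by linarith
  define D where "D = 2 * B * (LINT z|lborel. trunc_kern s d (z :: real^'n)) *
    (1 + (2 * R) powr (real CARD('n) + 2 * s))"
  have D: "0 \<le> D"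
    unfolding D_def using B0 by (intro mult_nonneg_nonneg integral_nonneg) auto
  have "(LINT z|lborel. trunc_kern s d z * \<bar>\<phi> x - \<phi> (x + z)\<bar>) \<le> (C + D) * decay s x" for x
  proof (cases "2 * R \<le> norm x")
    case True
    with C(2)[of x] D show ?thesis
      by (simp add: distrib_right add_increasing2)
  next
    case False
    have "(LINT z|lborel. trunc_kern s d z * \<bar>\<phi> x - \<phi> (x + z)\<bar>) \<le> (LINT z|lborel. trunc_kern s d (z :: real^'n) * (2 * B))"
    proof (rule Bochner_Integration.integral_mono)
      show "integrable lborel (\<lambda>z. trunc_kern s d z * \<bar>\<phi> x - \<phi> (x + z)\<bar>)"
        using integrable_abs[OF integrable_trunc_lap[OF s d assms(2) B]] by (simp add: abs_mult)
      show "trunc_kern s d z * \<bar>\<phi> x - \<phi> (x + z)\<bar> \<le> trunc_kern s d z * (2 * B)" for z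
        using B[of x] B[of "x + z"] by (intro mult_left_mono) auto
    qed (simp add: integrable_trunc_kern[OF s d])
    also have "\<dots> = 2 * B * (LINT z|lborel. trunc_kern s d (z :: real^'n)) * 1"
      by simp
    also have "\<dots> \<le> 2 * B * (LINT z|lborel. trunc_kern s d (z :: real^'n)) *
        ((1 + (2 * R) powr (real CARD('n) + 2 * s)) * decay s x)"
      using B0 s False by (intro mult_left_mono decay_lower mult_nonneg_nonneg integral_nonneg) auto
    also have "\<dots> = D * decay s x"
      by (simp add: D_def)
    also have "\<dots> \<le> (C + D) * decay s x"
      using C(1) by (intro mult_right_mono) auto
    finally show ?thesis .
  qed
  with C(1) D show ?thesis
    by (intro exI[of _ "C + D"]) auto
qed

lemma trunc_lap_symmetric:
  fixes \<phi> :: "real^'n::finite \<Rightarrow> real"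
  assumes s: "0 < s" "0 < d" and [measurable]: "\<phi> \<in> borel_measurable borel" and B: "\<And>x. \<bar>\<phi> x\<bar> \<le> B"
  shows "trunc_lap s d \<phi> x = (LINT z|lborel. trunc_kern s d z * (2 * \<phi> x - \<phi> (x + z) - \<phi> (x - z))) / 2"
proof -
  let ?f = "\<lambda>z. trunc_kern s d z * (\<phi> x - \<phi> (x + z))"
  have int: "integrable lborel ?f"
    by (rule integrable_trunc_lap[OF assms])
  have "integrable (distr lborel borel uminus) ?f"
    using int by (simp add: lborel_distr_reflect)
  then have int': "integrable lborel (\<lambda>z. ?f (- z))"
    by (subst (asm) integrable_distr_eq) auto
  have "trunc_lap s d \<phi> x = (LINT z|lborel. ?f (- z))"
    unfolding trunc_lap_def by (rule integral_reflect_lborel[symmetric]) measurable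
  then have "2 * trunc_lap s d \<phi> x = (LINT z|lborel. ?f z) + (LINT z|lborel. ?f (- z))"
    by (simp add: trunc_lap_def)
  also have "\<dots> = (LINT z|lborel. ?f z + ?f (- z))"
    by (rule Bochner_Integration.integral_add[symmetric, OF int int'])
  also have "\<dots> = (LINT z|lborel. trunc_kern s d z * (2 * \<phi> x - \<phi> (x + z) - \<phi> (x - z)))"
    by (simp add: algebra_simps)
  finally show ?thesis by simp
qed

text \<open>
  Dominates the symmetrised integrand for all \<open>x\<close> at once: near the origin by the quadratic bound on second
  differences, far away by boundedness. Either bound alone would fail to be integrable against the kernel.
\<close>

definition second_diff_majorant :: "real \<Rightarrow> real \<Rightarrow> real \<Rightarrow> real^'n::finite \<Rightarrow> real" where
  "second_diff_majorant s C B z = C * (indicator (ball 0 1) z * (norm z ^ 2 * kern s z)) + 4 * B * trunc_kern s 1 z"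

lemma second_difference_le_majorant:
  fixes \<phi> :: "real^'n::finite \<Rightarrow> real"
  assumes B: "\<And>x. \<bar>\<phi> x\<bar> \<le> B"
    and C: "\<And>x z. \<bar>2 * \<phi> x - \<phi> (x + z) - \<phi> (x - z)\<bar> \<le> C * norm z ^ 2"
  shows "kern s z * \<bar>2 * \<phi> x - \<phi> (x + z) - \<phi> (x - z)\<bar> \<le> second_diff_majorant s C B z"
proof (cases "norm z < 1")
  case True
  have "kern s z * \<bar>2 * \<phi> x - \<phi> (x + z) - \<phi> (x - z)\<bar> \<le> kern s z * (C * norm z ^ 2)"
    by (intro mult_left_mono C) simp
  with True show ?thesis
    by (simp add: second_diff_majorant_def trunc_kern_def mult_ac)
next
  case False
  have "\<bar>2 * \<phi> x - \<phi> (x + z) - \<phi> (x - z)\<bar> \<le> 4 * B"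
    using B[of x] B[of "x + z"] B[of "x - z"] by linarith
  then have "kern s z * \<bar>2 * \<phi> x - \<phi> (x + z) - \<phi> (x - z)\<bar> \<le> kern s z * (4 * B)"
    by (intro mult_left_mono) auto
  with False show ?thesis
    by (simp add: second_diff_majorant_def trunc_kern_def mult_ac)
qed

lemma integrable_second_diff_majorant:
  "0 < s \<Longrightarrow> s < 1 \<Longrightarrow> integrable lborel (second_diff_majorant s C B :: real^'n::finite \<Rightarrow> real)"
  unfolding second_diff_majorant_def[abs_def]
  by (intro Bochner_Integration.integrable_add integrable_mult_right kern_near integrable_trunc_kern) auto

text \<open>
  The definition of the fractional Laplacian through \<open>Lim\<close> is meaningful only once the limit is known to exist.
  It does, by dominated convergence for the symmetrised integrals.
\<close>

lemma trunc_lap_tendsto: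
  fixes \<phi> :: "real^'n::finite \<Rightarrow> real"
  assumes s: "0 < s" "s < 1" and test: "\<phi> \<in> test_functions V"
  shows "((\<lambda>d. trunc_lap s d \<phi> x) \<longlongrightarrow>
      (LINT z|lborel. kern s z * (2 * \<phi> x - \<phi> (x + z) - \<phi> (x - z))) / 2) (at_right 0)"
proof -
  note [measurable] = test_function_borel[OF test]
  obtain B where B: "\<And>x. \<bar>\<phi> x\<bar> \<le> B"
    using test_function_bounded[OF test] by blast
  obtain C where C: "\<And>x z. \<bar>2 * \<phi> x - \<phi> (x + z) - \<phi> (x - z)\<bar> \<le> C * norm z ^ 2"
    using second_difference_bound[OF test] by blast
  show ?thesis
    unfolding tendsto_at_iff_sequentially comp_def
  proof (intro allI impI)
    fix X :: "nat \<Rightarrow> real"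
    assume X: "\<forall>i. X i \<in> {0<..} - {0}" "X \<longlonglongrightarrow> 0"
    have "(\<lambda>i. LINT z|lborel. trunc_kern s (X i) z * (2 * \<phi> x - \<phi> (x + z) - \<phi> (x - z)))
      \<longlonglongrightarrow> (LINT z|lborel. kern s z * (2 * \<phi> x - \<phi> (x + z) - \<phi> (x - z)))"
    proof (rule integral_dominated_convergence)
      show "integrable lborel (second_diff_majorant s C B :: real^'n \<Rightarrow> real)"
        by (rule integrable_second_diff_majorant[OF s])
      show "AE z in lborel. (\<lambda>i. trunc_kern s (X i) z * (2 * \<phi> x - \<phi> (x + z) - \<phi> (x - z)))
          \<longlonglongrightarrow> kern s z * (2 * \<phi> x - \<phi> (x + z) - \<phi> (x - z))"
      proof (rule AE_I2)
        fix z :: "real^'n"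
        have "\<forall>\<^sub>F i in sequentially. trunc_kern s (X i) z = kern s z"
        proof (cases "z = 0")
          case False
          then have "\<forall>\<^sub>F i in sequentially. X i < norm z"
            using X(2) by (intro order_tendstoD) auto
          then show ?thesis
            by eventually_elim (simp add: trunc_kern_def)
        qed (simp add: trunc_kern_def kern_def)
        then have "(\<lambda>i. trunc_kern s (X i) z) \<longlonglongrightarrow> kern s z"
          by (rule tendsto_eventually)
        then show "(\<lambda>i. trunc_kern s (X i) z * (2 * \<phi> x - \<phi> (x + z) - \<phi> (x - z)))
          \<longlonglongrightarrow> kern s z * (2 * \<phi> x - \<phi> (x + z) - \<phi> (x - z))"
          by (intro tendsto_intros)
      qed
      show "AE z in lborel. norm (trunc_kern s (X i) z * (2 * \<phi> x - \<phi> (x + z) - \<phi> (x - z)))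
          \<le> second_diff_majorant s C B z" for i
      proof (rule AE_I2)
        fix z :: "real^'n"
        have "norm (trunc_kern s (X i) z * (2 * \<phi> x - \<phi> (x + z) - \<phi> (x - z))) \<le>
            kern s z * \<bar>2 * \<phi> x - \<phi> (x + z) - \<phi> (x - z)\<bar>"
          by (auto simp: abs_mult trunc_kern_def indicator_def)
        with second_difference_le_majorant[of \<phi> B C s z x] B C show "norm (trunc_kern s (X i) z * (2 * \<phi> x - \<phi> (x + z) - \<phi> (x - z)))
          \<le> second_diff_majorant s C B z"
          by (meson order_trans)
      qed
    qed measurable
    then have "(\<lambda>i. (LINT z|lborel. trunc_kern s (X i) z * (2 * \<phi> x - \<phi> (x + z) - \<phi> (x - z))) / 2)
      \<longlonglongrightarrow> (LINT z|lborel. kern s z * (2 * \<phi> x - \<phi> (x + z) - \<phi> (x - z))) / 2"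
      by (intro tendsto_intros) auto
    moreover have "trunc_lap s (X i) \<phi> x =
        (LINT z|lborel. trunc_kern s (X i) z * (2 * \<phi> x - \<phi> (x + z) - \<phi> (x - z))) / 2" for i
      using X(1) s B by (intro trunc_lap_symmetric[where B = B]) auto
    ultimately show "(\<lambda>i. trunc_lap s (X i) \<phi> x)
      \<longlonglongrightarrow> (LINT z|lborel. kern s z * (2 * \<phi> x - \<phi> (x + z) - \<phi> (x - z))) / 2"
      by (simp only:)
  qed
qed

lemma frac_laplacian_eq_Lim:
  fixes \<phi> :: "real^'n::finite \<Rightarrow> real"
  assumes [measurable]: "\<phi> \<in> borel_measurable borel"
  shows "frac_laplacian s \<phi> x = frac_laplacian_const CARD('n) s * Lim (at_right 0) (\<lambda>d. trunc_lap s d \<phi> x)"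
proof -
  have "(LINT y:(- ball x d)|lebesgue. (\<phi> x - \<phi> y) / norm (x - y) powr (real CARD('n) + 2 * s)) =
      trunc_lap s d \<phi> x" for d
  proof -
    let ?g = "\<lambda>y. trunc_kern s d (y - x) * (\<phi> x - \<phi> y)"
    have "(LINT y:(- ball x d)|lebesgue. (\<phi> x - \<phi> y) / norm (x - y) powr (real CARD('n) + 2 * s)) =
        (LINT y|lebesgue. ?g y)"
      unfolding set_lebesgue_integral_def
      by (intro Bochner_Integration.integral_cong)
        (auto simp: trunc_kern_def kern_def indicator_def dist_norm norm_minus_commute)
    also have "\<dots> = (LINT y|lborel. ?g y)"
      by (rule integral_completion) measurable
    also have "\<dots> = (LINT z|lborel. ?g (x + z))"
      by (rule integral_translate[symmetric]) measurable
    finally show ?thesis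
      by (simp add: trunc_lap_def)
  qed
  then show ?thesis
    by (simp add: frac_laplacian_def)
qed

lemma frac_laplacian_tendsto:
  fixes \<phi> :: "real^'n::finite \<Rightarrow> real"
  assumes s: "0 < s" "s < 1" and test: "\<phi> \<in> test_functions V"
  shows "((\<lambda>d. frac_laplacian_const CARD('n) s * trunc_lap s d \<phi> x) \<longlongrightarrow> frac_laplacian s \<phi> x) (at_right 0)"
  unfolding frac_laplacian_eq_Lim[OF test_function_borel[OF test]]
  unfolding tendsto_Lim[OF trivial_limit_at_right_real trunc_lap_tendsto[OF assms, of x]]
  by (intro tendsto_intros trunc_lap_tendsto[OF assms])

lemma test_function_support:
  assumes "\<phi> \<in> test_functions V"
  shows "\<exists>R\<ge>1. \<forall>x. R \<le> norm x \<longrightarrow> \<phi> x = 0"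
proof -
  have "bounded {x. \<phi> x \<noteq> 0}"
    using assms compact_imp_bounded bounded_subset[OF _ closure_subset] by (auto simp: test_functions_def)
  then obtain K where "\<And>x. \<phi> x \<noteq> 0 \<Longrightarrow> norm x \<le> K"
    by (auto simp: bounded_iff)
  then show ?thesis
    by (intro exI[of _ "max 1 (K + 1)"]) force
qed

text \<open>
  In contrast to \<open>trunc_lap_abs_bound\<close>, the constant does not depend on the truncation: near the support the
  cancellation in the symmetric second difference is used. It is the majorant for letting \<open>d\<close> tend to \<open>0\<close> under
  the integral against \<open>u\<close>.
\<close>

lemma trunc_lap_decay:
  fixes \<phi> :: "real^'n::finite \<Rightarrow> real"
  assumes s: "0 < s" "s < 1" and test: "\<phi> \<in> test_functions V"
  shows "\<exists>C\<ge>0. \<forall>d>0. \<forall>x. \<bar>trunc_lap s d \<phi> x\<bar> \<le> C * decay s x"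
proof -
  note [measurable] = test_function_borel[OF test]
  obtain B where B: "\<And>x. \<bar>\<phi> x\<bar> \<le> B" "0 \<le> B"
    using test_function_bounded[OF test] by blast
  obtain C where C: "\<And>x z. \<bar>2 * \<phi> x - \<phi> (x + z) - \<phi> (x - z)\<bar> \<le> C * norm z ^ 2"
    using second_difference_bound[OF test] by blast
  obtain R where R: "1 \<le> R" "\<And>x. R \<le> norm x \<Longrightarrow> \<phi> x = 0"
    using test_function_support[OF test] by blast
  obtain C1 where C1: "C1 \<ge> 0" "\<And>d x. 0 < d \<Longrightarrow> 2 * R \<le> norm x \<Longrightarrow>
      (LINT z|lborel. trunc_kern s d z * \<bar>\<phi> x - \<phi> (x + z)\<bar>) \<le> C1 * decay s x"
    using trunc_lap_far_bound[OF s(1) test_function_borel[OF test] B(1) R] by blast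
  define J where "J = \<bar>LINT z|lborel. second_diff_majorant s C B (z :: real^'n)\<bar>"
  define D where "D = J * (1 + (2 * R) powr (real CARD('n) + 2 * s))"
  have D: "0 \<le> D"
    unfolding D_def J_def by (intro mult_nonneg_nonneg) auto
  have "\<bar>trunc_lap s d \<phi> x\<bar> \<le> (C1 + D) * decay s x" if "0 < d" for d x
  proof (cases "2 * R \<le> norm x")
    case True
    have "\<bar>trunc_lap s d \<phi> x\<bar> \<le> (LINT z|lborel. \<bar>trunc_kern s d z * (\<phi> x - \<phi> (x + z))\<bar>)"
      unfolding trunc_lap_def by (rule integral_abs_bound)
    also have "\<dots> \<le> C1 * decay s x"
      using C1(2)[OF that True] by (simp add: abs_mult)
    also have "\<dots> \<le> (C1 + D) * decay s x"
      using D by (intro mult_right_mono) auto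
    finally show ?thesis .
  next
    case False
    have "\<bar>LINT z|lborel. trunc_kern s d z * (2 * \<phi> x - \<phi> (x + z) - \<phi> (x - z))\<bar> \<le>
        (LINT z|lborel. second_diff_majorant s C B (z :: real^'n))"
    proof (rule order_trans[OF integral_abs_bound integral_mono_AE'])
      show "integrable lborel (second_diff_majorant s C B :: real^'n \<Rightarrow> real)"
        by (rule integrable_second_diff_majorant[OF s])
      show "AE z in lborel. \<bar>trunc_kern s d z * (2 * \<phi> x - \<phi> (x + z) - \<phi> (x - z))\<bar> \<le> second_diff_majorant s C B z"
      proof (rule AE_I2)
        fix z :: "real^'n"
        have "\<bar>trunc_kern s d z * (2 * \<phi> x - \<phi> (x + z) - \<phi> (x - z))\<bar> \<le>
            kern s z * \<bar>2 * \<phi> x - \<phi> (x + z) - \<phi> (x - z)\<bar>"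
          by (auto simp: abs_mult trunc_kern_def indicator_def)
        with second_difference_le_majorant[of \<phi> B C s z x] B C
        show "\<bar>trunc_kern s d z * (2 * \<phi> x - \<phi> (x + z) - \<phi> (x - z))\<bar> \<le> second_diff_majorant s C B z"
          by (meson order_trans)
      qed
      then show "AE z in lborel. 0 \<le> second_diff_majorant s C B (z :: real^'n)"
        by eventually_elim (meson abs_ge_zero order_trans)
    qed
    then have "\<bar>trunc_lap s d \<phi> x\<bar> \<le> J * 1"
      unfolding trunc_lap_symmetric[OF s(1) that test_function_borel[OF test] B(1)] J_def by simp
    also have "\<dots> \<le> J * ((1 + (2 * R) powr (real CARD('n) + 2 * s)) * decay s x)"
      using s False by (intro mult_left_mono decay_lower) (auto simp: J_def)
    also have "\<dots> = D * decay s x"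
      by (simp add: D_def)
    also have "\<dots> \<le> (C1 + D) * decay s x"
      using C1(1) by (intro mult_right_mono) auto
    finally show ?thesis .
  qed
  with C1(1) D show ?thesis
    by (intro exI[of _ "C1 + D"]) auto
qed

section \<open>Moving the fractional Laplacian from the test function to the mollification\<close>

lemma frac_laplacian_const_pos:
  assumes "0 < s" "s < 1"
  shows "0 < frac_laplacian_const n s"
  unfolding frac_laplacian_const_def using assms
  by (intro divide_pos_pos mult_pos_pos Gamma_real_pos) (auto intro: add_nonneg_pos)

lemma trunc_lap_borel [measurable]:
  fixes \<phi> :: "real^'n::finite \<Rightarrow> real"
  assumes [measurable]: "\<phi> \<in> borel_measurable borel"
  shows "trunc_lap s d \<phi> \<in> borel_measurable borel"
  unfolding trunc_lap_def[abs_def] by measurable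

lemma filterlim_null_sequence:
  fixes d :: real
  assumes "0 < d"
  shows "filterlim (\<lambda>k. d / real (k + 2)) (at_right 0) sequentially"
proof -
  have "(\<lambda>k. d * inverse (real (Suc (Suc k)))) \<longlonglongrightarrow> d * 0"
    by (intro tendsto_intros LIMSEQ_Suc[OF LIMSEQ_inverse_real_of_nat])
  then have "(\<lambda>k. d / real (k + 2)) \<longlonglongrightarrow> 0"
    by (simp add: divide_inverse add.commute)
  moreover have "0 < d / real (k + 2)" for k
    using assms by simp
  ultimately show ?thesis
    using assms by (auto simp: filterlim_at intro!: always_eventually less_imp_neq[symmetric])
qed

lemma frac_laplacian_borel:
  fixes \<phi> :: "real^'n::finite \<Rightarrow> real"
  assumes s: "0 < s" "s < 1" and test: "\<phi> \<in> test_functions V"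
  shows "frac_laplacian s \<phi> \<in> borel_measurable borel"
proof -
  note [measurable] = test_function_borel[OF test]
  show ?thesis
    by (rule borel_measurable_LIMSEQ_real[OF
        filterlim_compose[OF frac_laplacian_tendsto[OF s test] filterlim_null_sequence[OF zero_less_one]]])
      measurable
qed

text \<open>
  The supersolution enters only through three properties: it is nonnegative, Borel measurable (after a
  change on a null set), and integrable against the decay rate of the kernel at infinity. The last one
  is what membership in the weighted space means, and it makes every exchange of integrals below
  absolutely convergent.
\<close>

locale nonneg_weighted =
  fixes u :: "real^'n::finite \<Rightarrow> real" and s :: real
  assumes s: "0 < s" and u_borel [measurable]: "u \<in> borel_measurable borel"
    and u_nonneg: "\<And>y. 0 \<le> u y"
    and u_int: "integrable lborel (\<lambda>y. u y * decay s y)"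
begin

lemma integrable_mult_decay:
  assumes [measurable]: "f \<in> borel_measurable borel" and "\<And>y. \<bar>f y\<bar> \<le> C * decay s y"
  shows "integrable lborel (\<lambda>y. u y * f y)"
proof (rule Bochner_Integration.integrable_bound)
  show "integrable lborel (\<lambda>y. C * (u y * decay s y))"
    using u_int by simp
  show "AE y in lborel. norm (u y * f y) \<le> norm (C * (u y * decay s y))"
  proof (rule AE_I2)
    fix y
    have "u y * \<bar>f y\<bar> \<le> u y * \<bar>C * decay s y\<bar>"
      using assms(2)[of y] u_nonneg by (intro mult_left_mono) auto
    then show "norm (u y * f y) \<le> norm (C * (u y * decay s y))"
      using u_nonneg[of y] by (simp add: abs_mult mult_ac)
  qed
qed measurable

lemma integrable_mult_compact_support:
  assumes [measurable]: "f \<in> borel_measurable borel" and B: "\<And>y. \<bar>f y\<bar> \<le> B"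
    and supp: "\<And>y. R \<le> norm y \<Longrightarrow> f y = 0"
  shows "integrable lborel (\<lambda>y. u y * f y)"
proof (rule integrable_mult_decay)
  have B0: "0 \<le> B" using B[of 0] by linarith
  show "\<bar>f y\<bar> \<le> (B * (1 + R powr (real CARD('n) + 2 * s))) * decay s y" for y
  proof (cases "R \<le> norm y")
    case True
    then show ?thesis
      using B0 supp[of y] by simp
  next
    case False
    have "\<bar>f y\<bar> \<le> B * 1" using B[of y] by simp
    also have "\<dots> \<le> B * ((1 + R powr (real CARD('n) + 2 * s)) * decay s y)"
      using False s B0 by (intro mult_left_mono decay_lower) auto
    finally show ?thesis by (simp only: mult.assoc)
  qed
qed measurable

text \<open>
  Fubini's theorem for the truncated operator. Here \<open>W z\<close> is a translate of a mollification of \<open>u\<close>, so the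
  right-hand side is a truncated fractional Laplacian of that mollification.
\<close>

lemma integral_trunc_lap_swap:
  fixes \<phi> :: "real^'n \<Rightarrow> real"
  assumes [measurable]: "\<phi> \<in> borel_measurable borel" and B: "\<And>x. \<bar>\<phi> x\<bar> \<le> B"
    and R: "1 \<le> R" and supp: "\<And>x. R \<le> norm x \<Longrightarrow> \<phi> x = 0" and d: "0 < d"
  defines "W \<equiv> \<lambda>z. LINT y|lborel. u y * \<phi> (y + z)"
  shows "integrable lborel (\<lambda>z. trunc_kern s d z * (W 0 - W z))"
    and "(LINT y|lborel. u y * trunc_lap s d \<phi> y) = (LINT z|lborel. trunc_kern s d z * (W 0 - W z))"
proof -
  define f where "f y z = u y * (trunc_kern s d z * (\<phi> y - \<phi> (y + z)))" for y z :: "real^'n"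
  obtain C where C: "\<And>x. (LINT z|lborel. trunc_kern s d z * \<bar>\<phi> x - \<phi> (x + z)\<bar>) \<le> C * decay s x"
    using trunc_lap_abs_bound[OF s assms(1) B R supp d] by blast
  have "integrable (lborel \<Otimes>\<^sub>M lborel) (\<lambda>(y, z). f y z)"
  proof (rule lborel_pair.Fubini_integrable)
    show "(\<lambda>(y, z). f y z) \<in> borel_measurable (lborel \<Otimes>\<^sub>M lborel)"
      unfolding f_def by measurable
    show "AE y in lborel. integrable lborel (\<lambda>z. case (y, z) of (y, z) \<Rightarrow> f y z)"
      unfolding f_def using integrable_trunc_lap[OF s d assms(1) B] by simp
    have "integrable lborel (\<lambda>y. u y * (LINT z|lborel. trunc_kern s d z * \<bar>\<phi> y - \<phi> (y + z)\<bar>))"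
    proof (rule integrable_mult_decay)
      show "\<bar>LINT z|lborel. trunc_kern s d z * \<bar>\<phi> y - \<phi> (y + z)\<bar>\<bar> \<le> C * decay s y" for y
        using C[of y] by (subst abs_of_nonneg) (auto intro!: integral_nonneg)
    qed measurable
    then show "integrable lborel (\<lambda>y. LINT z|lborel. norm (case (y, z) of (y, z) \<Rightarrow> f y z))"
      using u_nonneg by (simp add: f_def abs_mult)
  qed
  note int = this
  have inner: "(LINT y|lborel. f y z) = trunc_kern s d z * (W 0 - W z)" for z
  proof -
    have i0: "integrable lborel (\<lambda>y. u y * \<phi> y)"
      by (rule integrable_mult_compact_support[OF assms(1) B supp])
    have iz: "integrable lborel (\<lambda>y. u y * \<phi> (y + z))"
    proof (rule integrable_mult_compact_support)
      show "\<phi> (y + z) = 0" if "R + norm z \<le> norm y" for y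
      proof (rule supp)
        show "R \<le> norm (y + z)"
          using that norm_triangle_ineq4[of "y + z" z] by simp
      qed
    qed (use B in auto)
    have "(LINT y|lborel. f y z) = (LINT y|lborel. trunc_kern s d z * (u y * \<phi> y - u y * \<phi> (y + z)))"
      by (simp add: f_def algebra_simps)
    also have "\<dots> = trunc_kern s d z * (W 0 - W z)"
      using i0 iz by (simp add: W_def)
    finally show ?thesis .
  qed
  show "integrable lborel (\<lambda>z. trunc_kern s d z * (W 0 - W z))"
    using lborel_pair.integrable_snd[OF int] by (simp add: inner)
  have "(LINT y|lborel. u y * trunc_lap s d \<phi> y) = (LINT y|lborel. (LINT z|lborel. f y z))"
    by (simp add: f_def trunc_lap_def)
  also have "\<dots> = (LINT z|lborel. (LINT y|lborel. f y z))"
    by (rule lborel_pair.Fubini_integral[OF int, symmetric])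
  finally show "(LINT y|lborel. u y * trunc_lap s d \<phi> y) = (LINT z|lborel. trunc_kern s d z * (W 0 - W z))"
    by (simp add: inner)
qed

text \<open>
  An upper bound for the truncations that is uniform in small \<open>d\<close> passes to the limit by \<open>trunc_lap_decay\<close>. By
  \<open>integral_trunc_lap_swap\<close> such a bound concerns the mollification, where minimality can be used.
\<close>

lemma integral_frac_laplacian_le:
  fixes \<phi> :: "real^'n \<Rightarrow> real"
  assumes s1: "s < 1" and test: "\<phi> \<in> test_functions V" and d0: "0 < d0"
    and bound: "\<And>d. 0 < d \<Longrightarrow> d < d0 \<Longrightarrow> (LINT z|lborel. trunc_kern s d z *
      ((LINT y|lborel. u y * \<phi> y) - (LINT y|lborel. u y * \<phi> (y + z)))) \<le> T"
  shows "(LINT y|lborel. u y * frac_laplacian s \<phi> y) \<le> frac_laplacian_const CARD('n) s * T"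
proof -
  note [measurable] = test_function_borel[OF test] frac_laplacian_borel[OF s s1 test]
  obtain B where B: "\<And>x. \<bar>\<phi> x\<bar> \<le> B"
    using test_function_bounded[OF test] by blast
  obtain R where R: "1 \<le> R" "\<And>x. R \<le> norm x \<Longrightarrow> \<phi> x = 0"
    using test_function_support[OF test] by blast
  obtain C where C: "\<And>d x. 0 < d \<Longrightarrow> \<bar>trunc_lap s d \<phi> x\<bar> \<le> C * decay s x"
    using trunc_lap_decay[OF s s1 test] by blast
  let ?c = "frac_laplacian_const CARD('n) s"
  have c: "0 < ?c"
    by (rule frac_laplacian_const_pos[OF s s1])
  define X where "X k = d0 / real (k + 2)" for k
  have X: "0 < X k" "X k < d0" for k
    using d0 by (auto simp: X_def field_simps intro: add_pos_nonneg)
  have "filterlim X (at_right 0) sequentially"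
    unfolding X_def[abs_def] by (rule filterlim_null_sequence[OF d0])
  from filterlim_compose[OF frac_laplacian_tendsto[OF s s1 test] this]
  have lim: "(\<lambda>k. ?c * trunc_lap s (X k) \<phi> x) \<longlonglongrightarrow> frac_laplacian s \<phi> x" for x .
  have "(\<lambda>k. LINT y|lborel. u y * (?c * trunc_lap s (X k) \<phi> y)) \<longlonglongrightarrow> (LINT y|lborel. u y * frac_laplacian s \<phi> y)"
  proof (rule integral_dominated_convergence)
    show "integrable lborel (\<lambda>y. u y * decay s y * (?c * C))"
      using u_int by simp
    show "AE y in lborel. (\<lambda>k. u y * (?c * trunc_lap s (X k) \<phi> y)) \<longlonglongrightarrow> u y * frac_laplacian s \<phi> y"
      by (intro AE_I2 tendsto_intros lim)
    show "AE y in lborel. norm (u y * (?c * trunc_lap s (X k) \<phi> y)) \<le> u y * decay s y * (?c * C)" for k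
    proof (rule AE_I2)
      fix y
      have "(u y * ?c) * \<bar>trunc_lap s (X k) \<phi> y\<bar> \<le> (u y * ?c) * (C * decay s y)"
        using u_nonneg c by (intro mult_left_mono C X) auto
      with u_nonneg[of y] c show "norm (u y * (?c * trunc_lap s (X k) \<phi> y)) \<le> u y * decay s y * (?c * C)"
        by (simp add: abs_mult mult_ac)
    qed
  qed measurable
  moreover have "(LINT y|lborel. u y * (?c * trunc_lap s (X k) \<phi> y)) \<le> ?c * T" for k
  proof -
    have "(LINT y|lborel. u y * (?c * trunc_lap s (X k) \<phi> y)) = ?c * (LINT y|lborel. u y * trunc_lap s (X k) \<phi> y)"
      by (simp only: mult.left_commute[of _ ?c] integral_mult_right_zero)
    also have "\<dots> \<le> ?c * T"
      using integral_trunc_lap_swap(2)[OF test_function_borel[OF test] B R X(1)] bound[OF X, of k] c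
      by (intro mult_left_mono) auto
    finally show ?thesis .
  qed
  ultimately show "(LINT y|lborel. u y * frac_laplacian s \<phi> y) \<le> ?c * T"
    by (intro LIMSEQ_le_const2[of _ _ "?c * T"]) auto
qed

end

section \<open>Mollifications\<close>

definition bump_at :: "real^'n::finite \<Rightarrow> real \<Rightarrow> real^'n \<Rightarrow> real" where
  "bump_at a e y = bump ((y - a) /\<^sub>R e)"

lemma bump_at_nonneg [simp]: "0 \<le> bump_at a e y"
  and bump_at_le_1: "bump_at a e y \<le> 1"
  by (simp_all add: bump_at_def bump_nonneg bump_le_1)

lemma abs_bump_at_le_1: "\<bar>bump_at a e y\<bar> \<le> 1"
  by (simp add: bump_at_le_1)

lemma bump_at_shift: "bump_at a e (y + z) = bump_at (a - z) e y"
  by (simp add: bump_at_def algebra_simps)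

lemma bump_at_eq_0:
  assumes "0 < e" "e \<le> norm (y - a)"
  shows "bump_at a e y = 0"
proof -
  have "norm ((y - a) /\<^sub>R e) = norm (y - a) / e"
    using assms(1) by (simp add: divide_inverse mult.commute)
  with assms show ?thesis
    by (simp only: bump_at_def bump_eq_0_iff) (simp add: le_divide_eq)
qed

lemma test_functions_bump_at:
  "0 < e \<Longrightarrow> cball a e \<subseteq> V \<Longrightarrow> bump_at a e \<in> test_functions V"
  unfolding bump_at_def[abs_def] by (rule test_functions_rescaled_bump)

lemma continuous_on_bump: "continuous_on A bump"
proof -
  have "Ck 0 (bump :: real^'n::finite \<Rightarrow> real)"
    unfolding bump_def[abs_def] by (rule Ck_flat_class[OF flat_class.flat])
  then show ?thesis
    by (auto intro: continuous_on_subset)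
qed

lemma bump_borel [measurable]: "bump \<in> borel_measurable borel"
  by (intro borel_measurable_continuous_onI continuous_on_bump)

lemma bump_at_borel [measurable]: "bump_at a e \<in> borel_measurable borel"
  unfolding bump_at_def[abs_def] by measurable

lemma grad_bump_at_bound:
  "\<exists>L>0. \<forall>a e y. 0 < e \<longrightarrow> norm (grad (bump_at (a::real^'n::finite) e) y) \<le> L / e"
proof -
  have test: "(bump :: real^'n \<Rightarrow> real) \<in> test_functions UNIV"
    using test_functions_bump_at[of 1 "0 :: real^'n" UNIV] by (simp add: bump_at_def[abs_def])
  then obtain L where L: "L \<ge> 0" "\<And>x :: real^'n. norm (grad bump x) \<le> L"
    using grad_bounded by blast
  have "norm (grad (bump_at a e) y) \<le> (L + 1) / e" if e: "0 < e" for a y :: "real^'n" and e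
  proof -
    have "((\<lambda>y. (y - a) /\<^sub>R e) has_derivative (\<lambda>h. h /\<^sub>R e)) (at y)"
      by (auto intro!: derivative_eq_intros)
    from has_derivative_compose[OF this test_function_has_derivative[OF test]]
    have "(bump_at a e has_derivative (\<lambda>h. grad bump ((y - a) /\<^sub>R e) \<bullet> (h /\<^sub>R e))) (at y)"
      by (simp only: bump_at_def[abs_def])
    then have "grad (bump_at a e) y = grad bump ((y - a) /\<^sub>R e) /\<^sub>R e"
      by (simp add: grad_def partial_deriv_eq inner_axis vec_eq_iff)
    then have "norm (grad (bump_at a e) y) = norm (grad bump ((y - a) /\<^sub>R e)) / e"
      using e by (simp add: divide_inverse mult.commute)
    also have "\<dots> \<le> (L + 1) / e"
      using e L(2)[of "(y - a) /\<^sub>R e"] by (intro divide_right_mono) auto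
    finally show ?thesis .
  qed
  with L(1) show ?thesis
    by (intro exI[of _ "L + 1"]) auto
qed

lemma grad_bump_at_eq_0:
  assumes "0 < e" "y \<notin> cball a e"
  shows "grad (bump_at a e) y = 0"
proof -
  have "((\<lambda>_. 0) has_derivative (\<lambda>_. 0)) (at y)"
    by simp
  then have "(bump_at a e has_derivative (\<lambda>_. 0)) (at y)"
    by (rule has_derivative_transform_within_open[where s = "- cball a e"])
      (use assms in \<open>auto simp: dist_norm norm_minus_commute not_le intro!: bump_at_eq_0 less_imp_le\<close>)
  then show ?thesis
    by (simp add: grad_def partial_deriv_eq vec_eq_iff)
qed

definition bump_mass :: "'n::finite itself \<Rightarrow> real" where
  "bump_mass _ = (LINT y|lborel. bump (y :: real^'n))"

lemma integrable_bump_at: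
  fixes a :: "real^'n::finite"
  assumes "0 < e"
  shows "integrable lborel (bump_at a e)"
proof (rule Bochner_Integration.integrable_bound)
  show "integrable lborel (indicator (ball a e) :: real^'n \<Rightarrow> real)"
    using emeasure_lborel_ball_finite[of a e] by (intro integrable_real_indicator) auto
  show "AE y in lborel. norm (bump_at a e y) \<le> norm (indicator (ball a e) y :: real)"
  proof (rule AE_I2)
    fix y
    show "norm (bump_at a e y) \<le> norm (indicator (ball a e) y :: real)"
      using bump_at_eq_0[OF assms, of y a]
      by (auto simp: bump_at_le_1 indicator_def dist_norm norm_minus_commute not_less)
  qed
qed measurable

lemma bump_mass_pos: "0 < bump_mass TYPE('n::finite)"
proof -
  let ?B = "ball (0 :: real^'n) (1 / 2)"
  have "exp (- 2) * indicator ?B y \<le> bump y" for y :: "real^'n"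
  proof (cases "y \<in> ?B")
    case True
    then have "norm y * norm y \<le> (1 / 2) * (1 / 2)"
      by (intro mult_mono) auto
    then have y: "1 / 2 \<le> 1 - y \<bullet> y"
      by (simp add: dot_square_norm power2_eq_square)
    then have "inverse (1 - y \<bullet> y) \<le> inverse (1 / 2)"
      by (intro le_imp_inverse_le) auto
    with y True show ?thesis
      by (simp add: bump_def flat_def)
  qed (simp add: bump_nonneg)
  moreover have "integrable lborel (bump :: real^'n \<Rightarrow> real)"
    using integrable_bump_at[of 1 "0 :: real^'n"] by (simp add: bump_at_def[abs_def])
  moreover have "integrable lborel (\<lambda>y. exp (- 2) * indicator ?B y :: real)"
    using emeasure_lborel_ball_finite[of "0 :: real^'n" "1 / 2"]
    by (intro integrable_mult_right integrable_real_indicator) auto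
  ultimately have "(LINT y|lborel. exp (- 2) * indicator ?B y) \<le> bump_mass TYPE('n)"
    unfolding bump_mass_def by (intro Bochner_Integration.integral_mono) auto
  then have "exp (- 2) * measure lborel ?B \<le> bump_mass TYPE('n)"
    by simp
  moreover have "0 < exp (- 2) * measure lborel ?B"
    by (intro mult_pos_pos content_ball_pos) auto
  ultimately show ?thesis
    by linarith
qed

lemma integral_bump_at:
  fixes a :: "real^'n::finite"
  assumes "0 < e"
  shows "(LINT y|lborel. bump_at a e y) = e ^ CARD('n) * bump_mass TYPE('n)"
proof -
  have "(LINT y|lborel. bump_at a e y) =
      (LINT y|density (distr lborel borel (\<lambda>x. a + e *\<^sub>R x)) (\<lambda>_. ennreal (\<bar>e\<bar> ^ DIM(real^'n))). bump_at a e y)"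
    using assms by (subst lborel_affine[of e a]) auto
  also have "\<dots> = (LINT y|distr lborel borel (\<lambda>x. a + e *\<^sub>R x). \<bar>e\<bar> ^ DIM(real^'n) *\<^sub>R bump_at a e y)"
    by (rule integral_density) auto
  also have "\<dots> = (LINT x|lborel. \<bar>e\<bar> ^ DIM(real^'n) *\<^sub>R bump_at a e (a + e *\<^sub>R x))"
    by (rule integral_distr) auto
  also have "\<dots> = e ^ CARD('n) * bump_mass TYPE('n)"
    using assms by (simp add: bump_at_def bump_mass_def)
  finally show ?thesis .
qed

text \<open>
  Without a normalising factor the value at \<open>x\<close> is the pairing of \<open>u\<close> with a fixed bump moved to \<open>x\<close>, which is the
  form in which the weak inequality sees it.
\<close>

definition moll :: "(real^'n::finite \<Rightarrow> real) \<Rightarrow> real \<Rightarrow> real^'n \<Rightarrow> real" where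
  "moll u e x = (LINT y|lborel. u y * bump_at x e y)"

context nonneg_weighted
begin

lemma integrable_mult_bounded_set:
  assumes [measurable]: "f \<in> borel_measurable borel" and B: "\<And>y. \<bar>f y\<bar> \<le> B" and "bounded S"
    and supp: "\<And>y. y \<notin> S \<Longrightarrow> f y = 0"
  shows "integrable lborel (\<lambda>y. u y * f y)"
proof -
  obtain K where K: "\<And>y. y \<in> S \<Longrightarrow> norm y \<le> K"
    using \<open>bounded S\<close> by (auto simp: bounded_iff)
  show ?thesis
    by (rule integrable_mult_compact_support[OF assms(1) B, of "K + 1"])
      (use K supp in force)
qed

lemma integrable_mult_bump_at:
  "0 < e \<Longrightarrow> integrable lborel (\<lambda>y. u y * bump_at a e y)"
  by (rule integrable_mult_bounded_set[of _ 1 "ball a e"])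
    (use bump_at_eq_0[of e] in \<open>auto simp: bump_at_le_1 dist_norm norm_minus_commute not_less\<close>)

lemma moll_nonneg: "0 \<le> moll u e x"
  unfolding moll_def using u_nonneg by (intro integral_nonneg_AE AE_I2 mult_nonneg_nonneg) auto

lemma continuous_moll:
  assumes e: "0 < e"
  shows "continuous_on A (moll u e)"
proof (rule continuous_at_imp_continuous_on, rule ballI)
  fix x
  show "isCont (moll u e) x"
    unfolding continuous_at_sequentially comp_def
  proof (intro allI impI)
    fix X assume X: "X \<longlonglongrightarrow> x"
    then have "bounded (range X)"
      by (rule convergent_imp_bounded)
    then obtain K where K: "\<And>k. norm (X k) \<le> K"
      by (auto simp: bounded_iff)
    show "(\<lambda>k. moll u e (X k)) \<longlonglongrightarrow> moll u e x"
      unfolding moll_def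
    proof (rule integral_dominated_convergence)
      show "integrable lborel (\<lambda>y. u y * indicator (ball 0 (K + e)) y)"
        by (rule integrable_mult_bounded_set[of _ 1 "ball 0 (K + e)"]) (auto intro!: borel_measurable_indicator)
      show "AE y in lborel. (\<lambda>k. u y * bump_at (X k) e y) \<longlonglongrightarrow> u y * bump_at x e y"
      proof (rule AE_I2)
        fix y
        have "(\<lambda>k. bump ((y - X k) /\<^sub>R e)) \<longlonglongrightarrow> bump ((y - x) /\<^sub>R e)"
          by (rule isCont_tendsto_compose[OF _ tendsto_scaleR[OF tendsto_const tendsto_diff[OF tendsto_const X]]])
            (use continuous_on_bump[of UNIV] in \<open>auto simp: continuous_on_eq_continuous_at\<close>)
        then show "(\<lambda>k. u y * bump_at (X k) e y) \<longlonglongrightarrow> u y * bump_at x e y"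
          unfolding bump_at_def by (intro tendsto_intros)
      qed
      show "AE y in lborel. norm (u y * bump_at (X k) e y) \<le> u y * indicator (ball 0 (K + e)) y" for k
      proof (rule AE_I2)
        fix y
        have "bump_at (X k) e y \<le> indicator (ball 0 (K + e)) y"
        proof (cases "norm (y - X k) < e")
          case True
          then have "norm y < K + e"
            using K[of k] norm_triangle_sub[of y "X k"] by linarith
          then show ?thesis by (simp add: bump_at_le_1)
        next
          case False
          then show ?thesis using bump_at_eq_0[OF e, of y "X k"] by simp
        qed
        then show "norm (u y * bump_at (X k) e y) \<le> u y * indicator (ball 0 (K + e)) y"
          using u_nonneg[of y] by (simp add: abs_mult mult_left_mono)
      qed
    qed measurable
  qed
qed

text \<open>
  The integral is \<open>- \<nabla>w(a) \<bullet> v\<close> for \<open>w = moll u e\<close>. Moving the centre of the bump by \<open>- t v\<close> does not decrease \<open>w\<close>;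
  passing to the limit in the difference quotients gives one sign, and replacing \<open>v\<close> by \<open>- v\<close> the other.
\<close>

lemma integral_grad_at_local_min:
  assumes e: "0 < e" and eta: "0 < \<eta>" and min: "\<And>x. x \<in> ball a \<eta> \<Longrightarrow> moll u e a \<le> moll u e x"
  shows "(LINT y|lborel. u y * (grad (bump_at a e) y \<bullet> v)) = 0"
proof -
  let ?\<phi> = "bump_at a e"
  have test: "?\<phi> \<in> test_functions UNIV"
    by (rule test_functions_bump_at[OF e]) simp
  obtain L where L: "L \<ge> 0" "\<And>y. norm (grad ?\<phi> y) \<le> L"
    using grad_bounded[OF test] by blast
  have nonneg: "0 \<le> (LINT y|lborel. u y * (grad ?\<phi> y \<bullet> v))" for v
  proof -
    \<comment> \<open>Scaled so that \<open>a - t k *\<^sub>R v\<close> stays in the ball where \<open>a\<close> is minimal.\<close>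
    define t where "t k = \<eta> / ((norm v + 1) * real (k + 2))" for k
    have t: "0 < t k" "t k \<le> \<eta>" "norm (t k *\<^sub>R v) < \<eta>" for k
    proof -
      have nv: "0 < norm v + 1" by (simp add: add_nonneg_pos)
      show "0 < t k" using eta nv by (simp add: t_def)
      have "t k * (norm v + 1) = \<eta> / real (k + 2)"
        using nv by (simp add: t_def)
      also have "\<dots> < \<eta>"
        using eta by (simp add: field_simps add_pos_nonneg)
      finally have *: "t k * norm v + t k < \<eta>"
        by (simp add: algebra_simps)
      then show "norm (t k *\<^sub>R v) < \<eta>"
        using \<open>0 < t k\<close> by simp
      show "t k \<le> \<eta>"
        using * mult_nonneg_nonneg[OF less_imp_le[OF \<open>0 < t k\<close>] norm_ge_zero[of v]] by linarith
    qed
    have t_lim: "t \<longlonglongrightarrow> 0"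
    proof -
      have "(\<lambda>k. (\<eta> / (norm v + 1)) * inverse (real (Suc (Suc k)))) \<longlonglongrightarrow> (\<eta> / (norm v + 1)) * 0"
        by (intro tendsto_intros LIMSEQ_Suc[OF LIMSEQ_inverse_real_of_nat])
      then show ?thesis
        by (simp add: t_def[abs_def] divide_inverse mult.assoc add.commute)
    qed
    have quot: "(\<lambda>k. LINT y|lborel. u y * ((?\<phi> (y + t k *\<^sub>R v) - ?\<phi> y) / t k))
        \<longlonglongrightarrow> (LINT y|lborel. u y * (grad ?\<phi> y \<bullet> v))"
    proof (rule integral_dominated_convergence)
      show "integrable lborel (\<lambda>y. u y * (L * norm v * indicator (ball a (e + \<eta>)) y))"
        by (rule integrable_mult_bounded_set[of _ "L * norm v" "ball a (e + \<eta>)"])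
          (use L in \<open>auto simp: indicator_def\<close>)
      show "(\<lambda>y. u y * (grad ?\<phi> y \<bullet> v)) \<in> borel_measurable lborel"
        unfolding grad_def inner_vec_def
        using test_function_borel[OF partial_deriv_test_function[OF test]] by simp
      show "AE y in lborel. (\<lambda>k. u y * ((?\<phi> (y + t k *\<^sub>R v) - ?\<phi> y) / t k)) \<longlonglongrightarrow> u y * (grad ?\<phi> y \<bullet> v)"
      proof (rule AE_I2)
        fix y
        have "((\<lambda>\<tau>. ?\<phi> (y + \<tau> *\<^sub>R v)) has_derivative (\<lambda>h. grad ?\<phi> (y + 0 *\<^sub>R v) \<bullet> (h *\<^sub>R v))) (at 0)"
          by (rule has_derivative_compose[OF _ test_function_has_derivative[OF test]])
            (auto intro!: derivative_eq_intros)
        then have "((\<lambda>\<tau>. ?\<phi> (y + \<tau> *\<^sub>R v)) has_real_derivative (grad ?\<phi> y \<bullet> v)) (at 0)"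
          unfolding has_field_derivative_def by (rule has_derivative_eq_rhs) (simp add: fun_eq_iff)
        then have "((\<lambda>h. (?\<phi> (y + h *\<^sub>R v) - ?\<phi> y) / h) \<longlongrightarrow> grad ?\<phi> y \<bullet> v) (at 0)"
          by (simp add: DERIV_def)
        then have "(\<lambda>k. (?\<phi> (y + t k *\<^sub>R v) - ?\<phi> y) / t k) \<longlonglongrightarrow> grad ?\<phi> y \<bullet> v"
          by (rule filterlim_compose) (use t(1) t_lim in \<open>auto simp: filterlim_at intro!: always_eventually less_imp_neq[symmetric]\<close>)
        then show "(\<lambda>k. u y * ((?\<phi> (y + t k *\<^sub>R v) - ?\<phi> y) / t k)) \<longlonglongrightarrow> u y * (grad ?\<phi> y \<bullet> v)"
          by (intro tendsto_intros)
      qed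
      show "AE y in lborel. norm (u y * ((?\<phi> (y + t k *\<^sub>R v) - ?\<phi> y) / t k))
          \<le> u y * (L * norm v * indicator (ball a (e + \<eta>)) y)" for k
      proof (rule AE_I2)
        fix y
        have "\<bar>(?\<phi> (y + t k *\<^sub>R v) - ?\<phi> y) / t k\<bar> \<le> L * norm v * indicator (ball a (e + \<eta>)) y"
        proof (cases "y \<in> ball a (e + \<eta>)")
          case True
          have "\<bar>?\<phi> (y + t k *\<^sub>R v) - ?\<phi> y\<bar> \<le> L * norm (y + t k *\<^sub>R v - y)"
            by (rule lipschitz_of_grad_bound[OF test L(2)])
          with True t(1)[of k] show ?thesis
            by (simp add: abs_divide divide_le_eq mult_ac)
        next
          case False
          then have far: "e + \<eta> \<le> norm (y - a)"
            by (simp add: dist_norm norm_minus_commute)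
          then have "?\<phi> y = 0"
            using eta by (intro bump_at_eq_0[OF e]) simp
          moreover have "?\<phi> (y + t k *\<^sub>R v) = 0"
          proof (rule bump_at_eq_0[OF e])
            have "norm (y - a) \<le> norm (y + t k *\<^sub>R v - a) + norm (t k *\<^sub>R v)"
              using norm_triangle_ineq4[of "y + t k *\<^sub>R v - a" "t k *\<^sub>R v"] by (simp add: algebra_simps)
            with far t(3)[of k] show "e \<le> norm (y + t k *\<^sub>R v - a)"
              by linarith
          qed
          ultimately show ?thesis
            using L(1) by simp
        qed
        then have "u y * \<bar>(?\<phi> (y + t k *\<^sub>R v) - ?\<phi> y) / t k\<bar> \<le> u y * (L * norm v * indicator (ball a (e + \<eta>)) y)"
          by (rule mult_left_mono) (rule u_nonneg)
        then show "norm (u y * ((?\<phi> (y + t k *\<^sub>R v) - ?\<phi> y) / t k))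
          \<le> u y * (L * norm v * indicator (ball a (e + \<eta>)) y)"
          using u_nonneg[of y] by (simp only: real_norm_def abs_mult abs_of_nonneg)
      qed
    qed measurable
    have "0 \<le> (LINT y|lborel. u y * ((?\<phi> (y + t k *\<^sub>R v) - ?\<phi> y) / t k))" for k
    proof -
      have "(LINT y|lborel. u y * ((?\<phi> (y + t k *\<^sub>R v) - ?\<phi> y) / t k)) =
          (LINT y|lborel. (u y * bump_at (a - t k *\<^sub>R v) e y - u y * bump_at a e y) / t k)"
        by (simp add: bump_at_shift right_diff_distrib)
      also have "\<dots> = (moll u e (a - t k *\<^sub>R v) - moll u e a) / t k"
        by (simp add: moll_def integrable_mult_bump_at[OF e])
      also have "\<dots> \<ge> 0"
        using min[of "a - t k *\<^sub>R v"] t[of k] by (intro divide_nonneg_pos) (auto simp: dist_norm)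
      finally show ?thesis .
    qed
    with quot show ?thesis
      by (intro LIMSEQ_le_const) auto
  qed
  from nonneg[of v] nonneg[of "- v"] show ?thesis
    by (simp add: inner_minus_right)
qed

end

section \<open>The drift term and the mass near the minimum point\<close>

text \<open>
  The divergence of \<open>b\<close>, written through the Jacobian because its continuity is assumed in that form.
\<close>

definition jacobian_trace :: "(real^'n::finite \<Rightarrow> real^'n) \<Rightarrow> real^'n \<Rightarrow> real" where
  "jacobian_trace b x = (\<Sum>i\<in>UNIV. jacobian b (at x) $ i $ i)"

lemma divergence_scaleR:
  fixes \<phi> :: "real^'n::finite \<Rightarrow> real"
  assumes test: "\<phi> \<in> test_functions V" and b: "b differentiable (at x)"
  shows "divergence (\<lambda>y. \<phi> y *\<^sub>R b y) x = \<phi> x * jacobian_trace b x + grad \<phi> x \<bullet> b x"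
proof -
  let ?D = "frechet_derivative b (at x)"
  have D: "(b has_derivative ?D) (at x)"
    using b by (simp add: frechet_derivative_works)
  have product: "((\<lambda>y. (\<phi> y *\<^sub>R b y) $ i) has_derivative
      (\<lambda>h. (\<phi> x *\<^sub>R ?D h + (grad \<phi> x \<bullet> h) *\<^sub>R b x) $ i)) (at x)" for i
    by (intro has_derivative_compose[OF has_derivative_scaleR[OF test_function_has_derivative[OF test] D]
        bounded_linear_imp_has_derivative[OF bounded_linear_vec_nth]])
  have "partial_deriv i (\<lambda>y. (\<phi> y *\<^sub>R b y) $ i) x = \<phi> x * jacobian b (at x) $ i $ i + grad \<phi> x $ i * b x $ i" for i
    unfolding partial_deriv_eq[OF product] by (simp add: jacobian_def matrix_def inner_axis)
  then show ?thesis
    by (simp add: divergence_def jacobian_trace_def inner_vec_def sum.distrib sum_distrib_left)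
qed

context
  fixes b :: "real^'n::finite \<Rightarrow> real^'n" and U :: "(real^'n) set" and M :: real
  assumes C1: "C1_on U b" and norm_C1: "C1_norm U b \<le> ennreal M" and M: "0 \<le> M"
begin

lemma C1_norm_value_bound:
  assumes "x \<in> U"
  shows "norm (b x) \<le> M"
proof -
  have "ennreal (norm (b x)) \<le> (SUP x\<in>U. ennreal (norm (b x)))"
    by (rule SUP_upper[OF assms])
  also have "\<dots> \<le> C1_norm U b"
    unfolding C1_norm_def by (simp add: add_increasing2)
  also note norm_C1
  finally show ?thesis
    using M by simp
qed

lemma C1_norm_derivative_bound:
  assumes "x \<in> U"
  shows "onorm (frechet_derivative b (at x)) \<le> M"
proof -
  have "ennreal (onorm (frechet_derivative b (at x))) \<le> (SUP x\<in>U. ennreal (onorm (frechet_derivative b (at x))))"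
    by (rule SUP_upper[OF assms])
  also have "\<dots> \<le> C1_norm U b"
    unfolding C1_norm_def by (simp add: add_increasing)
  also note norm_C1
  finally show ?thesis
    using M by simp
qed

lemma C1_has_derivative: "x \<in> U \<Longrightarrow> (b has_derivative frechet_derivative b (at x)) (at x)"
  using C1 by (simp add: C1_on_def frechet_derivative_works)

lemma jacobian_trace_bound:
  assumes "x \<in> U"
  shows "\<bar>jacobian_trace b x\<bar> \<le> real CARD('n) * M"
proof -
  let ?D = "frechet_derivative b (at x)"
  have "\<bar>jacobian b (at x) $ i $ i\<bar> \<le> M" for i
  proof -
    have "\<bar>jacobian b (at x) $ i $ i\<bar> \<le> norm (?D (axis i 1))"
      using component_le_norm_cart[of "?D (axis i 1)" i] by (simp add: jacobian_def matrix_def)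
    also have "\<dots> \<le> onorm ?D * norm (axis i 1 :: real^'n)"
      by (rule onorm[OF has_derivative_bounded_linear[OF C1_has_derivative[OF assms]]])
    also have "\<dots> \<le> M"
      using C1_norm_derivative_bound[OF assms] by simp
    finally show ?thesis .
  qed
  then have "(\<Sum>i\<in>UNIV. \<bar>jacobian b (at x) $ i $ i\<bar>) \<le> (\<Sum>i\<in>(UNIV :: 'n set). M)"
    by (intro sum_mono)
  then show ?thesis
    unfolding jacobian_trace_def using sum_abs[of "\<lambda>i. jacobian b (at x) $ i $ i" UNIV]
    by (simp only: sum_constant)
qed

text \<open>
  The mean value inequality; the bound on the derivative of \<open>b\<close> enters here to control the commutator of
  mollification and drift.
\<close>

lemma C1_norm_lipschitz:
  assumes "convex U" "x \<in> U" "y \<in> U"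
  shows "norm (b x - b y) \<le> M * norm (x - y)"
  by (rule differentiable_bound[of U b "\<lambda>x. frechet_derivative b (at x)"])
    (use assms C1_norm_derivative_bound C1_has_derivative has_derivative_at_withinI in blast)+

end

lemma drift_coefficient_borel:
  fixes b :: "real^'n::finite \<Rightarrow> real^'n"
  assumes C1: "C1_on U b" and U: "open U" and test: "\<phi> \<in> test_functions V"
  shows "(\<lambda>x. indicator U x * (\<phi> x * jacobian_trace b x + grad \<phi> x \<bullet> b x)) \<in> borel_measurable borel"
proof -
  have "continuous_on U (\<lambda>x. \<phi> x * jacobian_trace b x + grad \<phi> x \<bullet> b x)"
  proof (intro continuous_intros)
    show "continuous_on U (grad \<phi>)"
      unfolding grad_def[abs_def]
      by (intro continuous_on_vec_lambda test_function_continuous[OF partial_deriv_test_function[OF test]])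
    show "continuous_on U b"
      using C1 by (auto simp: C1_on_def intro!: continuous_at_imp_continuous_on differentiable_imp_continuous_within)
    show "continuous_on U (jacobian_trace b)"
      unfolding jacobian_trace_def[abs_def] using C1 by (auto simp: C1_on_def intro!: continuous_intros)
  qed (rule test_function_continuous[OF test])
  then have "(\<lambda>x. indicator U x *\<^sub>R (\<phi> x * jacobian_trace b x + grad \<phi> x \<bullet> b x)) \<in> borel_measurable borel"
    using U by (intro borel_measurable_continuous_on_indicator) auto
  then show ?thesis
    by simp
qed

definition shell :: "real \<Rightarrow> real \<Rightarrow> (real^'n::finite) set" where
  "shell q R = cball 0 R - ball 0 q"

lemma shell_borel: "shell q R \<in> sets borel"
  unfolding shell_def by simp

context nonneg_weighted
begin

text \<open>
  Write \<open>- div (\<phi> b) = - \<phi> div b - \<nabla>\<phi> \<bullet> b(a) - \<nabla>\<phi> \<bullet> (b - b(a))\<close>. The first term is controlled by \<open>n M \<phi>\<close>, the second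
  integrates to zero against \<open>u\<close> by the criticality assumption, and the third is at most \<open>(L / e) (M e)\<close> on the
  ball where \<open>\<nabla>\<phi>\<close> lives. The bound on \<open>c\<close> is one-sided, which suffices since \<open>u \<phi> \<ge> 0\<close>.
\<close>

lemma drift_term_bound:
  fixes b :: "real^'n \<Rightarrow> real^'n"
  assumes C1: "C1_on (ball x\<^sub>0 r) b" and norm_C1: "C1_norm (ball x\<^sub>0 r) b \<le> ennreal M" and M: "0 \<le> M"
    and c: "\<And>x. x \<in> ball x\<^sub>0 r \<Longrightarrow> c x \<le> M"
    and cu: "locally_integrable_on (\<lambda>x. c x * u x) (ball x\<^sub>0 r)"
    and e: "0 < e" and sub: "cball a e \<subseteq> ball x\<^sub>0 r"
    and L: "\<And>y. norm (grad (bump_at a e) y) \<le> L / e"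
    and crit: "\<And>v. (LINT y|lborel. u y * (grad (bump_at a e) y \<bullet> v)) = 0"
  shows "(LINT x:ball x\<^sub>0 r|lebesgue. u x * (- divergence (\<lambda>y. bump_at a e y *\<^sub>R b y) x + c x * bump_at a e x))
    \<le> (real CARD('n) + 1) * M * moll u e a + M * L * (LINT y|lborel. u y * indicator (cball a e) y)"
proof -
  let ?\<phi> = "bump_at a e" and ?U = "ball x\<^sub>0 r" and ?K = "cball a e" and ?N = "real CARD('n)"
  have test: "?\<phi> \<in> test_functions ?U"
    by (rule test_functions_bump_at[OF e sub])
  have div: "divergence (\<lambda>y. ?\<phi> y *\<^sub>R b y) x = ?\<phi> x * jacobian_trace b x + grad ?\<phi> x \<bullet> b x" if "x \<in> ?U" for x
    using C1 that by (intro divergence_scaleR[OF test]) (auto simp: C1_on_def)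
  have L0: "0 \<le> L / e"
    using L[of 0] norm_ge_zero order_trans by blast
  have zero: "?\<phi> x = 0" "grad ?\<phi> x = 0" if "x \<notin> ?K" for x
    using that grad_bump_at_eq_0[OF e that] bump_at_eq_0[OF e, of x a]
    by (auto simp: dist_norm norm_minus_commute)
  \<comment> \<open>The drift coefficient is Borel and bounded with compact support; the part with \<open>c\<close> is only locally
    integrable after multiplication by \<open>u\<close>, so it is kept separate.\<close>
  define g where "g x = - (indicator ?U x * (?\<phi> x * jacobian_trace b x + grad ?\<phi> x \<bullet> b x))" for x
  define G where "G x = u x * g x + (indicator ?K x * (c x * u x)) * ?\<phi> x" for x
  have g_borel: "g \<in> borel_measurable borel"
    unfolding g_def[abs_def] using drift_coefficient_borel[OF C1 _ test] by simp
  have "integrable lborel (\<lambda>x. u x * g x)"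
  proof (rule integrable_mult_bounded_set[OF g_borel])
    show "\<bar>g x\<bar> \<le> 1 * (?N * M) + (L / e) * M" for x
    proof (cases "x \<in> ?U")
      case True
      have "\<bar>?\<phi> x * jacobian_trace b x\<bar> \<le> 1 * (?N * M)"
        unfolding abs_mult using True
        by (intro mult_mono abs_bump_at_le_1 jacobian_trace_bound[OF C1 norm_C1 M]) auto
      moreover have "\<bar>grad ?\<phi> x \<bullet> b x\<bar> \<le> (L / e) * M"
        using Cauchy_Schwarz_ineq2[of "grad ?\<phi> x" "b x"]
          mult_mono[OF L[of x] C1_norm_value_bound[OF C1 norm_C1 M True] L0 norm_ge_zero]
        by linarith
      ultimately have "\<bar>?\<phi> x * jacobian_trace b x + grad ?\<phi> x \<bullet> b x\<bar> \<le> 1 * (?N * M) + (L / e) * M"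
        by linarith
      with True show ?thesis
        by (simp add: g_def)
    next
      case False
      have "0 \<le> 1 * (?N * M) + (L / e) * M"
        using M L0 by (intro add_nonneg_nonneg mult_nonneg_nonneg) auto
      with False show ?thesis
        by (simp only: g_def) simp
    qed
    show "g x = 0" if "x \<notin> ?K" for x
      using zero[OF that] by (simp add: g_def)
  qed simp
  then have "integrable lebesgue (\<lambda>x. u x * g x)"
    by (rule integrable_completion[THEN iffD2, rotated]) (use g_borel in measurable)
  moreover have "integrable lebesgue (\<lambda>x. (indicator ?K x * (c x * u x)) * ?\<phi> x)"
  proof (rule integrable_mult_bounded)
    show "integrable lebesgue (\<lambda>x. indicator ?K x * (c x * u x))"
      using cu sub compact_cball unfolding locally_integrable_on_def set_integrable_def by fastforce
    show "?\<phi> \<in> borel_measurable lebesgue"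
      by (rule measurable_completion) simp
  qed (rule abs_bump_at_le_1)
  ultimately have G_int: "integrable lebesgue G"
    unfolding G_def[abs_def] by (rule Bochner_Integration.integrable_add)
  have G_eq: "(LINT x:?U|lebesgue. u x * (- divergence (\<lambda>y. ?\<phi> y *\<^sub>R b y) x + c x * ?\<phi> x)) = (LINT x|lebesgue. G x)"
    unfolding set_lebesgue_integral_def
  proof (rule Bochner_Integration.integral_cong)
    fix x
    show "indicator ?U x *\<^sub>R (u x * (- divergence (\<lambda>y. ?\<phi> y *\<^sub>R b y) x + c x * ?\<phi> x)) = G x"
    proof (cases "x \<in> ?U")
      case True
      then show ?thesis
        using zero(1)[of x] by (cases "x \<in> ?K") (simp_all add: G_def g_def div algebra_simps)
    next
      case False
      then have "x \<notin> ?K" using sub by blast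
      with False show ?thesis
        by (simp add: G_def g_def zero)
    qed
  qed simp
  define H where "H x = ((?N + 1) * M) * (u x * ?\<phi> x) - u x * (grad ?\<phi> x \<bullet> b a) + (M * L) * (u x * indicator ?K x)" for x
  have i1: "integrable lborel (\<lambda>x. u x * ?\<phi> x)"
    by (rule integrable_mult_bump_at[OF e])
  have i2: "integrable lborel (\<lambda>x. u x * (grad ?\<phi> x \<bullet> b a))"
  proof (rule integrable_mult_bounded_set)
    show "(\<lambda>x. grad ?\<phi> x \<bullet> b a) \<in> borel_measurable borel"
      unfolding grad_def inner_vec_def
      using test_function_borel[OF partial_deriv_test_function[OF test]] by simp
    show "\<bar>grad ?\<phi> x \<bullet> b a\<bar> \<le> (L / e) * norm (b a)" for x
      using Cauchy_Schwarz_ineq2[of "grad ?\<phi> x" "b a"] mult_right_mono[OF L[of x] norm_ge_zero[of "b a"]]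
      by linarith
    show "bounded ?K" by simp
  qed (use zero in simp)
  have i3: "integrable lborel (\<lambda>x. u x * indicator ?K x)"
    by (rule integrable_mult_bounded_set[of _ 1 ?K])
      (auto intro!: borel_measurable_indicator)
  have H_int: "integrable lborel H"
    unfolding H_def[abs_def]
    by (intro Bochner_Integration.integrable_add Bochner_Integration.integrable_diff integrable_mult_right i1 i2 i3)
  have H_meas: "H \<in> borel_measurable lborel"
    by (rule borel_measurable_integrable[OF H_int])
  have "(LINT x|lebesgue. G x) \<le> (LINT x|lebesgue. H x)"
  proof (rule Bochner_Integration.integral_mono[OF G_int])
    show "integrable lebesgue H"
      using H_int H_meas by (simp add: integrable_completion)
    fix x
    show "G x \<le> H x"
    proof (cases "x \<in> ?K")
      case False
      then show ?thesis by (simp add: G_def H_def g_def zero)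
    next
      case True
      with sub have xU: "x \<in> ?U" and aU: "a \<in> ?U"
        using e by (auto simp: subset_iff)
      have "c x * ?\<phi> x \<le> M * ?\<phi> x"
        using c[OF xU] by (intro mult_right_mono) auto
      moreover have "- (?\<phi> x * jacobian_trace b x) \<le> ?N * M * ?\<phi> x"
      proof -
        have "?\<phi> x * - jacobian_trace b x \<le> ?\<phi> x * (?N * M)"
          using jacobian_trace_bound[OF C1 norm_C1 M xU] by (intro mult_left_mono) auto
        then show ?thesis by (simp add: mult_ac)
      qed
      moreover have "- (grad ?\<phi> x \<bullet> b x) \<le> - (grad ?\<phi> x \<bullet> b a) + M * L"
      proof -
        have "norm (b x - b a) \<le> M * norm (x - a)"
          by (rule C1_norm_lipschitz[OF C1 norm_C1 M convex_ball xU aU])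
        also have "\<dots> \<le> M * e"
          using True M by (intro mult_left_mono) (auto simp: dist_norm norm_minus_commute)
        finally have "norm (grad ?\<phi> x) * norm (b x - b a) \<le> (L / e) * (M * e)"
          by (intro mult_mono L L0) auto
        then have "\<bar>grad ?\<phi> x \<bullet> (b x - b a)\<bar> \<le> M * L"
          using Cauchy_Schwarz_ineq2[of "grad ?\<phi> x" "b x - b a"] e by (simp add: mult.commute)
        then show ?thesis
          by (simp add: inner_diff_right)
      qed
      ultimately have "- (?\<phi> x * jacobian_trace b x + grad ?\<phi> x \<bullet> b x) + c x * ?\<phi> x \<le>
          (?N + 1) * M * ?\<phi> x - grad ?\<phi> x \<bullet> b a + M * L"
        by (simp add: algebra_simps)
      then have "u x * (- (?\<phi> x * jacobian_trace b x + grad ?\<phi> x \<bullet> b x) + c x * ?\<phi> x) \<le>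
          u x * ((?N + 1) * M * ?\<phi> x - grad ?\<phi> x \<bullet> b a + M * L)"
        by (rule mult_left_mono) (rule u_nonneg)
      with True xU show ?thesis
        by (simp add: G_def H_def g_def algebra_simps)
    qed
  qed
  also have "(LINT x|lebesgue. H x) = (LINT x|lborel. H x)"
    by (rule integral_completion[OF H_meas])
  also have "\<dots> = ((?N + 1) * M) * moll u e a - 0 + (M * L) * (LINT y|lborel. u y * indicator ?K y)"
    unfolding H_def[abs_def] moll_def
    by (subst Bochner_Integration.integral_add Bochner_Integration.integral_diff;
        (intro Bochner_Integration.integrable_add Bochner_Integration.integrable_diff integrable_mult_right i1 i2 i3)?)+
      (simp add: crit)
  finally show ?thesis
    unfolding G_eq by simp
qed

text \<open>
  After exchanging the integrals, each point \<open>y\<close> of the ball around \<open>a\<close> is weighted by the integral of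
  \<open>bump_at a e (y + z)\<close> over \<open>z\<close> in the shell. All \<open>z\<close> in the support satisfy \<open>|z| \<le> 2 e\<close>, so only the hole
  \<open>|z| < \<eta> e\<close> is lost, which costs at most half of the mass. The hole is there because the kernel is truncated.
\<close>

lemma shell_mass:
  assumes e: "0 < e" and q: "0 < \<eta>" "\<eta> ^ CARD('n) * measure lborel (ball (0 :: real^'n) 1) \<le> bump_mass TYPE('n) / 2"
  shows "(e ^ CARD('n) * bump_mass TYPE('n) / 2) * (LINT y|lborel. u y * indicator (cball a e) y)
    \<le> (LINT z|lborel. indicator (shell (\<eta> * e) (2 * e)) z * moll u e (a - z))"
proof -
  let ?S = "shell (\<eta> * e) (2 * e)" and ?m = "e ^ CARD('n) * bump_mass TYPE('n)"
  have [measurable]: "(indicator ?S :: real^'n \<Rightarrow> real) \<in> borel_measurable borel"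
    by (intro borel_measurable_indicator shell_borel)
  have [measurable]: "(indicator (cball a e) :: real^'n \<Rightarrow> real) \<in> borel_measurable borel"
    by (intro borel_measurable_indicator) simp
  define f where "f y z = u y * (indicator ?S z * bump_at a e (y + z))" for y z
  define k where "k y = (LINT z|lborel. indicator ?S z * bump_at a e (y + z))" for y
  have shifted: "bump_at a e (y + z) = bump_at (a - y) e z" for y z
    using bump_at_shift[of a e z y] by (simp add: add.commute)
  have int_bump: "integrable lborel (\<lambda>z. bump_at a e (y + z))" for y
    unfolding shifted by (rule integrable_bump_at[OF e])
  have int_k: "integrable lborel (\<lambda>z. indicator ?S z * bump_at a e (y + z))" for y
  proof (subst mult.commute, rule integrable_mult_bounded[OF int_bump])
    show "(indicator ?S :: real^'n \<Rightarrow> real) \<in> borel_measurable lborel"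
      by measurable
    show "\<bar>indicator ?S z :: real\<bar> \<le> 1" for z
      by (simp add: indicator_def)
  qed
  have total: "(LINT z|lborel. bump_at a e (y + z)) = ?m" for y
    unfolding shifted by (rule integral_bump_at[OF e])
  have k_nonneg: "0 \<le> k y" for y
    unfolding k_def by (intro integral_nonneg_AE AE_I2 mult_nonneg_nonneg) auto
  have k_borel [measurable]: "k \<in> borel_measurable borel"
    unfolding k_def[abs_def] by measurable
  have k_le: "k y \<le> ?m" for y
    unfolding total[of y, symmetric] k_def
    by (rule Bochner_Integration.integral_mono[OF int_k int_bump]) (simp add: indicator_def)
  have k_zero: "k y = 0" if "y \<notin> cball a (3 * e)" for y
  proof -
    have "indicator ?S z * bump_at a e (y + z) = 0" for z
    proof (cases "z \<in> ?S")
      case True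
      then have "norm z \<le> 2 * e" by (simp add: shell_def)
      moreover have "3 * e < norm (y - a)"
        using that by (simp add: dist_norm norm_minus_commute)
      moreover have "norm (y - a) \<le> norm (y + z - a) + norm z"
        using norm_triangle_ineq4[of "y + z - a" z] by (simp add: algebra_simps)
      ultimately have "e \<le> norm (y + z - a)" by linarith
      then show ?thesis by (simp add: bump_at_eq_0[OF e])
    qed simp
    then show ?thesis by (simp only: k_def Bochner_Integration.integral_zero)
  qed
  have uk: "integrable lborel (\<lambda>y. u y * k y)"
    by (rule integrable_mult_bounded_set[OF k_borel, of ?m "cball a (3 * e)"])
      (use k_nonneg k_le k_zero in auto)
  have "?m / 2 \<le> k y" if y: "y \<in> cball a e" for y
  proof -
    let ?B = "ball (0 :: real^'n) (\<eta> * e)"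
    have int_B: "integrable lborel (indicator ?B :: real^'n \<Rightarrow> real)"
      using emeasure_lborel_ball_finite[of "0 :: real^'n" "\<eta> * e"] by (intro integrable_real_indicator) auto
    have "bump_at a e (y + z) - indicator ?B z \<le> indicator ?S z * bump_at a e (y + z)" for z
    proof -
      have "bump_at a e (y + z) = 0" if "2 * e < norm z"
      proof (rule bump_at_eq_0[OF e])
        have "norm z \<le> norm (y + z - a) + norm (y - a)"
          using norm_triangle_ineq4[of "y + z - a" "y - a"] by simp
        then show "e \<le> norm (y + z - a)"
          using that y by (simp add: dist_norm norm_minus_commute)
      qed
      then show ?thesis
        using bump_at_le_1[of a e "y + z"] by (auto simp: shell_def indicator_def not_le not_less)
    qed
    then have "(LINT z|lborel. bump_at a e (y + z) - indicator ?B z) \<le> k y"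
      unfolding k_def by (intro Bochner_Integration.integral_mono Bochner_Integration.integrable_diff int_bump int_B int_k)
    then have "?m - measure lborel ?B \<le> k y"
      by (subst (asm) Bochner_Integration.integral_diff[OF int_bump int_B]) (simp add: total)
    moreover have "measure lborel ?B = e ^ CARD('n) * (\<eta> ^ CARD('n) * measure lborel (ball (0 :: real^'n) 1))"
      using e q by (subst content_ball_conv_unit_ball) (auto simp: power_mult_distrib)
    moreover have "e ^ CARD('n) * (\<eta> ^ CARD('n) * measure lborel (ball (0 :: real^'n) 1)) \<le> e ^ CARD('n) * (bump_mass TYPE('n) / 2)"
      using e q by (intro mult_left_mono) auto
    ultimately show ?thesis by simp
  qed
  then have "u y * ((?m / 2) * indicator (cball a e) y) \<le> u y * k y" for y
    using k_nonneg u_nonneg by (intro mult_left_mono) (auto simp: indicator_def)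
  moreover have "integrable lborel (\<lambda>y. u y * ((?m / 2) * indicator (cball a e) y))"
    by (rule integrable_mult_bounded_set[of _ "\<bar>?m / 2\<bar>" "cball a e"])
      (auto simp: indicator_def)
  ultimately have "(LINT y|lborel. u y * ((?m / 2) * indicator (cball a e) y)) \<le> (LINT y|lborel. u y * k y)"
    by (intro Bochner_Integration.integral_mono uk)
  moreover have "(LINT y|lborel. u y * k y) = (LINT z|lborel. indicator ?S z * moll u e (a - z))"
  proof -
    have "integrable (lborel \<Otimes>\<^sub>M lborel) (\<lambda>(y, z). f y z)"
    proof (rule lborel_pair.Fubini_integrable)
      show "(\<lambda>(y, z). f y z) \<in> borel_measurable (lborel \<Otimes>\<^sub>M lborel)"
        unfolding f_def by measurable
      show "AE y in lborel. integrable lborel (\<lambda>z. case (y, z) of (y, z) \<Rightarrow> f y z)"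
        unfolding f_def using int_k by simp
      show "integrable lborel (\<lambda>y. LINT z|lborel. norm (case (y, z) of (y, z) \<Rightarrow> f y z))"
        using uk u_nonneg by (simp add: f_def abs_mult k_def)
    qed
    from lborel_pair.Fubini_integral[OF this]
    have "(LINT y|lborel. LINT z|lborel. f y z) = (LINT z|lborel. LINT y|lborel. f y z)"
      by simp
    moreover have "(LINT y|lborel. f y z) = indicator ?S z * moll u e (a - z)" for z
      by (simp add: f_def moll_def bump_at_shift mult.left_commute[of _ "indicator ?S z"])
    ultimately show ?thesis
      by (simp add: f_def k_def)
  qed
  moreover have "(LINT y|lborel. u y * ((?m / 2) * indicator (cball a e) y)) =
      (?m / 2) * (LINT y|lborel. u y * indicator (cball a e) y)"
    by (simp only: mult.left_commute[of _ "?m / 2"] integral_mult_right_zero)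
  ultimately show ?thesis
    by linarith
qed

end

section \<open>The estimate at a minimum point\<close>

context nonneg_weighted
begin

lemma integrable_compact_moll:
  assumes e: "0 < e" and "compact S"
  shows "integrable lborel (\<lambda>z. indicator S z * moll u e (a - z))"
proof -
  have "continuous_on UNIV (moll u e)"
    by (rule continuous_moll[OF e])
  then have "continuous_on S (\<lambda>z. moll u e (a - z))"
    by (rule continuous_on_compose2) (auto intro!: continuous_intros)
  from borel_integrable_compact[OF \<open>compact S\<close> this] show ?thesis
    by (simp add: set_integrable_def)
qed

text \<open>
  A pointwise bound on the integrand, integrated. Where \<open>|z| \<ge> r/8\<close> the integrand is at most \<open>w(a) K(z)\<close>, improved by
  \<open>\<mu> K(z)\<close> on a ball \<open>?D\<close> on which \<open>a - z\<close> runs through part of the annulus. Where \<open>|z| < r/8\<close> the point \<open>a - z\<close>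
  stays in the ball over which \<open>a\<close> is minimal, so the integrand is nonpositive, and on the shell any fraction of
  it can be kept. The parameter \<open>\<kappa>\<close> measures this fraction and remains free until the drift error is known.
\<close>

lemma nonlocal_bound_at_min:
  fixes a x\<^sub>0 :: "real^'n"
  defines "p \<equiv> real CARD('n) + 2 * s" and "\<omega> \<equiv> measure lborel (ball (0 :: real^'n) 1)"
  assumes e: "0 < e" "32 * e \<le> r" and eta: "0 < \<eta>" "\<eta> < 1" and d: "0 < d" "d < \<eta> * e"
    and a: "norm (a - x\<^sub>0) \<le> r / 2 + e"
    and min: "\<And>x. x \<in> cball x\<^sub>0 (3 / 4 * r) \<Longrightarrow> moll u e a \<le> moll u e x"
    and mu: "0 \<le> \<mu>" "\<And>x. 11 / 16 * r \<le> norm (x - x\<^sub>0) \<Longrightarrow> norm (x - x\<^sub>0) \<le> 3 / 4 * r \<Longrightarrow> \<mu> \<le> moll u e x"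
    and tail: "(LINT z|lborel. trunc_kern s (r / 8) (z :: real^'n)) \<le> T"
    and kappa: "0 \<le> \<kappa>" "\<kappa> \<le> 1 / (2 * e) powr p"
  shows "(LINT z|lborel. trunc_kern s d z * (moll u e a - moll u e (a - z))) \<le>
    moll u e a * T - \<mu> * (1 / (2 * r) powr p) * ((r / 32) ^ CARD('n) * \<omega>) +
    \<kappa> * (moll u e a * ((2 * e) ^ CARD('n) * \<omega>) -
      (LINT z|lborel. indicator (shell (\<eta> * e) (2 * e)) z * moll u e (a - z)))"
proof -
  let ?w = "moll u e"
  have r: "0 < r" using e by linarith
  have w_nonneg: "0 \<le> ?w x" for x
    by (rule moll_nonneg)
  obtain i :: 'n where True by blast
  \<comment> \<open>The ball of radius \<open>r/32\<close> around \<open>y0\<close> lies in the annulus with radii \<open>11r/16\<close> and \<open>3r/4\<close>.\<close>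
  define y0 where "y0 = x\<^sub>0 + (23 / 32 * r) *\<^sub>R (axis i 1 :: real^'n)"
  have y0: "norm (y0 - x\<^sub>0) = 23 / 32 * r"
    using r by (simp add: y0_def)
  let ?D = "ball (a - y0) (r / 32)" and ?S = "shell (\<eta> * e) (2 * e) :: (real^'n) set" and ?C = "cball (0 :: real^'n) (2 * e)"
  have D: "11 / 16 * r \<le> norm (a - z - x\<^sub>0)" "norm (a - z - x\<^sub>0) \<le> 3 / 4 * r" "r / 8 \<le> norm z" "norm z \<le> 2 * r"
    if "z \<in> ?D" for z
  proof -
    have near: "norm (a - z - y0) < r / 32"
    proof -
      have "a - y0 - z = a - z - y0" by simp
      then show ?thesis using that by (simp only: mem_ball dist_norm)
    qed
    have eq: "a - z - x\<^sub>0 = (a - z - y0) + (y0 - x\<^sub>0)" by simp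
    show up: "norm (a - z - x\<^sub>0) \<le> 3 / 4 * r"
      using norm_triangle_ineq[of "a - z - y0" "y0 - x\<^sub>0"] near y0 r unfolding eq by linarith
    show low: "11 / 16 * r \<le> norm (a - z - x\<^sub>0)"
      using norm_diff_ineq[of "y0 - x\<^sub>0" "a - z - y0"] near y0 r unfolding eq by (simp add: add.commute)
    have eq2: "a - z - x\<^sub>0 = (a - x\<^sub>0) - z" by simp
    show "r / 8 \<le> norm z"
      using norm_triangle_ineq4[of "a - x\<^sub>0" z] low a e unfolding eq2 by linarith
    have "z = (a - x\<^sub>0) - (a - z - x\<^sub>0)" by simp
    then have "norm z \<le> norm (a - x\<^sub>0) + norm (a - z - x\<^sub>0)"
      by (metis norm_triangle_ineq4)
    then show "norm z \<le> 2 * r"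
      using up a e r by linarith
  qed
  have pointwise: "trunc_kern s d z * (?w a - ?w (a - z)) \<le>
      ?w a * trunc_kern s (r / 8) z - (\<mu> * (1 / (2 * r) powr p)) * indicator ?D z
      + (\<kappa> * ?w a) * indicator ?C z - \<kappa> * (indicator ?S z * ?w (a - z))" for z
  proof (cases "r / 8 \<le> norm z")
    case True
    \<comment> \<open>The truncation radius is below \<open>e\<close>, so neither truncation is felt here.\<close>
    have "\<eta> * e < e" using e eta by simp
    then have tk: "trunc_kern s d z = kern s z" "trunc_kern s (r / 8) z = kern s z"
    proof -
      have "d \<le> norm z"
        using True e d \<open>\<eta> * e < e\<close> by linarith
      with True show "trunc_kern s d z = kern s z" "trunc_kern s (r / 8) z = kern s z"
        by (simp_all add: trunc_kern_def)
    qed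
    have out: "z \<notin> ?S" "z \<notin> ?C"
      using True e by (auto simp: shell_def)
    have "kern s z * (?w a - ?w (a - z)) \<le> kern s z * ?w a - (\<mu> * (1 / (2 * r) powr p)) * indicator ?D z"
    proof (cases "z \<in> ?D")
      case inD: True
      have "z \<noteq> 0" using True r by auto
      then have "\<mu> * (1 / (2 * r) powr p) \<le> ?w (a - z) * kern s z"
        unfolding p_def using inD D[OF inD] mu w_nonneg
        by (intro mult_mono kern_lower[OF s]) auto
      with inD show ?thesis by (simp add: algebra_simps)
    next
      case False
      then show ?thesis using w_nonneg[of "a - z"] by (simp add: right_diff_distrib)
    qed
    with tk out show ?thesis by (simp add: mult.commute)
  next
    case False
    then have nD: "z \<notin> ?D" using D(3)[of z] by blast
    have "norm (a - z - x\<^sub>0) \<le> 3 / 4 * r"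
      using norm_triangle_ineq4[of "a - x\<^sub>0" z] False a e by (simp add: algebra_simps)
    then have diff: "?w a - ?w (a - z) \<le> 0"
      using min[of "a - z"] by (simp add: dist_norm norm_minus_commute)
    have tk: "trunc_kern s (r / 8) z = 0"
      using False by (simp add: trunc_kern_def)
    show ?thesis
    proof (cases "z \<in> ?S")
      case True
      then have z: "\<eta> * e \<le> norm z" "norm z \<le> 2 * e" by (auto simp: shell_def)
      then have "z \<noteq> 0" using e eta by (auto simp: mult_le_0_iff)
      then have "\<kappa> \<le> kern s z"
        using kappa(2) kern_lower[OF s _ z(2)] unfolding p_def by linarith
      moreover have "trunc_kern s d z = kern s z"
        using z d by (simp add: trunc_kern_def)
      ultimately have "trunc_kern s d z * (?w a - ?w (a - z)) \<le> \<kappa> * (?w a - ?w (a - z))"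
        using diff by (intro mult_right_mono_neg) auto
      then show ?thesis
        using True z nD tk by (simp add: right_diff_distrib)
    next
      case False
      have "trunc_kern s d z * (?w a - ?w (a - z)) \<le> 0"
        using diff by (intro mult_nonneg_nonpos) auto
      also have "0 \<le> (\<kappa> * ?w a) * indicator ?C z"
        using kappa w_nonneg by simp
      finally show ?thesis
        using False nD tk by simp
    qed
  qed
  have test: "bump_at a e \<in> test_functions UNIV"
    by (rule test_functions_bump_at[OF e(1)]) simp
  obtain R where R: "1 \<le> R" "\<And>x. R \<le> norm x \<Longrightarrow> bump_at a e x = 0"
    using test_function_support[OF test] by blast
  have int_left: "integrable lborel (\<lambda>z. trunc_kern s d z * (?w a - ?w (a - z)))"
    using integral_trunc_lap_swap(1)[OF test_function_borel[OF test] abs_bump_at_le_1 R d(1)]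
    unfolding bump_at_shift moll_def by simp
  have int_T: "integrable lborel (trunc_kern s (r / 8) :: real^'n \<Rightarrow> real)"
    using r by (intro integrable_trunc_kern s) simp
  have int_ball: "integrable lborel (indicator ?D :: real^'n \<Rightarrow> real)"
    using emeasure_lborel_ball_finite[of "a - y0" "r / 32"] by (intro integrable_real_indicator) auto
  have int_cball: "integrable lborel (indicator ?C :: real^'n \<Rightarrow> real)"
    using emeasure_lborel_cball_finite[of "0 :: real^'n" "2 * e"] by (intro integrable_real_indicator) auto
  have int_shell: "integrable lborel (\<lambda>z. indicator ?S z * ?w (a - z))"
    unfolding shell_def by (intro integrable_compact_moll e compact_diff) auto
  note ints = Bochner_Integration.integrable_add Bochner_Integration.integrable_diff integrable_mult_right
    int_T int_ball int_cball int_shell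
  have "(LINT z|lborel. trunc_kern s d z * (?w a - ?w (a - z))) \<le>
      (LINT z|lborel. ?w a * trunc_kern s (r / 8) z - (\<mu> * (1 / (2 * r) powr p)) * indicator ?D z
      + (\<kappa> * ?w a) * indicator ?C z - \<kappa> * (indicator ?S z * ?w (a - z)))"
    by (intro Bochner_Integration.integral_mono int_left pointwise ints)
  also have "\<dots> = ?w a * (LINT z|lborel. trunc_kern s (r / 8) (z :: real^'n)) - (\<mu> * (1 / (2 * r) powr p)) * measure lborel ?D
      + (\<kappa> * ?w a) * measure lborel ?C - \<kappa> * (LINT z|lborel. indicator ?S z * ?w (a - z))"
  proof -
    have "has_bochner_integral lborel (\<lambda>z. ?w a * trunc_kern s (r / 8) z - (\<mu> * (1 / (2 * r) powr p)) * indicator ?D z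
      + (\<kappa> * ?w a) * indicator ?C z - \<kappa> * (indicator ?S z * ?w (a - z)))
      (?w a * (LINT z|lborel. trunc_kern s (r / 8) (z :: real^'n)) - (\<mu> * (1 / (2 * r) powr p)) * (LINT z|lborel. indicator ?D z)
      + (\<kappa> * ?w a) * (LINT z|lborel. indicator ?C z) - \<kappa> * (LINT z|lborel. indicator ?S z * ?w (a - z)))"
      by (intro has_bochner_integral_add has_bochner_integral_diff has_bochner_integral_mult_right
        has_bochner_integral_integrable int_T int_ball int_cball int_shell)
    then show ?thesis
      by (simp add: has_bochner_integral_iff)
  qed
  also have "measure lborel ?D = (r / 32) ^ CARD('n) * \<omega>"
    unfolding \<omega>_def using r by (subst content_ball_conv_unit_ball) auto
  also have "measure lborel ?C = (2 * e) ^ CARD('n) * \<omega>"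
    unfolding \<omega>_def content_cball_conv_ball using e by (subst content_ball_conv_unit_ball) auto
  also have "?w a * (LINT z|lborel. trunc_kern s (r / 8) (z :: real^'n)) \<le> ?w a * T"
    by (rule mult_left_mono[OF tail w_nonneg])
  finally show ?thesis
    by (simp add: algebra_simps)
qed

text \<open>
  The balance at a minimum point: with \<open>\<kappa>\<close> chosen so that the shell term absorbs the drift error, the
  quantity \<open>\<integral> u\<close> over the small ball disappears and only multiples of \<open>w(a)\<close> and of \<open>\<mu>\<close> are left. The
  smallness condition on \<open>e\<close> says that this \<open>\<kappa>\<close> is an admissible fraction of the kernel on the shell.
\<close>

lemma min_point_estimate:
  fixes a x\<^sub>0 :: "real^'n" and b :: "real^'n \<Rightarrow> real^'n"
  defines "p \<equiv> real CARD('n) + 2 * s" and "\<omega> \<equiv> measure lborel (ball (0 :: real^'n) 1)"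
    and "\<beta> \<equiv> bump_mass TYPE('n)" and "k \<equiv> frac_laplacian_const CARD('n) s"
  assumes s1: "s < 1"
    and C1: "C1_on (ball x\<^sub>0 r) b" and norm_C1: "C1_norm (ball x\<^sub>0 r) b \<le> ennreal M" and M: "0 \<le> M"
    and c: "\<And>x. x \<in> ball x\<^sub>0 r \<Longrightarrow> c x \<le> M"
    and cu: "locally_integrable_on (\<lambda>x. c x * u x) (ball x\<^sub>0 r)"
    and super: "distributional_supersolution s (ball x\<^sub>0 r) b c u"
    and e: "0 < e" "32 * e \<le> r" and small: "2 * M * L * (2 * e) powr p \<le> k * (e ^ CARD('n) * \<beta>)"
    and L: "0 \<le> L" "\<And>y. norm (grad (bump_at a e) y) \<le> L / e"
    and a: "norm (a - x\<^sub>0) \<le> r / 2 + e"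
    and min: "\<And>x. x \<in> cball x\<^sub>0 (3 / 4 * r) \<Longrightarrow> moll u e a \<le> moll u e x"
    and mu: "0 \<le> \<mu>" "\<And>x. 11 / 16 * r \<le> norm (x - x\<^sub>0) \<Longrightarrow> norm (x - x\<^sub>0) \<le> 3 / 4 * r \<Longrightarrow> \<mu> \<le> moll u e x"
    and tail: "(LINT z|lborel. trunc_kern s (r / 8) (z :: real^'n)) \<le> T"
  shows "k * \<mu> * ((1 / (2 * r) powr p) * ((r / 32) ^ CARD('n) * \<omega>)) \<le>
    moll u e a * (k * T + 2 * M * L * 2 ^ CARD('n) * \<omega> / \<beta> + (real CARD('n) + 1) * M)"
proof -
  let ?w = "moll u e" and ?m = "e ^ CARD('n) * \<beta>" and ?Q = "LINT y|lborel. u y * indicator (cball a e) y"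
  let ?\<phi> = "bump_at a e"
  have r: "0 < r" using e by linarith
  have \<beta>: "0 < \<beta>" unfolding \<beta>_def by (rule bump_mass_pos)
  have k: "0 < k" unfolding k_def by (rule frac_laplacian_const_pos[OF s s1])
  have \<omega>: "0 < \<omega>" unfolding \<omega>_def by (rule content_ball_pos) simp
  have m: "0 < ?m" using e \<beta> by simp
  \<comment> \<open>Small enough that the hole of the shell contains at most half of the mass of a bump.\<close>
  obtain \<eta> where eta: "0 < \<eta>" "\<eta> < 1" "\<eta> ^ CARD('n) * \<omega> \<le> \<beta> / 2"
  proof -
    define \<eta> where "\<eta> = min (1 / 2) (\<beta> / (2 * \<omega>))"
    have \<eta>: "0 < \<eta>" "\<eta> < 1" "\<eta> \<le> \<beta> / (2 * \<omega>)"
      using \<beta> \<omega> by (auto simp: \<eta>_def)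
    have "\<eta> ^ CARD('n) \<le> \<eta> ^ 1"
      using \<eta> by (intro power_decreasing) auto
    with \<eta> have "\<eta> ^ CARD('n) * \<omega> \<le> \<beta> / (2 * \<omega>) * \<omega>"
      using \<omega> by (intro mult_right_mono) auto
    with \<eta> \<omega> show ?thesis by (intro that[of \<eta>]) auto
  qed
  have "cball a e \<subseteq> ball x\<^sub>0 r"
  proof
    fix x assume "x \<in> cball a e"
    then have "norm (x - x\<^sub>0) \<le> e + (r / 2 + e)"
      using norm_triangle_ineq[of "x - a" "a - x\<^sub>0"] a by (simp add: dist_norm norm_minus_commute)
    then show "x \<in> ball x\<^sub>0 r"
      using e r by (simp add: dist_norm norm_minus_commute)
  qed
  note sub = this
  have test: "?\<phi> \<in> test_functions (ball x\<^sub>0 r)"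
    by (rule test_functions_bump_at[OF e(1) sub])
  have crit: "(LINT y|lborel. u y * (grad ?\<phi> y \<bullet> v)) = 0" for v
  proof (rule integral_grad_at_local_min[OF e(1)])
    show "0 < r / 8" using r by simp
    fix x assume x: "x \<in> ball a (r / 8)"
    have "norm (x - x\<^sub>0) \<le> norm (x - a) + norm (a - x\<^sub>0)"
      using norm_triangle_ineq[of "x - a" "a - x\<^sub>0"] by simp
    with x a e r show "?w a \<le> ?w x"
      by (intro min) (simp add: dist_norm norm_minus_commute)
  qed
  let ?drift = "LINT x:ball x\<^sub>0 r|lebesgue. u x * (- divergence (\<lambda>y. ?\<phi> y *\<^sub>R b y) x + c x * ?\<phi> x)"
  have drift: "?drift \<le> (real CARD('n) + 1) * M * ?w a + M * L * ?Q"
    by (rule drift_term_bound[OF C1 norm_C1 M c cu e(1) sub L(2) crit])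
  \<comment> \<open>With this choice \<open>k \<kappa> (?m / 2)\<close>, the factor in front of \<open>?Q\<close> gained on the shell, equals \<open>M L\<close>.\<close>
  define \<kappa> where "\<kappa> = 2 * M * L / (k * ?m)"
  have kappa: "0 \<le> \<kappa>" "\<kappa> \<le> 1 / (2 * e) powr p"
  proof -
    show "0 \<le> \<kappa>" using M L(1) k m by (simp add: \<kappa>_def)
    show "\<kappa> \<le> 1 / (2 * e) powr p"
      using small k m e by (simp add: \<kappa>_def divide_simps mult.commute)
  qed
  define A where "A = (1 / (2 * r) powr p) * ((r / 32) ^ CARD('n) * \<omega>)"
  define S where "S = (LINT z|lborel. indicator (shell (\<eta> * e) (2 * e)) z * ?w (a - z))"
  have S: "(?m / 2) * ?Q \<le> S"
    using shell_mass[OF e(1) eta(1), of a] eta(3)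
    unfolding S_def \<beta>_def \<omega>_def by simp
  let ?X = "?w a * T - \<mu> * (1 / (2 * r) powr p) * ((r / 32) ^ CARD('n) * \<omega>) +
    \<kappa> * (?w a * ((2 * e) ^ CARD('n) * \<omega>) - S)"
  have swap: "(LINT z|lborel. trunc_kern s d z *
      ((LINT y|lborel. u y * ?\<phi> y) - (LINT y|lborel. u y * ?\<phi> (y + z)))) \<le> ?X"
    if "0 < d" "d < \<eta> * e" for d
    using nonlocal_bound_at_min[OF e eta(1,2) that a min mu tail, of \<kappa>] kappa
    unfolding bump_at_shift moll_def S_def p_def \<omega>_def by simp
  have "0 < \<eta> * e" using eta e by simp
  note frac = integral_frac_laplacian_le[OF s1 test this swap]
  note [measurable] = frac_laplacian_borel[OF s s1 test]
  have "(LINT x|lebesgue. u x * frac_laplacian s ?\<phi> x) = (LINT x|lborel. u x * frac_laplacian s ?\<phi> x)"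
    by (rule integral_completion) measurable
  with frac have "(LINT x|lebesgue. u x * frac_laplacian s ?\<phi> x) \<le> k * ?X"
    by (simp only: k_def)
  moreover have "0 \<le> (LINT x|lebesgue. u x * frac_laplacian s ?\<phi> x) + ?drift"
    using super test unfolding distributional_supersolution_def by simp
  ultimately have main: "0 \<le> k * ?X + ((real CARD('n) + 1) * M * ?w a + M * L * ?Q)"
    using drift by linarith
  have absorbed: "k * \<kappa> * ((?m / 2) * ?Q) \<le> k * \<kappa> * S"
    using S k kappa by (intro mult_left_mono) auto
  have "k * \<kappa> * (?m / 2) = M * L"
  proof -
    have "k * (2 * M * L / (k * t)) * (t / 2) = M * L" if "0 < t" for t
      using k that by (simp add: field_simps)
    from this[OF m] show ?thesis
      unfolding \<kappa>_def .
  qed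
  then have "k * \<kappa> * ((?m / 2) * ?Q) = M * L * ?Q"
    by (simp only: mult.assoc[symmetric])
  with absorbed have "M * L * ?Q \<le> k * \<kappa> * S"
    by (simp only:)
  moreover have "k * \<kappa> * ((2 * e) ^ CARD('n) * \<omega>) = 2 * M * L * 2 ^ CARD('n) * \<omega> / \<beta>"
    using k e \<beta> by (simp add: \<kappa>_def power_mult_distrib)
  then have "?w a * (2 * M * L * 2 ^ CARD('n) * \<omega> / \<beta>) = ?w a * (k * \<kappa> * ((2 * e) ^ CARD('n) * \<omega>))"
    by simp
  moreover have "k * ?X = ?w a * (k * T) - k * \<mu> * ((1 / (2 * r) powr p) * ((r / 32) ^ CARD('n) * \<omega>)) +
      ?w a * (k * \<kappa> * ((2 * e) ^ CARD('n) * \<omega>)) - k * \<kappa> * S"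
    by (simp add: algebra_simps)
  ultimately have "k * \<mu> * ((1 / (2 * r) powr p) * ((r / 32) ^ CARD('n) * \<omega>)) \<le>
      ?w a * (k * T) + ?w a * (2 * M * L * 2 ^ CARD('n) * \<omega> / \<beta>) + (real CARD('n) + 1) * M * ?w a"
    using main by linarith
  then show ?thesis
    by (simp add: distrib_left mult.commute)
qed

end

section \<open>From mollifications back to the function\<close>

text \<open>
  The bump is even, so averaging the mollification over a box means mollifying the indicator of the box.
\<close>

lemma bump_at_swap: "bump_at x e y = bump_at y e x"
proof -
  have "(y - x) /\<^sub>R e = - ((x - y) /\<^sub>R e)"
    by (simp add: algebra_simps)
  then show ?thesis
    unfolding bump_at_def by (metis bump_minus)
qed

context nonneg_weighted
begin

lemma moll_lower_of_AE:
  assumes lower: "AE y in lborel. y \<in> ball x e \<longrightarrow> m \<le> u y" and e: "0 < e"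
  shows "m * (e ^ CARD('n) * bump_mass TYPE('n)) \<le> moll u e x"
proof -
  have "(LINT y|lborel. m * bump_at x e y) \<le> moll u e x"
    unfolding moll_def
  proof (rule integral_mono_AE)
    show "integrable lborel (\<lambda>y. m * bump_at x e y)"
      by (intro integrable_mult_right integrable_bump_at[OF e])
    show "integrable lborel (\<lambda>y. u y * bump_at x e y)"
      by (rule integrable_mult_bump_at[OF e])
    show "AE y in lborel. m * bump_at x e y \<le> u y * bump_at x e y"
      using lower
    proof eventually_elim
      fix y assume y: "y \<in> ball x e \<longrightarrow> m \<le> u y"
      show "m * bump_at x e y \<le> u y * bump_at x e y"
      proof (cases "y \<in> ball x e")
        case True
        with y show ?thesis by (intro mult_right_mono) auto
      next
        case False
        then have "bump_at x e y = 0"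
          by (intro bump_at_eq_0[OF e]) (simp add: dist_norm norm_minus_commute)
        then show ?thesis by simp
      qed
    qed
  qed
  then show ?thesis
    by (simp add: integral_bump_at[OF e])
qed

text \<open>
  By Fubini's theorem the integral of the mollification over the box is the integral of \<open>u\<close> against the mollified
  indicator of the box, which converges to the indicator off the boundary. Boxes are used since their boundary
  is a null set.
\<close>

lemma box_integral_lower_of_moll:
  fixes a b :: "real^'n"
  assumes e0: "0 < e0" and lower: "\<And>e x. 0 < e \<Longrightarrow> e < e0 \<Longrightarrow> x \<in> cbox a b \<Longrightarrow>
    \<mu> * (e ^ CARD('n) * bump_mass TYPE('n)) \<le> moll u e x"
  shows "\<mu> * measure lborel (cbox a b) \<le> (LINT y|lborel. u y * indicator (cbox a b) y)"
proof -
  let ?Q = "cbox a b"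
  have [measurable]: "(indicator ?Q :: real^'n \<Rightarrow> real) \<in> borel_measurable borel"
    by (intro borel_measurable_indicator) simp
  \<comment> \<open>The shift by \<open>2\<close> keeps the scales strictly below \<open>e0\<close>.\<close>
  define E where "E k = e0 / real (k + 2)" for k
  have E: "0 < E k" "E k < e0" for k
    using e0 by (auto simp: E_def field_simps intro: add_pos_nonneg)
  have "filterlim E (at_right 0) sequentially"
    unfolding E_def[abs_def] by (rule filterlim_null_sequence[OF e0])
  then have E_lim: "E \<longlonglongrightarrow> 0"
    by (simp add: filterlim_at)
  define m where "m k = E k ^ CARD('n) * bump_mass TYPE('n)" for k
  have m: "0 < m k" for k
    unfolding m_def by (intro mult_pos_pos zero_less_power bump_mass_pos E)
  define h where "h k y = (LINT x|lborel. indicator ?Q x * bump_at y (E k) x)" for k y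
  define g where "g k y = h k y / m k" for k y
  have int_bump: "integrable lborel (bump_at y (E k))" for k and y :: "real^'n"
    by (rule integrable_bump_at[OF E(1)])
  have int_h: "integrable lborel (\<lambda>x. indicator ?Q x * bump_at y (E k) x)" for k y
  proof (subst mult.commute, rule integrable_mult_bounded[OF int_bump])
    show "(indicator ?Q :: real^'n \<Rightarrow> real) \<in> borel_measurable lborel"
      by measurable
    show "\<bar>indicator ?Q x :: real\<bar> \<le> 1" for x
      by (simp add: indicator_def)
  qed
  have total: "(LINT x|lborel. bump_at y (E k) x) = m k" for k and y :: "real^'n"
    unfolding m_def by (rule integral_bump_at[OF E(1)])
  have bump_meas [measurable]: "(\<lambda>(y, x). bump_at y (E k) x) \<in> borel_measurable (lborel \<Otimes>\<^sub>M (lborel :: (real^'n) measure))" for k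
    unfolding bump_at_def by measurable
  have h_borel [measurable]: "h k \<in> borel_measurable borel" for k
  proof -
    have "h k \<in> borel_measurable lborel"
      unfolding h_def[abs_def] by measurable
    then show ?thesis by simp
  qed
  have g_borel [measurable]: "g k \<in> borel_measurable borel" for k
    unfolding g_def[abs_def] by measurable
  have h0: "0 \<le> h k y" for k y
    unfolding h_def by (intro integral_nonneg_AE AE_I2 mult_nonneg_nonneg) auto
  have h1: "h k y \<le> m k" for k y
    unfolding total[of y k, symmetric] h_def
    by (rule Bochner_Integration.integral_mono[OF int_h int_bump]) (simp add: indicator_def)
  have g01: "0 \<le> g k y" "g k y \<le> 1" for k y
    using h0[of k y] h1[of k y] m[of k] by (auto simp: g_def)
  have g_inside: "g k y = 1" if "ball y (E k) \<subseteq> ?Q" for k y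
  proof -
    have "indicator ?Q x * bump_at y (E k) x = bump_at y (E k) x" for x
      using that bump_at_eq_0[OF E(1), of k x y]
      by (cases "x \<in> ball y (E k)") (auto simp: dist_norm norm_minus_commute subset_iff)
    then have "h k y = m k"
      by (simp only: h_def total)
    with m[of k] show ?thesis by (simp add: g_def)
  qed
  have g_outside: "g k y = 0" if "ball y (E k) \<inter> ?Q = {}" for k y
  proof -
    have "indicator ?Q x * bump_at y (E k) x = 0" for x
    proof (cases "x \<in> ball y (E k)")
      case True
      with that have "x \<notin> ?Q" by blast
      then show ?thesis by simp
    next
      case False
      then show ?thesis
        using bump_at_eq_0[OF E(1), of k x y] by (simp add: dist_norm norm_minus_commute)
    qed
    then show ?thesis
      by (simp only: g_def h_def Bochner_Integration.integral_zero div_0)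
  qed
  obtain K where K: "\<And>x. x \<in> ?Q \<Longrightarrow> norm x \<le> K"
    using bounded_cbox[of a b] by (auto simp: bounded_iff)
  have g_far: "g k y = 0" if "y \<notin> cball 0 (K + e0)" for k y
  proof (rule g_outside)
    show "ball y (E k) \<inter> ?Q = {}"
    proof (rule ccontr)
      assume "ball y (E k) \<inter> ?Q \<noteq> {}"
      then obtain x where "x \<in> ball y (E k)" "x \<in> ?Q"
        by blast
      then have x: "norm (y - x) < E k" "norm x \<le> K"
        using K by (simp_all add: dist_norm)
      then have "norm y \<le> K + e0"
        using norm_triangle_sub[of y x] E(2)[of k] by linarith
      with that show False by simp
    qed
  qed
  have int_g: "integrable lborel (\<lambda>y. u y * g k y)" for k
    by (rule integrable_mult_bounded_set[OF g_borel, of _ 1 "cball 0 (K + e0)"])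
      (use g01 g_far in auto)
  have lower_k: "\<mu> * measure lborel ?Q \<le> (LINT y|lborel. u y * g k y)" for k
  proof -
    define f where "f y x = u y * (indicator ?Q x * bump_at y (E k) x)" for y x
    have "integrable (lborel \<Otimes>\<^sub>M lborel) (\<lambda>(y, x). f y x)"
    proof (rule lborel_pair.Fubini_integrable)
      show "(\<lambda>(y, x). f y x) \<in> borel_measurable (lborel \<Otimes>\<^sub>M lborel)"
        unfolding f_def by measurable
      show "AE y in lborel. integrable lborel (\<lambda>x. case (y, x) of (y, x) \<Rightarrow> f y x)"
        unfolding f_def using int_h by simp
      have "integrable lborel (\<lambda>y. m k * (u y * g k y))"
        using int_g by simp
      moreover have "(LINT x|lborel. norm (f y x)) = m k * (u y * g k y)" for y
        using u_nonneg[of y] m[of k] by (simp add: f_def abs_mult g_def h_def)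
      ultimately show "integrable lborel (\<lambda>y. LINT x|lborel. norm (case (y, x) of (y, x) \<Rightarrow> f y x))"
        by simp
    qed
    note swap = lborel_pair.Fubini_integral[OF this] and int_f = lborel_pair.integrable_snd[OF this]
    have inner: "(LINT y|lborel. f y x) = indicator ?Q x * moll u (E k) x" for x
      by (simp add: f_def moll_def bump_at_swap[of _ "E k" x] mult.left_commute[of _ "indicator ?Q x"])
    have "\<mu> * m k * indicator ?Q x \<le> indicator ?Q x * moll u (E k) x" for x
      using lower[OF E, of x k] by (simp add: indicator_def m_def)
    moreover have "integrable lborel (\<lambda>x. \<mu> * m k * indicator ?Q x)"
      using emeasure_lborel_cbox_finite[of a b] by (intro integrable_mult_right integrable_real_indicator) auto
    moreover have "integrable lborel (\<lambda>x. indicator ?Q x * moll u (E k) x)"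
      using int_f by (simp add: inner)
    ultimately have "(LINT x|lborel. \<mu> * m k * indicator ?Q x) \<le> (LINT x|lborel. indicator ?Q x * moll u (E k) x)"
      by (intro Bochner_Integration.integral_mono)
    also have "\<dots> = (LINT y|lborel. LINT x|lborel. f y x)"
      using swap by (simp add: inner)
    also have "\<dots> = m k * (LINT y|lborel. u y * g k y)"
      using m[of k] by (simp add: f_def g_def h_def)
    finally have "m k * (\<mu> * measure lborel ?Q) \<le> m k * (LINT y|lborel. u y * g k y)"
      by (simp add: mult_ac)
    then show ?thesis
      using m[of k] by simp
  qed
  have "(\<lambda>k. LINT y|lborel. u y * g k y) \<longlonglongrightarrow> (LINT y|lborel. u y * indicator ?Q y)"
  proof (rule integral_dominated_convergence)
    show "integrable lborel (\<lambda>y. u y * indicator (cball 0 (K + e0)) y)"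
      by (rule integrable_mult_bounded_set[of _ 1 "cball 0 (K + e0)"])
        (auto intro!: borel_measurable_indicator)
    have "?Q - box a b \<in> null_sets lborel"
      using negligible_frontier_interval[of a b]
      by (simp add: negligible_iff_null_sets null_sets_completion_iff)
    then have "AE y in lborel. y \<notin> ?Q - box a b"
      by (rule AE_not_in)
    then show "AE y in lborel. (\<lambda>k. u y * g k y) \<longlonglongrightarrow> u y * indicator ?Q y"
    proof eventually_elim
      fix y assume y: "y \<notin> ?Q - box a b"
      \<comment> \<open>Off the boundary of the box, a whole neighbourhood of \<open>y\<close> lies on one side of it.\<close>
      have "open (if y \<in> ?Q then box a b else - ?Q)" "y \<in> (if y \<in> ?Q then box a b else - ?Q)"
        using y by (auto simp: open_Compl)
      then obtain \<delta> where \<delta>: "0 < \<delta>" "ball y \<delta> \<subseteq> (if y \<in> ?Q then box a b else - ?Q)"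
        by (rule openE)
      have "\<forall>\<^sub>F k in sequentially. E k < \<delta>"
        using E_lim \<delta>(1) by (rule order_tendstoD)
      then have "\<forall>\<^sub>F k in sequentially. g k y = indicator ?Q y"
      proof eventually_elim
        fix k assume k: "E k < \<delta>"
        then have sub: "ball y (E k) \<subseteq> (if y \<in> ?Q then box a b else - ?Q)"
          using \<delta>(2) by (meson less_imp_le subset_ball subset_trans)
        show "g k y = indicator ?Q y"
        proof (cases "y \<in> ?Q")
          case True
          with sub box_subset_cbox[of a b] show ?thesis
            using g_inside[of y k] by auto
        next
          case False
          with sub show ?thesis
            using g_outside[of y k] by auto
        qed
      qed
      then have "(\<lambda>k. g k y) \<longlonglongrightarrow> indicator ?Q y"
        by (rule tendsto_eventually)
      then show "(\<lambda>k. u y * g k y) \<longlonglongrightarrow> u y * indicator ?Q y"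
        by (intro tendsto_intros)
    qed
    show "AE y in lborel. norm (u y * g k y) \<le> u y * indicator (cball 0 (K + e0)) y" for k
    proof (rule AE_I2)
      fix y
      have "u y * g k y \<le> u y * indicator (cball 0 (K + e0)) y"
        using g01(2)[of k y] g_far[of y k] u_nonneg[of y]
        by (intro mult_left_mono) (auto simp: indicator_def simp del: mem_cball)
      then show "norm (u y * g k y) \<le> u y * indicator (cball 0 (K + e0)) y"
        using u_nonneg[of y] g01(1)[of k y] by simp
    qed
  qed measurable
  then show ?thesis
    using lower_k by (intro LIMSEQ_le_const) auto
qed

text \<open>
  Lebesgue's differentiation theorem for cubes: at almost every point \<open>u\<close> is the limit of its averages over small
  cubes, and these are bounded below by \<open>box_integral_lower_of_moll\<close>.
\<close>

lemma AE_lower_of_moll: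
  assumes e0: "0 < e0" and lower: "\<And>e x. 0 < e \<Longrightarrow> e < e0 \<Longrightarrow> x \<in> cball x\<^sub>0 R \<Longrightarrow>
    \<mu> * (e ^ CARD('n) * bump_mass TYPE('n)) \<le> moll u e x"
  shows "AE y in lborel. y \<in> ball x\<^sub>0 R \<longrightarrow> \<mu> \<le> u y"
proof -
  define f where "f y = u y * indicator (ball x\<^sub>0 R) y" for y
  have f_int: "integrable lborel f"
    unfolding f_def[abs_def]
    by (rule integrable_mult_bounded_set[of _ 1 "ball x\<^sub>0 R"])
      (auto intro!: borel_measurable_indicator)
  have "f integrable_on cbox a b" for a b
    by (rule integrable_on_subcbox[OF integrable_on_lborel[OF f_int]]) simp
  from integrable_ccontinuous_explicit[OF this] obtain N where N: "negligible N"
      "\<And>x e. x \<notin> N \<Longrightarrow> 0 < e \<Longrightarrow> \<exists>d>0. \<forall>h. 0 < h \<and> h < d \<longrightarrow>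
        norm (integral (cbox x (x + h *\<^sub>R One)) f /\<^sub>R h ^ DIM(real^'n) - f x) < e"
    by metis
  have "\<mu> \<le> u x" if x: "x \<notin> N" "x \<in> ball x\<^sub>0 R" for x
  proof (rule ccontr)
    assume "\<not> \<mu> \<le> u x"
    then have "0 < \<mu> - f x"
      using x by (simp add: f_def)
    from N(2)[OF x(1) this] obtain d where d: "0 < d" "\<And>h. 0 < h \<Longrightarrow> h < d \<Longrightarrow>
        norm (integral (cbox x (x + h *\<^sub>R One)) f /\<^sub>R h ^ DIM(real^'n) - f x) < \<mu> - f x"
      by blast
    obtain \<rho> where \<rho>: "0 < \<rho>" "ball x \<rho> \<subseteq> ball x\<^sub>0 R"
      using openE[OF open_ball x(2)] by blast
    let ?c = "norm (One :: real^'n) + 1"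
    \<comment> \<open>Small enough for the differentiation theorem and for the cube to stay inside the ball.\<close>
    define h where "h = min (d / 2) (\<rho> / ?c / 2)"
    have c: "0 < ?c" by (simp add: add_nonneg_pos)
    have h: "0 < h" "h < d" "h * ?c < \<rho>"
    proof -
      show "0 < h" "h < d" using d(1) \<rho>(1) c by (auto simp: h_def)
      have "h * ?c \<le> (\<rho> / ?c / 2) * ?c"
        using c by (intro mult_right_mono) (auto simp: h_def)
      also have "\<dots> = \<rho> / 2"
      proof -
        have "(\<rho> / t / 2) * t = \<rho> / 2" if "0 < t" for t
          using that by simp
        from this[OF c] show ?thesis .
      qed
      finally show "h * ?c < \<rho>" using \<rho>(1) by simp
    qed
    let ?Q = "cbox x (x + h *\<^sub>R One)"
    have Q: "?Q \<subseteq> ball x \<rho>"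
    proof
      fix y assume "y \<in> ?Q"
      then have "norm (y - x) \<le> norm (h *\<^sub>R (One :: real^'n))"
        by (intro norm_le_componentwise) (auto simp: mem_box inner_diff_left inner_add_left)
      also have "\<dots> \<le> h * ?c"
        using h(1) by simp
      finally show "y \<in> ball x \<rho>"
        using h(3) by (simp add: dist_norm norm_minus_commute)
    qed
    have "\<mu> * measure lborel ?Q \<le> (LINT y|lborel. u y * indicator ?Q y)"
    proof (rule box_integral_lower_of_moll[OF e0 lower])
      show "y \<in> cball x\<^sub>0 R" if "y \<in> ?Q" for y
        using that Q \<rho>(2) by (auto simp: subset_iff intro: less_imp_le)
    qed
    also have "(LINT y|lborel. u y * indicator ?Q y) = (LINT y:?Q|lborel. f y)"
      unfolding set_lebesgue_integral_def using Q \<rho>(2)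
      by (intro Bochner_Integration.integral_cong) (auto simp: f_def indicator_def subset_iff)
    also have "\<dots> = integral ?Q f"
    proof (rule set_borel_integral_eq_integral)
      show "set_integrable lborel ?Q f"
        unfolding set_integrable_def
        by (rule integrable_mult_indicator[OF _ f_int]) simp
    qed
    also have "measure lborel ?Q = h ^ DIM(real^'n)"
      using h(1) by (simp add: measure_lborel_cbox_eq inner_add_left)
    finally have "\<mu> \<le> integral ?Q f /\<^sub>R h ^ DIM(real^'n)"
      using h(1) by (simp add: field_simps)
    with d(2)[OF h(1,2)] show False
      by simp
  qed
  then have bound: "x \<notin> N \<Longrightarrow> x \<in> ball x\<^sub>0 R \<longrightarrow> \<mu> \<le> u x" for x
    by blast
  have "N \<in> null_sets lebesgue"
    using N(1) by (simp only: negligible_iff_null_sets)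
  then have "AE x in lebesgue. x \<notin> N"
    by (rule AE_not_in)
  then have "AE x in lborel. x \<notin> N"
    by (simp only: AE_completion_iff)
  then show ?thesis
    by eventually_elim (rule bound)
qed

end

section \<open>The lower bound\<close>

text \<open>
  All quantities in \<open>min_point_estimate\<close> scale: the gain and the tail of the kernel both carry the factor
  \<open>r\<^sup>-\<^sup>2\<^sup>s\<close>, and the drift terms can be multiplied by it because \<open>r \<le> 1\<close>. Hence the constant does not depend on \<open>r\<close>.
  The dependence on \<open>r\<close> is confined to the threshold for \<open>e\<close>.
\<close>

lemma moll_lower_bound:
  fixes s M :: real
  assumes s: "0 < s" "s < 1" and M: "0 < M"
  shows "\<exists>\<alpha>>0. \<forall>(x\<^sub>0 :: real^'n::finite) r (b :: real^'n \<Rightarrow> real^'n) c m (u :: real^'n \<Rightarrow> real).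
    0 < r \<and> r \<le> 1 \<and> C1_on (ball x\<^sub>0 r) b \<and> C1_norm (ball x\<^sub>0 r) b \<le> ennreal M \<and>
    (\<forall>x\<in>ball x\<^sub>0 r. c x \<le> M) \<and> 0 < m \<and>
    u \<in> borel_measurable borel \<and> (\<forall>y. 0 \<le> u y) \<and> integrable lborel (\<lambda>y. u y * decay s y) \<and>
    locally_integrable_on (\<lambda>x. c x * u x) (ball x\<^sub>0 r) \<and>
    distributional_supersolution s (ball x\<^sub>0 r) b c u \<and>
    (AE x in lborel. x \<in> ball x\<^sub>0 r - ball x\<^sub>0 (r / 2) \<longrightarrow> m \<le> u x) \<longrightarrow>
    (\<exists>e0>0. \<forall>e x. 0 < e \<and> e < e0 \<and> x \<in> cball x\<^sub>0 (3 / 4 * r) \<longrightarrow>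
      \<alpha> * m * (e ^ CARD('n) * bump_mass TYPE('n)) \<le> moll u e x)"
proof -
  define p where "p = real CARD('n) + 2 * s"
  define \<omega> where "\<omega> = measure lborel (ball (0 :: real^'n) 1)"
  define \<beta> where "\<beta> = bump_mass TYPE('n)"
  define k where "k = frac_laplacian_const CARD('n) s"
  obtain L where L: "0 < L" "\<And>(a :: real^'n) e y. 0 < e \<Longrightarrow> norm (grad (bump_at a e) y) \<le> L / e"
    using grad_bump_at_bound by blast
  obtain K where K: "0 < K" "\<And>d. 0 < d \<Longrightarrow> (LINT z|lborel. trunc_kern s d (z :: real^'n)) \<le> K * d powr (- (2 * s))"
    using kern_tail(2)[OF s(1), where ?'n = 'n] unfolding trunc_kern_def by blast
  have \<beta>: "0 < \<beta>" unfolding \<beta>_def by (rule bump_mass_pos)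
  have k: "0 < k" unfolding k_def by (rule frac_laplacian_const_pos[OF s])
  have \<omega>: "0 < \<omega>" unfolding \<omega>_def by (rule content_ball_pos) simp
  \<comment> \<open>The coefficients of \<open>\<mu>\<close> and of the minimum in \<open>min_point_estimate\<close>, divided by \<open>r powr (- (2 * s))\<close>; for the
    drift terms this division is replaced by the upper bound \<open>drift\<close>.\<close>
  define num where "num = k * (1 / 2 powr p * ((1 / 32) ^ CARD('n) * \<omega>))"
  define drift where "drift = 2 * M * L * 2 ^ CARD('n) * \<omega> / \<beta> + (real CARD('n) + 1) * M"
  define den where "den = k * (K * 8 powr (2 * s)) + drift"
  have drift: "0 \<le> drift"
    unfolding drift_def using M L(1) \<omega> \<beta> by (intro add_nonneg_nonneg mult_nonneg_nonneg divide_nonneg_nonneg) auto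
  have num: "0 < num" and den: "0 < den"
    using k \<omega> K(1) drift by (auto simp: num_def den_def intro!: add_pos_nonneg)
  define \<alpha> where "\<alpha> = min 1 (num / den)"
  have \<alpha>: "0 < \<alpha>" "\<alpha> \<le> 1" "\<alpha> * den \<le> num"
  proof -
    show "0 < \<alpha>" "\<alpha> \<le> 1" using num den by (auto simp: \<alpha>_def)
    have "\<alpha> * den \<le> num / den * den"
      using den by (intro mult_right_mono) (auto simp: \<alpha>_def)
    with den show "\<alpha> * den \<le> num" by simp
  qed
  have "\<exists>e0>0. \<forall>e x. 0 < e \<and> e < e0 \<and> x \<in> cball x\<^sub>0 (3 / 4 * r) \<longrightarrow> \<alpha> * m * (e ^ CARD('n) * \<beta>) \<le> moll u e x"
    if r: "0 < r" "r \<le> 1" and C1: "C1_on (ball x\<^sub>0 r) b" "C1_norm (ball x\<^sub>0 r) b \<le> ennreal M"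
      and c: "\<forall>x\<in>ball x\<^sub>0 r. c x \<le> M" and m: "0 < m"
      and u: "u \<in> borel_measurable borel" "\<forall>y. 0 \<le> u y" "integrable lborel (\<lambda>y. u y * decay s y)"
      and cu: "locally_integrable_on (\<lambda>x. c x * u x) (ball x\<^sub>0 r)"
      and super: "distributional_supersolution s (ball x\<^sub>0 r) b c u"
      and lower: "AE x in lborel. x \<in> ball x\<^sub>0 r - ball x\<^sub>0 (r / 2) \<longrightarrow> m \<le> u x"
    for x\<^sub>0 :: "real^'n" and r b c m u
  proof -
    interpret W: nonneg_weighted u s
      using s u by unfold_locales auto
    \<comment> \<open>The condition \<open>e powr (2 * s) \<le> q\<close> is the smallness required in \<open>min_point_estimate\<close>.\<close>
    define q where "q = k * \<beta> / (2 * M * L * 2 powr p)"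
    have q: "0 < q" using k \<beta> M L(1) by (simp add: q_def)
    define e0 where "e0 = min (r / 32) (q powr (1 / (2 * s)))"
    have "0 < e0" using r q by (simp add: e0_def)
    moreover have "\<alpha> * m * (e ^ CARD('n) * \<beta>) \<le> moll u e x"
      if e: "0 < e" "e < e0" and x: "x \<in> cball x\<^sub>0 (3 / 4 * r)" for e x
    proof -
      let ?w = "moll u e" and ?\<mu> = "m * (e ^ CARD('n) * \<beta>)"
      have e32: "32 * e \<le> r" using e by (simp add: e0_def)
      have "e powr (2 * s) \<le> (q powr (1 / (2 * s))) powr (2 * s)"
        using e s by (intro powr_mono2) (auto simp: e0_def)
      also have "\<dots> = q" using q s by (simp add: powr_powr)
      finally have eq: "e powr (2 * s) \<le> q" .
      have small: "2 * M * L * (2 * e) powr p \<le> k * (e ^ CARD('n) * \<beta>)"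
      proof -
        have "(2 * e) powr p = 2 powr p * (e ^ CARD('n) * e powr (2 * s))"
          using e(1) by (simp add: p_def powr_mult powr_add powr_realpow)
        also have "2 * M * L * \<dots> \<le> 2 * M * L * (2 powr p * (e ^ CARD('n) * q))"
          using eq e(1) M L(1) by (intro mult_left_mono) auto
        also have "\<dots> = k * (e ^ CARD('n) * \<beta>)"
          using M L(1) by (simp add: q_def)
        finally show ?thesis .
      qed
      have annulus: "?\<mu> \<le> ?w y" if "r / 2 + e \<le> norm (y - x\<^sub>0)" "norm (y - x\<^sub>0) + e \<le> r" for y
        unfolding \<beta>_def
      proof (rule W.moll_lower_of_AE[OF _ e(1)])
        have "z \<in> ball x\<^sub>0 r - ball x\<^sub>0 (r / 2)" if "z \<in> ball y e" for z
        proof -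
          have z: "norm (z - y) < e" using that by (simp add: dist_norm norm_minus_commute)
          have "norm (z - x\<^sub>0) \<le> norm (z - y) + norm (y - x\<^sub>0)"
            using norm_triangle_ineq[of "z - y" "y - x\<^sub>0"] by simp
          moreover have "norm (y - x\<^sub>0) \<le> norm (z - x\<^sub>0) + norm (z - y)"
            using norm_triangle_ineq4[of "z - x\<^sub>0" "z - y"] by simp
          ultimately have "norm (z - x\<^sub>0) < r" "r / 2 \<le> norm (z - x\<^sub>0)"
            using z \<open>r / 2 + e \<le> norm (y - x\<^sub>0)\<close> \<open>norm (y - x\<^sub>0) + e \<le> r\<close> by linarith+
          then show ?thesis by (simp add: dist_norm norm_minus_commute)
        qed
        with lower show "AE z in lborel. z \<in> ball y e \<longrightarrow> m \<le> u z"
          by (auto elim: eventually_mono)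
      qed
      have "\<exists>a\<in>cball x\<^sub>0 (3 / 4 * r). \<forall>y\<in>cball x\<^sub>0 (3 / 4 * r). ?w a \<le> ?w y"
        by (intro continuous_attains_inf W.continuous_moll[OF e(1)])
          (use r in auto)
      then obtain a where a: "a \<in> cball x\<^sub>0 (3 / 4 * r)" "\<And>y. y \<in> cball x\<^sub>0 (3 / 4 * r) \<Longrightarrow> ?w a \<le> ?w y"
        by blast
      have \<mu>0: "0 \<le> ?\<mu>" using m e(1) \<beta> by simp
      have "\<alpha> * ?\<mu> \<le> ?w a"
      proof (cases "r / 2 + e \<le> norm (a - x\<^sub>0)")
        case True
        have "\<alpha> * ?\<mu> \<le> 1 * ?\<mu>"
          using \<alpha>(2) \<mu>0 by (rule mult_right_mono)
        also have "\<dots> \<le> ?w a"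
          using annulus[OF True] a(1) e32 r by (simp add: dist_norm norm_minus_commute)
        finally show ?thesis .
      next
        case False
        let ?T = "K * (r / 8) powr (- (2 * s))"
        have "k * ?\<mu> * ((1 / (2 * r) powr p) * ((r / 32) ^ CARD('n) * \<omega>)) \<le>
            ?w a * (k * ?T + 2 * M * L * 2 ^ CARD('n) * \<omega> / \<beta> + (real CARD('n) + 1) * M)"
          unfolding p_def \<omega>_def \<beta>_def k_def
        proof (rule W.min_point_estimate[OF s(2) C1(1) C1(2)])
          show "(LINT z|lborel. trunc_kern s (r / 8) (z :: real^'n)) \<le> ?T"
            using r by (intro K(2)) simp
          show "2 * M * L * (2 * e) powr (real CARD('n) + 2 * s) \<le>
              frac_laplacian_const CARD('n) s * (e ^ CARD('n) * bump_mass TYPE('n))"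
            using small by (simp only: p_def k_def \<beta>_def)
          show "m * (e ^ CARD('n) * bump_mass TYPE('n)) \<le> ?w y"
            if "11 / 16 * r \<le> norm (y - x\<^sub>0)" "norm (y - x\<^sub>0) \<le> 3 / 4 * r" for y
            using annulus[of y] that e32 r unfolding \<beta>_def by simp
          show "norm (grad (bump_at a e) y) \<le> L / e" for y
            by (rule L(2)[OF e(1)])
        qed (use M c cu super e e32 L(1) False a(2) \<mu>0 in \<open>auto simp: \<beta>_def\<close>)
        also have "k * ?\<mu> * ((1 / (2 * r) powr p) * ((r / 32) ^ CARD('n) * \<omega>)) = ?\<mu> * num * r powr (- (2 * s))"
        proof -
          have "(2 * r) powr p = 2 powr p * (r ^ CARD('n) * r powr (2 * s))"
            using r by (simp add: p_def powr_mult powr_add powr_realpow)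
          then show ?thesis
            using r by (simp add: num_def powr_minus power_divide divide_simps)
        qed
        also have "?T = K * 8 powr (2 * s) * r powr (- (2 * s))"
          using r by (simp add: powr_divide powr_minus divide_simps)
        also have "?w a * (k * (K * 8 powr (2 * s) * r powr (- (2 * s))) + 2 * M * L * 2 ^ CARD('n) * \<omega> / \<beta> + (real CARD('n) + 1) * M) \<le>
            ?w a * (den * r powr (- (2 * s)))"
        proof (rule mult_left_mono)
          have "r powr (2 * s) \<le> 1 powr (2 * s)"
            using r s by (intro powr_mono2) auto
          then have "1 \<le> r powr (- (2 * s))"
            using r by (simp add: powr_minus one_le_inverse_iff)
          then have "drift * 1 \<le> drift * r powr (- (2 * s))"
            using drift by (rule mult_left_mono)
          moreover have "den * r powr (- (2 * s)) =
              k * (K * 8 powr (2 * s) * r powr (- (2 * s))) + drift * r powr (- (2 * s))"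
            by (simp add: den_def distrib_right mult.assoc)
          ultimately show "k * (K * 8 powr (2 * s) * r powr (- (2 * s))) + 2 * M * L * 2 ^ CARD('n) * \<omega> / \<beta> + (real CARD('n) + 1) * M
              \<le> den * r powr (- (2 * s))"
            using drift_def by linarith
          show "0 \<le> ?w a"
            by (rule W.moll_nonneg)
        qed
        finally have "(?\<mu> * num) * r powr (- (2 * s)) \<le> (?w a * den) * r powr (- (2 * s))"
          by (simp only: mult.assoc)
        then have "?\<mu> * num \<le> ?w a * den"
          using r by simp
        moreover have "?\<mu> * (\<alpha> * den) \<le> ?\<mu> * num"
          using \<alpha>(3) \<mu>0 by (rule mult_left_mono)
        ultimately have "(\<alpha> * ?\<mu>) * den \<le> ?w a * den"
          by (simp add: mult_ac)
        then show ?thesis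
          using den by simp
      qed
      also have "\<dots> \<le> ?w x"
        using x by (rule a(2))
      finally show ?thesis
        by (simp only: mult.assoc)
    qed
    ultimately show ?thesis by blast
  qed
  then show ?thesis
    unfolding \<beta>_def by (intro exI[of _ \<alpha>] conjI \<alpha>(1)) blast
qed

lemma drift_integrand_measurable:
  fixes b :: "real^'n::finite \<Rightarrow> real^'n" and v :: "real^'n \<Rightarrow> real"
  assumes C1: "C1_on U b" and U: "open U" and c: "c \<in> borel_measurable (lebesgue_on U)"
    and test: "\<phi> \<in> test_functions U" and v: "v \<in> borel_measurable lebesgue"
  shows "(\<lambda>x. indicator U x *\<^sub>R (v x * (- divergence (\<lambda>y. \<phi> y *\<^sub>R b y) x + c x * \<phi> x))) \<in> borel_measurable lebesgue"
proof -
  have c': "(\<lambda>x. indicator U x *\<^sub>R c x) \<in> borel_measurable lebesgue"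
    using c U by (subst (asm) borel_measurable_restrict_space_iff) auto
  have \<phi>: "\<phi> \<in> borel_measurable lebesgue"
    using test_function_borel[OF test] by (intro measurable_completion) simp
  have d: "(\<lambda>x. indicator U x * (\<phi> x * jacobian_trace b x + grad \<phi> x \<bullet> b x)) \<in> borel_measurable lebesgue"
    using drift_coefficient_borel[OF C1 U test] by (intro measurable_completion) simp
  have "(\<lambda>x. indicator U x *\<^sub>R (v x * (- divergence (\<lambda>y. \<phi> y *\<^sub>R b y) x + c x * \<phi> x))) =
      (\<lambda>x. v x * (- (indicator U x * (\<phi> x * jacobian_trace b x + grad \<phi> x \<bullet> b x)) + (indicator U x *\<^sub>R c x) * \<phi> x))"
  proof (rule ext)
    fix x
    show "indicator U x *\<^sub>R (v x * (- divergence (\<lambda>y. \<phi> y *\<^sub>R b y) x + c x * \<phi> x)) =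
      v x * (- (indicator U x * (\<phi> x * jacobian_trace b x + grad \<phi> x \<bullet> b x)) + (indicator U x *\<^sub>R c x) * \<phi> x)"
    proof (cases "x \<in> U")
      case True
      then have "b differentiable (at x)" using C1 by (simp add: C1_on_def)
      with True show ?thesis by (simp add: divergence_scaleR[OF test])
    qed simp
  qed
  also have "\<dots> \<in> borel_measurable lebesgue"
    by (intro borel_measurable_times borel_measurable_add borel_measurable_uminus v d c' \<phi>)
  finally show ?thesis .
qed

text \<open>
  Replacing \<open>u\<close> by a Borel representative must not disturb the inequality. Since the Bochner integral is \<open>0\<close> for
  nonmeasurable integrands, this uses the measurability of both integrands.
\<close>

lemma distributional_supersolution_cong_AE:
  fixes b :: "real^'n::finite \<Rightarrow> real^'n" and u v :: "real^'n \<Rightarrow> real"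
  assumes s: "0 < s" "s < 1" and C1: "C1_on U b" and U: "open U" and c: "c \<in> borel_measurable (lebesgue_on U)"
    and u: "u \<in> borel_measurable lebesgue" and v: "v \<in> borel_measurable lebesgue"
    and eq: "AE x in lebesgue. u x = v x"
    and super: "distributional_supersolution s U b c u"
  shows "distributional_supersolution s U b c v"
  unfolding distributional_supersolution_def
proof (intro ballI impI)
  fix \<phi> assume test: "\<phi> \<in> test_functions U" and "\<forall>x. 0 \<le> \<phi> x"
  then have "0 \<le> (LINT x|lebesgue. u x * frac_laplacian s \<phi> x) +
      (LINT x:U|lebesgue. u x * (- divergence (\<lambda>y. \<phi> y *\<^sub>R b y) x + c x * \<phi> x))"
    using super by (simp add: distributional_supersolution_def)
  also have "(LINT x|lebesgue. u x * frac_laplacian s \<phi> x) = (LINT x|lebesgue. v x * frac_laplacian s \<phi> x)"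
  proof (rule integral_cong_AE)
    have "frac_laplacian s \<phi> \<in> borel_measurable lebesgue"
      using frac_laplacian_borel[OF s test] by (intro measurable_completion) simp
    with u v show "(\<lambda>x. u x * frac_laplacian s \<phi> x) \<in> borel_measurable lebesgue"
        "(\<lambda>x. v x * frac_laplacian s \<phi> x) \<in> borel_measurable lebesgue"
      by auto
    show "AE x in lebesgue. u x * frac_laplacian s \<phi> x = v x * frac_laplacian s \<phi> x"
      using eq by eventually_elim simp
  qed
  also have "(LINT x:U|lebesgue. u x * (- divergence (\<lambda>y. \<phi> y *\<^sub>R b y) x + c x * \<phi> x)) =
      (LINT x:U|lebesgue. v x * (- divergence (\<lambda>y. \<phi> y *\<^sub>R b y) x + c x * \<phi> x))"
    unfolding set_lebesgue_integral_def
  proof (rule integral_cong_AE)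
    show "AE x in lebesgue. indicator U x *\<^sub>R (u x * (- divergence (\<lambda>y. \<phi> y *\<^sub>R b y) x + c x * \<phi> x)) =
        indicator U x *\<^sub>R (v x * (- divergence (\<lambda>y. \<phi> y *\<^sub>R b y) x + c x * \<phi> x))"
      using eq by eventually_elim simp
  qed (rule drift_integrand_measurable[OF C1 U c test u], rule drift_integrand_measurable[OF C1 U c test v])
  finally show "0 \<le> (LINT x|lebesgue. v x * frac_laplacian s \<phi> x) +
      (LINT x:U|lebesgue. v x * (- divergence (\<lambda>y. \<phi> y *\<^sub>R b y) x + c x * \<phi> x))" .
qed

theorem theorem1p6:
  fixes s M :: real
  assumes "CARD('n::finite) \<ge> 2" and "0 < s" and "s < 1" and "0 < M"
  shows "\<exists>\<alpha>>0. \<forall>(x\<^sub>0 :: real^'n) (r::real) (b :: real^'n \<Rightarrow> real^'n)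
           (c :: real^'n \<Rightarrow> real) (m::real) (u :: real^'n \<Rightarrow> real).
      0 < r \<and> r \<le> 1 \<and>
      C1_on (ball x\<^sub>0 r) b \<and> C1_norm (ball x\<^sub>0 r) b \<le> ennreal M \<and>
      c \<in> borel_measurable (lebesgue_on (ball x\<^sub>0 r)) \<and>
      (\<forall>x\<in>ball x\<^sub>0 r. c x \<le> M) \<and>
      0 < m \<and>
      u \<in> weighted_L1 (2 * s) \<and>
      locally_integrable_on (\<lambda>x. c x * u x) (ball x\<^sub>0 r) \<and>
      distributional_supersolution s (ball x\<^sub>0 r) b c u \<and>
      (AE x in lebesgue. x \<in> ball x\<^sub>0 r - ball x\<^sub>0 (r / 2) \<longrightarrow> m \<le> u x) \<and>
      (AE x in lebesgue. 0 \<le> u x)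
      \<longrightarrow> (AE x in lebesgue. x \<in> ball x\<^sub>0 r \<longrightarrow> \<alpha> * m \<le> u x)"
proof -
  obtain \<alpha>' where \<alpha>': "0 < \<alpha>'" and moll: "\<And>(x\<^sub>0 :: real^'n) r (b :: real^'n \<Rightarrow> real^'n) c m (u :: real^'n \<Rightarrow> real).
    0 < r \<and> r \<le> 1 \<and> C1_on (ball x\<^sub>0 r) b \<and> C1_norm (ball x\<^sub>0 r) b \<le> ennreal M \<and>
    (\<forall>x\<in>ball x\<^sub>0 r. c x \<le> M) \<and> 0 < m \<and>
    u \<in> borel_measurable borel \<and> (\<forall>y. 0 \<le> u y) \<and> integrable lborel (\<lambda>y. u y * decay s y) \<and>
    locally_integrable_on (\<lambda>x. c x * u x) (ball x\<^sub>0 r) \<and>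
    distributional_supersolution s (ball x\<^sub>0 r) b c u \<and>
    (AE x in lborel. x \<in> ball x\<^sub>0 r - ball x\<^sub>0 (r / 2) \<longrightarrow> m \<le> u x) \<Longrightarrow>
    \<exists>e0>0. \<forall>e x. 0 < e \<and> e < e0 \<and> x \<in> cball x\<^sub>0 (3 / 4 * r) \<longrightarrow>
      \<alpha>' * m * (e ^ CARD('n) * bump_mass TYPE('n)) \<le> moll u e x"
    using moll_lower_bound[OF assms(2-4), where ?'n = 'n] by blast
  define \<alpha> where "\<alpha> = min 1 \<alpha>'"
  have \<alpha>: "0 < \<alpha>" "\<alpha> \<le> 1" "\<alpha> \<le> \<alpha>'"
    using \<alpha>' by (auto simp: \<alpha>_def)
  have "AE x in lebesgue. x \<in> ball x\<^sub>0 r \<longrightarrow> \<alpha> * m \<le> u x"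
    if r: "0 < r" "r \<le> 1" and C1: "C1_on (ball x\<^sub>0 r) b" "C1_norm (ball x\<^sub>0 r) b \<le> ennreal M"
      and c: "c \<in> borel_measurable (lebesgue_on (ball x\<^sub>0 r))" "\<forall>x\<in>ball x\<^sub>0 r. c x \<le> M" and m: "0 < m"
      and u: "u \<in> weighted_L1 (2 * s)"
      and cu: "locally_integrable_on (\<lambda>x. c x * u x) (ball x\<^sub>0 r)"
      and super: "distributional_supersolution s (ball x\<^sub>0 r) b c u"
      and lower: "AE x in lebesgue. x \<in> ball x\<^sub>0 r - ball x\<^sub>0 (r / 2) \<longrightarrow> m \<le> u x"
      and nonneg: "AE x in lebesgue. 0 \<le> u x"
    for x\<^sub>0 :: "real^'n" and r b c m and u :: "real^'n \<Rightarrow> real"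
  proof -
    have u_meas: "u \<in> borel_measurable lebesgue"
      and u_int: "integrable lebesgue (\<lambda>y. \<bar>u y\<bar> / (1 + norm y powr (real CARD('n) + 2 * s)))"
      using u by (auto simp: weighted_L1_def)
    obtain u' where u': "u' \<in> borel_measurable lborel" "AE x in lborel. u x = u' x"
      using completion_ex_borel_measurable_real[OF u_meas] by blast
    define v where "v x = max 0 (u' x)" for x
    have v_borel [measurable]: "v \<in> borel_measurable borel"
      unfolding v_def[abs_def] using u'(1) by simp
    have v_nonneg: "0 \<le> v x" for x by (simp add: v_def)
    have v_meas: "v \<in> borel_measurable lebesgue"
      by (rule measurable_completion) simp
    have eq: "AE x in lebesgue. u x = v x"
      using AE_completion[OF u'(2)] nonneg by eventually_elim (simp add: v_def)
    have v_int: "integrable lborel (\<lambda>y. v y * decay s y)"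
    proof -
      have "integrable lebesgue (\<lambda>y. v y * decay s y)"
      proof (rule integrable_cong_AE_imp[OF u_int])
        show "(\<lambda>y. v y * decay s y) \<in> borel_measurable lebesgue"
          by (rule measurable_completion) (simp add: decay_def[abs_def])
        show "AE y in lebesgue. \<bar>u y\<bar> / (1 + norm y powr (real CARD('n) + 2 * s)) = v y * decay s y"
          using eq by eventually_elim (simp add: decay_def v_nonneg)
      qed
      then show ?thesis
        by (subst (asm) integrable_completion) (auto simp: decay_def[abs_def])
    qed
    have cv: "locally_integrable_on (\<lambda>x. c x * v x) (ball x\<^sub>0 r)"
      unfolding locally_integrable_on_def set_integrable_def
    proof (intro allI impI)
      fix S :: "(real^'n) set" assume S: "compact S \<and> S \<subseteq> ball x\<^sub>0 r"
      have c': "(\<lambda>x. indicator (ball x\<^sub>0 r) x *\<^sub>R c x) \<in> borel_measurable lebesgue"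
        using c(1) by (subst (asm) borel_measurable_restrict_space_iff) auto
      show "integrable lebesgue (\<lambda>x. indicator S x *\<^sub>R (c x * v x))"
      proof (rule integrable_cong_AE_imp)
        show "integrable lebesgue (\<lambda>x. indicator S x *\<^sub>R (c x * u x))"
          using cu S unfolding locally_integrable_on_def set_integrable_def by blast
        show "AE x in lebesgue. indicator S x *\<^sub>R (c x * u x) = indicator S x *\<^sub>R (c x * v x)"
          using eq by eventually_elim simp
        have "(indicator S :: real^'n \<Rightarrow> real) \<in> borel_measurable lebesgue"
          using S by (intro borel_measurable_indicator) (auto intro: fmeasurableD lmeasurable_compact)
        then have "(\<lambda>x. indicator S x * ((indicator (ball x\<^sub>0 r) x *\<^sub>R c x) * v x)) \<in> borel_measurable lebesgue"
          by (intro borel_measurable_times c' v_meas)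
        also have "(\<lambda>x. indicator S x * ((indicator (ball x\<^sub>0 r) x *\<^sub>R c x) * v x)) =
            (\<lambda>x. indicator S x *\<^sub>R (c x * v x))"
          using S by (auto simp: indicator_def fun_eq_iff)
        finally show "(\<lambda>x. indicator S x *\<^sub>R (c x * v x)) \<in> borel_measurable lebesgue" .
      qed
    qed
    have "AE x in lebesgue. x \<in> ball x\<^sub>0 r - ball x\<^sub>0 (r / 2) \<longrightarrow> m \<le> v x"
      using eq lower by eventually_elim simp
    then have lower': "AE x in lborel. x \<in> ball x\<^sub>0 r - ball x\<^sub>0 (r / 2) \<longrightarrow> m \<le> v x"
      by (simp only: AE_completion_iff)
    have "distributional_supersolution s (ball x\<^sub>0 r) b c v"
      by (rule distributional_supersolution_cong_AE[OF assms(2,3) C1(1) open_ball c(1) u_meas v_meas eq super])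
    then obtain e0 where e0: "0 < e0" "\<And>e x. 0 < e \<Longrightarrow> e < e0 \<Longrightarrow> x \<in> cball x\<^sub>0 (3 / 4 * r) \<Longrightarrow>
        \<alpha>' * m * (e ^ CARD('n) * bump_mass TYPE('n)) \<le> moll v e x"
      using moll[of r x\<^sub>0 b c m v] r C1 c(2) m v_borel v_nonneg v_int cv lower' by blast
    interpret W: nonneg_weighted v s
      using assms(2) v_borel v_nonneg v_int by unfold_locales
    have "AE x in lborel. x \<in> ball x\<^sub>0 (3 / 4 * r) \<longrightarrow> \<alpha>' * m \<le> v x"
      by (rule W.AE_lower_of_moll[OF e0])
    from AE_completion[OF this] lower eq show ?thesis
    proof eventually_elim
      fix x
      assume inner: "x \<in> ball x\<^sub>0 (3 / 4 * r) \<longrightarrow> \<alpha>' * m \<le> v x"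
        and outer: "x \<in> ball x\<^sub>0 r - ball x\<^sub>0 (r / 2) \<longrightarrow> m \<le> u x" and eq: "u x = v x"
      show "x \<in> ball x\<^sub>0 r \<longrightarrow> \<alpha> * m \<le> u x"
      proof
        assume x: "x \<in> ball x\<^sub>0 r"
        have "\<alpha> * m \<le> \<alpha>' * m" "\<alpha> * m \<le> 1 * m"
          using \<alpha> m by (auto intro!: mult_right_mono)
        with x r inner outer eq show "\<alpha> * m \<le> u x"
          by (cases "x \<in> ball x\<^sub>0 (3 / 4 * r)") auto
      qed
    qed
  qed
  with \<alpha>(1) show ?thesis
    by blast
qed

end
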